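(* Let $m\geq2$. Then $SCH_0(\mathbb{R}^m)=SCH_{0,\mathcal{W},1^*}(\mathbb{R}^m)$ (as normed spaces of linear forms on $BV_{1^*}(\mathbb{R}^m)$).
   Context: $1^*=m/(m-1)$, whose Hölder conjugate is $m$; $\mathcal{L}^m$ is Lebesgue measure. $BV_{1^*}(\mathbb{R}^m)$ is the Banach space of $u\in L_{1^*}(\mathbb{R}^m)$ whose distributional partial derivatives are finite signed Borel measures, normed by the total variation $\|Du\|(\mathbb{R}^m)=\sup\{\int u\,\mathrm{div}\,v\,d\mathcal{L}^m:v\in C_c^\infty(\mathbb{R}^m;\mathbb{R}^m),\ \sup_x|v(x)|_2\leq1\}$. $SCH_0(\mathbb{R}^m)$ is the norm closure in the Banach dual $BV_{1^*}(\mathbb{R}^m)^*$ of the set of linear forms $u\mapsto\int uf\,d\mathcal{L}^m$, $f\in L_m(\mathbb{R}^m)$, with the dual norm. $SCH_{0,\mathcal{W},1^*}(\mathbb{R}^m)=BV_{1^*}(\mathbb{R}^m)[\mathcal{W}_{1^*,TV}]^*$ is the dual for the localized locally convex topology $\mathcal{W}_{1^*,TV}$ associated with the restriction of the weak topology $\sigma(L_{1^*},L_m)$ and the sets $\{u:\|Du\|(\mathbb{R}^m)\leq k\}$, $k\in\mathbb{N}$; it is exactly the space of linear forms $F$ on $BV_{1^*}(\mathbb{R}^m)$ such that for every $\varepsilon>0$ there are a finite non-empty set $E$ of functions $f\in L_m(\mathbb{R}^m)$ with $\|f\|_{L_m}=1$ and $\theta>0$ with $|\langle u,F\rangle|\leq\theta\max_{f\in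 E}|\int uf\,d\mathcal{L}^m|+\varepsilon\|Du\|(\mathbb{R}^m)$ for all $u$ (this can be taken as the definition). Its norm is $|||F|||=\sup\{|\langle u,F\rangle|:\|Du\|(\mathbb{R}^m)\leq1\}$. *)

theory Defs
  imports "HOL-Analysis.Analysis"
begin

text \<open>
  Throughout, \<open>real ^ 'n\<close> plays the role of \<open>R^m\<close> with \<open>m = CARD('n)\<close>.  Function spaces are sets of
  genuine functions rather than of almost-everywhere classes; linear forms on \<open>BV\<close> are required to
  respect almost-everywhere equality, so that they are exactly the linear forms on the space of classes.
\<close>

definition partial_deriv :: "'n \<Rightarrow> (real ^ 'n \<Rightarrow> real) \<Rightarrow> real ^ 'n \<Rightarrow> real" where
  "partial_deriv i f x = frechet_derivative f (at x) (axis i 1)"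

primrec Ck_fun :: "nat \<Rightarrow> (real ^ 'n \<Rightarrow> real) \<Rightarrow> bool" where
  "Ck_fun 0 f \<longleftrightarrow> continuous_on UNIV f"
| "Ck_fun (Suc k) f \<longleftrightarrow> f differentiable_on UNIV \<and> (\<forall>i. Ck_fun k (partial_deriv i f))"

definition test_funs :: "(real ^ 'n \<Rightarrow> real) set" where
  "test_funs = {\<phi>. (\<forall>k. Ck_fun k \<phi>) \<and> compact (closure {x. \<phi> x \<noteq> 0})}"

definition test_fields :: "(real ^ 'n \<Rightarrow> real ^ 'n) set" where
  "test_fields = {v. \<forall>i. (\<lambda>x. v x $ i) \<in> test_funs}"

definition divergence :: "(real ^ 'n \<Rightarrow> real ^ 'n) \<Rightarrow> real ^ 'n \<Rightarrow> real" where
  "divergence v x = (\<Sum>i\<in>UNIV. partial_deriv i (\<lambda>y. v y $ i) x)"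

definition Lp :: "real \<Rightarrow> (real ^ 'n \<Rightarrow> real) set" where
  "Lp p = {f \<in> borel_measurable lebesgue. integrable lebesgue (\<lambda>x. \<bar>f x\<bar> powr p)}"

definition Lp_norm :: "real \<Rightarrow> (real ^ 'n \<Rightarrow> real) \<Rightarrow> real" where
  "Lp_norm p f = (LINT x|lebesgue. \<bar>f x\<bar> powr p) powr (1 / p)"

text \<open>
  A finite signed Borel measure is given as a difference \<open>M - N\<close> of two finite Borel measures
  (Jordan decomposition), and integration against it is the difference of the two integrals.
\<close>

definition distr_partial_is_measure :: "'n \<Rightarrow> (real ^ 'n \<Rightarrow> real) \<Rightarrow> bool" where
  "distr_partial_is_measure i u \<longleftrightarrow>
    (\<exists>M N. finite_measure M \<and> sets M = sets borel \<and> finite_measure N \<and> sets N = sets borel \<and>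
      (\<forall>\<phi>\<in>test_funs.
        (LINT x|lebesgue. u x * partial_deriv i \<phi> x) = - ((LINT x|M. \<phi> x) - (LINT x|N. \<phi> x))))"

definition BV :: "(real ^ 'n \<Rightarrow> real) set" where
  "BV = {u \<in> Lp (real CARD('n) / (real CARD('n) - 1)). \<forall>i. distr_partial_is_measure i u}"

text \<open>The set under the supremum is bounded above whenever \<open>u \<in> BV\<close>, the only case used.\<close>

definition TV :: "(real ^ 'n \<Rightarrow> real) \<Rightarrow> real" where
  "TV u = (SUP v\<in>{v \<in> test_fields. \<forall>x. norm (v x) \<le> 1}. LINT x|lebesgue. u x * divergence v x)"

text \<open>Forms are set to \<open>0\<close> outside \<open>BV\<close>, so that equality of forms is equality on \<open>BV\<close>.\<close>

definition BV_linear_form :: "((real ^ 'n \<Rightarrow> real) \<Rightarrow> real) \<Rightarrow> bool" where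
  "BV_linear_form F \<longleftrightarrow>
    (\<forall>u\<in>BV. \<forall>v\<in>BV. F (\<lambda>x. u x + v x) = F u + F v) \<and>
    (\<forall>c. \<forall>u\<in>BV. F (\<lambda>x. c * u x) = c * F u) \<and>
    (\<forall>u\<in>BV. \<forall>v\<in>BV. (AE x in lebesgue. u x = v x) \<longrightarrow> F u = F v) \<and>
    (\<forall>u. u \<notin> BV \<longrightarrow> F u = 0)"

definition BV_dual :: "((real ^ 'n \<Rightarrow> real) \<Rightarrow> real) set" where
  "BV_dual = {F. BV_linear_form F \<and> (\<exists>C. \<forall>u\<in>BV. \<bar>F u\<bar> \<le> C * TV u)}"

text \<open>The set under the supremum is bounded above for \<open>F \<in> BV_dual\<close>, where alone the value is meaningful.\<close>

definition BV_dual_norm :: "((real ^ 'n \<Rightarrow> real) \<Rightarrow> real) \<Rightarrow> real" where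
  "BV_dual_norm F = (SUP u\<in>{u \<in> BV. TV u \<le> 1}. \<bar>F u\<bar>)"

definition integral_form :: "(real ^ 'n \<Rightarrow> real) \<Rightarrow> (real ^ 'n \<Rightarrow> real) \<Rightarrow> real" where
  "integral_form f u = (if u \<in> BV then LINT x|lebesgue. u x * f x else 0)"

text \<open>The norm closure in \<open>BV_dual\<close> of the forms given by \<open>f \<in> L_m\<close>, normed by \<^const>\<open>BV_dual_norm\<close>.\<close>

definition SCH0 :: "((real ^ 'n \<Rightarrow> real) \<Rightarrow> real) set" where
  "SCH0 = {F \<in> BV_dual. \<forall>\<epsilon>>0. \<exists>f\<in>Lp (real CARD('n)).
             BV_dual_norm (\<lambda>u. F u - integral_form f u) < \<epsilon>}"

text \<open>
  The dual of \<open>BV\<close> for the localized topology associated with the restriction of \<open>\<sigma>(L_{1*}, L_m)\<close>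
  and the sets \<open>{u. TV u \<le> k}\<close>, given by its description through \<open>\<epsilon>\<close>-\<open>\<theta>\<close> estimates.
  No boundedness with respect to \<^const>\<open>TV\<close> is imposed here.
\<close>

definition SCH0W :: "((real ^ 'n \<Rightarrow> real) \<Rightarrow> real) set" where
  "SCH0W = {F. BV_linear_form F \<and>
     (\<forall>\<epsilon>>0. \<exists>E \<theta>. finite E \<and> E \<noteq> {} \<and>
        E \<subseteq> {f \<in> Lp (real CARD('n)). Lp_norm (real CARD('n)) f = 1} \<and> \<theta> > 0 \<and>
        (\<forall>u\<in>BV. \<bar>F u\<bar> \<le> \<theta> * Max ((\<lambda>f. \<bar>LINT x|lebesgue. u x * f x\<bar>) ` E) + \<epsilon> * TV u))}"

definition SCH0W_norm :: "((real ^ 'n \<Rightarrow> real) \<Rightarrow> real) \<Rightarrow> real" where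
  "SCH0W_norm F = (SUP u\<in>{u \<in> BV. TV u \<le> 1}. \<bar>F u\<bar>)"

end

theory Submission
  imports Defs
begin

text \<open>
  One inclusion rests on the Gagliardo--Nirenberg--Sobolev inequality in the dual form
  \<open>\<bar>\<integral> u f\<bar> \<le> TV u * \<parallel>f\<parallel>\<^sub>m\<close>, which makes the forms \<open>u \<mapsto> \<integral> u f\<close> bounded on \<open>BV\<close>: if \<open>F\<close> is at dual distance
  less than \<open>\<epsilon>\<close> from such a form, then \<open>\<bar>F u\<bar> \<le> \<bar>\<integral> u f\<bar> + \<epsilon> * TV u\<close>.  Conversely, an estimate
  \<open>\<bar>F u\<bar> \<le> \<theta> * max\<^bsub>f \<in> E\<^esub> \<bar>\<integral> u f\<bar> + \<epsilon> * TV u\<close> shows that \<open>\<bar>F\<bar> \<le> \<epsilon> * TV\<close> on the common kernel of the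
  finitely many forms given by \<open>E\<close>; extending from a subspace of finite codimension as in the
  Hahn--Banach theorem, \<open>F\<close> is within \<open>\<epsilon>\<close> of a linear combination of these forms.

  For the Sobolev inequality, \<open>u\<close> is mollified.  The mollified function vanishes at infinity, so it is
  bounded by the integral of each partial derivative along the corresponding line, and the
  Loomis--Whitney inequality applies.  The mollification is removed by weak convergence against
  continuous functions of compact support.
\<close>

section \<open>Hoelder and Loomis--Whitney inequalities\<close>

text \<open>The obstacle is that \<open>u\<close> is given only by its integrability with exponent
  \<open>1*\<close> and by the bound \<open>TV u\<close> on its distributional gradient. Two facts
  make its mollification tractable. The partial derivatives have \<open>L_1\<close> norm at most
  \<open>TV u\<close>, because a mollified truncated sign function is itself an admissible test
  function. The decay at infinity comes from the integrability of \<open>u\<close>; nonzero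
  constants would otherwise violate the inequality. The constant 1 is not sharp: each of the
  \<open>m\<close> directional derivatives is bounded by \<open>TV u\<close>, and the geometric mean
  of these bounds is \<open>TV u\<close> again. Norm convergence of the mollifications of
  \<open>u\<close> is never shown. The even kernel moves from \<open>u\<close> to the continuous
  function paired with it, where pointwise convergence is enough. In the converse inclusion
  boundedness of \<open>F\<close> is not assumed: the functions in \<open>E\<close> have norm 1, so
  the inequality bounds every pairing by \<open>TV u\<close>, and the estimate with
  \<open>\<epsilon> = 1\<close> gives it. Finite codimension lets the Hahn-Banach argument fix one
  real coefficient at a time, each taken between a supremum and an infimum.\<close>

definition epowr :: "ennreal \<Rightarrow> real \<Rightarrow> ennreal" where
  "epowr x a = (if x = top then top else ennreal (enn2real x powr a))"

lemma epowr_top [simp]: "epowr top a = top"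
  by (simp add: epowr_def)

lemma epowr_ennreal: "0 \<le> x \<Longrightarrow> epowr (ennreal x) a = ennreal (x powr a)"
  by (simp add: epowr_def)

lemma epowr_0 [simp]: "epowr 0 a = 0"
  by (simp add: epowr_def)

lemma epowr_eq_0_iff: "epowr x a = 0 \<longleftrightarrow> x = 0"
proof (cases x)
  case (real r)
  then show ?thesis by (auto simp: epowr_ennreal)
qed auto

lemma epowr_one [simp]: "epowr x 1 = x"
  by (cases x) (auto simp: epowr_ennreal)

lemma epowr_mono: "x \<le> y \<Longrightarrow> 0 \<le> a \<Longrightarrow> epowr x a \<le> epowr y a"
  by (cases x; cases y) (auto simp: epowr_ennreal top_unique intro!: ennreal_leI powr_mono2)

text \<open>Infinite arguments need no exception: \<open>epowr\<close> fixes 0 and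
  \<open>top\<close> for every exponent, and \<open>0 * top = 0\<close> in \<open>ennreal\<close>.
  The inequalities below can therefore be stated without integrability hypotheses.\<close>

lemma epowr_mult: "epowr (x * y) a = epowr x a * epowr y a"
proof (cases "x = top \<or> y = top")
  case True
  then show ?thesis
    by (auto simp: ennreal_top_mult ennreal_mult_top epowr_eq_0_iff)
next
  case False
  then obtain r s where "x = ennreal r" "0 \<le> r" "y = ennreal s" "0 \<le> s"
    by (metis ennreal_cases)
  then show ?thesis
    by (simp add: epowr_ennreal powr_mult flip: ennreal_mult)
qed

lemma epowr_prod: "finite I \<Longrightarrow> epowr (\<Prod>i\<in>I. f i) a = (\<Prod>i\<in>I. epowr (f i) a)"
  by (induction I rule: finite_induct) (simp_all add: epowr_mult epowr_def[of 1])

lemma epowr_epowr: "epowr (epowr x a) b = epowr x (a * b)"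
  by (cases x) (auto simp: epowr_ennreal powr_powr)

lemma epowr_add: "0 < a \<Longrightarrow> 0 < b \<Longrightarrow> epowr x a * epowr x b = epowr x (a + b)"
  by (cases x) (auto simp: epowr_ennreal powr_add ennreal_top_mult  simp flip: ennreal_mult)

lemma prod_epowr_const:
  "finite I \<Longrightarrow> I \<noteq> {} \<Longrightarrow> 0 < a \<Longrightarrow> (\<Prod>i\<in>I. epowr x a) = epowr x (real (card I) * a)"
  by (induction I rule: finite_ne_induct) (simp_all add: epowr_add algebra_simps card_gt_0_iff)

lemma measurable_epowr [measurable (raw)]:
  assumes [measurable]: "f \<in> borel_measurable M"
  shows "(\<lambda>x. epowr (f x) a) \<in> borel_measurable M"
  unfolding epowr_def by measurable

text \<open>Jensen's inequality for \<open>exp\<close> at the points \<open>ln (x i)\<close>. A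
  vanishing \<open>x i\<close> has no usable logarithm, but makes the left side 0.\<close>

lemma weighted_AM_GM:
  fixes x :: "'i \<Rightarrow> real"
  assumes I: "finite I" "I \<noteq> {}" and a: "\<And>i. i \<in> I \<Longrightarrow> 0 < a i" "(\<Sum>i\<in>I. a i) = 1"
    and x: "\<And>i. i \<in> I \<Longrightarrow> 0 \<le> x i"
  shows "(\<Prod>i\<in>I. x i powr a i) \<le> (\<Sum>i\<in>I. a i * x i)"
proof (cases "\<exists>i\<in>I. x i = 0")
  case True
  then have "(\<Prod>i\<in>I. x i powr a i) = 0"
    using I by force
  then show ?thesis
    using a x by (auto intro!: sum_nonneg mult_nonneg_nonneg simp: less_imp_le)
next
  case False
  then have pos: "i \<in> I \<Longrightarrow> 0 < x i" for i
    using x by fastforce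
  have "(\<Prod>i\<in>I. x i powr a i) = exp (\<Sum>i\<in>I. a i *\<^sub>R ln (x i))"
    unfolding exp_sum[OF I(1)] by (intro prod.cong) (use pos in \<open>force simp: powr_def\<close>)+
  also have "\<dots> \<le> (\<Sum>i\<in>I. a i * exp (ln (x i)))"
    using I a by (intro convex_on_sum[OF _ _ exp_convex]) (auto simp: less_imp_le)
  finally show ?thesis using pos by simp
qed

text \<open>Each factor is divided by its integral; weighted AM-GM bounds the normalised product
  pointwise by a sum whose integral is the sum of the weights, which is 1. A zero integral (the
  product vanishes almost everywhere) and an infinite one (the right side is \<open>top\<close>) are
  settled first.\<close>

theorem nn_integral_Hoelder:
  assumes I: "finite I" "I \<noteq> {}" and a: "\<And>i. i \<in> I \<Longrightarrow> 0 < a i" "(\<Sum>i\<in>I. a i) = 1"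
    and [measurable]: "\<And>i. i \<in> I \<Longrightarrow> f i \<in> borel_measurable M"
  shows "(\<integral>\<^sup>+x. (\<Prod>i\<in>I. epowr (f i x) (a i)) \<partial>M) \<le> (\<Prod>i\<in>I. epowr (\<integral>\<^sup>+x. f i x \<partial>M) (a i))"
proof -
  define c where "c i = (\<integral>\<^sup>+x. f i x \<partial>M)" for i
  consider "\<exists>i\<in>I. c i = 0" | "\<forall>i\<in>I. c i \<noteq> 0" "\<exists>i\<in>I. c i = top" | "\<forall>i\<in>I. c i \<noteq> 0 \<and> c i \<noteq> top"
    by blast
  then show ?thesis
  proof cases
    case 1
    then obtain i where i: "i \<in> I" "c i = 0" by blast
    then have "AE x in M. f i x = 0"
      by (simp add: c_def nn_integral_0_iff_AE)
    then have "AE x in M. (\<Prod>i\<in>I. epowr (f i x) (a i)) = 0"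
      by eventually_elim (use i I in \<open>auto simp: prod_zero_iff epowr_eq_0_iff\<close>)
    then have "(\<integral>\<^sup>+x. (\<Prod>i\<in>I. epowr (f i x) (a i)) \<partial>M) = (\<integral>\<^sup>+x. 0 \<partial>M)"
      by (rule nn_integral_cong_AE)
    then show ?thesis by simp
  next
    case 2
    then have "(\<Prod>i\<in>I. epowr (c i) (a i)) = top"
      using I by (force simp: ennreal_prod_eq_top epowr_eq_0_iff)
    then show ?thesis by (simp add: c_def)
  next
    case 3
    define r where "r i = enn2real (c i)" for i
    have c: "c i = ennreal (r i)" "0 < r i" if "i \<in> I" for i
      using 3 that by (auto simp: r_def enn2real_positive_iff top.not_eq_extremum zero_less_iff_neq_zero)
    define C where "C = (\<Prod>i\<in>I. epowr (c i) (a i))"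
    have C: "C \<noteq> 0"
      using I 3 by (simp add: C_def epowr_eq_0_iff)
    have pt: "(\<Prod>i\<in>I. epowr (f i x) (a i)) \<le> C * (\<Sum>i\<in>I. ennreal (a i / r i) * f i x)" for x
    proof (cases "\<exists>i\<in>I. f i x = top")
      case True
      then obtain i where i: "i \<in> I" "f i x = top" by blast
      then have "ennreal (a i / r i) * f i x = top"
        using a(1)[of i] c(2)[of i] by (simp add: ennreal_mult_top)
      then have "(\<Sum>i\<in>I. ennreal (a i / r i) * f i x) = top"
        using i I by (metis ennreal_sum_eq_top)
      then show ?thesis using C by (simp add: ennreal_mult_top)
    next
      case False
      define y where "y i = enn2real (f i x)" for i
      have y: "f i x = ennreal (y i)" "0 \<le> y i" if "i \<in> I" for i
        using False that by (auto simp: y_def top.not_eq_extremum)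
      have "(\<Prod>i\<in>I. y i powr a i) = (\<Prod>i\<in>I. r i powr a i) * (\<Prod>i\<in>I. (y i / r i) powr a i)"
        unfolding prod.distrib[symmetric]
      proof (intro prod.cong refl)
        fix i assume i: "i \<in> I"
        show "y i powr a i = r i powr a i * (y i / r i) powr a i"
          using c(2)[OF i] y(2)[OF i] by (simp add: powr_divide)
      qed
      also have "\<dots> \<le> (\<Prod>i\<in>I. r i powr a i) * (\<Sum>i\<in>I. a i * (y i / r i))"
        by (intro mult_left_mono weighted_AM_GM I a prod_nonneg) (use c y in \<open>auto simp: less_imp_le\<close>)
      finally have le: "ennreal (\<Prod>i\<in>I. y i powr a i) \<le> ennreal ((\<Prod>i\<in>I. r i powr a i) * (\<Sum>i\<in>I. a i * (y i / r i)))"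
        by (rule ennreal_leI)
      have "(\<Prod>i\<in>I. epowr (f i x) (a i)) = (\<Prod>i\<in>I. ennreal (y i powr a i))"
        by (intro prod.cong) (use y in \<open>auto simp: epowr_ennreal\<close>)
      moreover have "C = (\<Prod>i\<in>I. ennreal (r i powr a i))"
        unfolding C_def by (intro prod.cong) (use c in \<open>auto simp: epowr_ennreal less_imp_le\<close>)
      moreover have "(\<Sum>i\<in>I. ennreal (a i / r i) * f i x) = (\<Sum>i\<in>I. ennreal (a i * (y i / r i)))"
        by (intro sum.cong) (use c y a in \<open>auto simp: less_imp_le simp flip: ennreal_mult\<close>)
      moreover have "(\<Sum>i\<in>I. ennreal (a i * (y i / r i))) = ennreal (\<Sum>i\<in>I. a i * (y i / r i))"
        by (intro sum_ennreal) (use c y a in \<open>auto simp: less_imp_le\<close>)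
      ultimately show ?thesis
        using le by (simp add: prod_ennreal prod_nonneg ennreal_mult'')
          (simp add: prod_ennreal prod_nonneg ennreal_mult')
    qed
    have "(\<integral>\<^sup>+x. (\<Prod>i\<in>I. epowr (f i x) (a i)) \<partial>M) \<le> (\<integral>\<^sup>+x. C * (\<Sum>i\<in>I. ennreal (a i / r i) * f i x) \<partial>M)"
      by (intro nn_integral_mono pt)
    also have "\<dots> = C * (\<Sum>i\<in>I. ennreal (a i / r i) * c i)"
      by (simp add: nn_integral_cmult nn_integral_sum c_def)
    also have "(\<Sum>i\<in>I. ennreal (a i / r i) * c i) = (\<Sum>i\<in>I. ennreal (a i))"
    proof (intro sum.cong refl)
      fix i assume i: "i \<in> I"
      show "ennreal (a i / r i) * c i = ennreal (a i)"
        using c[OF i] a(1)[OF i] by (simp flip: ennreal_mult')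
    qed
    also have "\<dots> = 1"
      using a by (subst sum_ennreal) (auto simp: less_imp_le)
    finally show ?thesis by (simp add: C_def c_def)
  qed
qed

text \<open>Induction on the set of coordinates. On the slice where coordinate \<open>k\<close>
  equals \<open>t\<close>, Hoelder's inequality detaches \<open>g k\<close>, which does not depend
  on \<open>t\<close>, and the induction hypothesis treats the other factors. A second use of
  Hoelder's inequality, in the variable \<open>t\<close>, finishes.\<close>

theorem (in product_sigma_finite) Loomis_Whitney:
  assumes "finite I" "card I \<ge> 2"
    and "\<And>i. i \<in> I \<Longrightarrow> g i \<in> borel_measurable (Pi\<^sub>M (I - {i}) M)"
  shows "(\<integral>\<^sup>+x. (\<Prod>i\<in>I. epowr (g i (restrict x (I - {i}))) (1 / (real (card I) - 1))) \<partial>Pi\<^sub>M I M)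
    \<le> (\<Prod>i\<in>I. epowr (\<integral>\<^sup>+x. g i x \<partial>Pi\<^sub>M (I - {i}) M) (1 / (real (card I) - 1)))"
  using assms
proof (induction I arbitrary: g rule: finite_induct)
  case empty
  then show ?case by simp
next
  case (insert k I)
  note I = insert.hyps and IH = insert.IH
  define m where "m = real (card I)"
  have ne: "I \<noteq> {}" and m: "m \<ge> 1" and card: "real (card (insert k I)) - 1 = m"
    using insert.prems(1) I by (auto simp: m_def card_gt_0_iff Suc_le_eq)
  have ins: "insert k (I - {i}) = insert k I - {i}" if "i \<in> I" for i
    using that I by auto
  have gk [measurable]: "g k \<in> borel_measurable (Pi\<^sub>M I M)"
    using insert.prems(2)[of k] I by simp
  have gi [measurable]: "g i \<in> borel_measurable (Pi\<^sub>M (insert k (I - {i})) M)" if "i \<in> I" for i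
    using insert.prems(2)[of i] that by (simp add: ins)
  have upd [measurable]: "(\<lambda>(x, t). g i (x(k := t))) \<in> borel_measurable (Pi\<^sub>M (I - {i}) M \<Otimes>\<^sub>M M k)"
    if "i \<in> I" for i
    using measurable_compose[OF measurable_add_dim gi[OF that]] by (simp add: case_prod_beta')
  have gt [measurable]: "(\<lambda>x. g i (x(k := t))) \<in> borel_measurable (Pi\<^sub>M (I - {i}) M)"
    if "i \<in> I" "t \<in> space (M k)" for i t
    using measurable_compose[OF measurable_Pair2'[OF that(2)] upd[OF that(1)]] by simp
  \<comment> \<open>\<open>J i t\<close> is the integral of \<open>g i\<close> over the slice at
    \<open>t\<close>, so integrating it in \<open>t\<close> recovers the full integral of
    \<open>g i\<close>. Below, \<open>A t\<close> is the slice at \<open>t\<close> of the left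
    side.\<close>
  define J where "J i t = (\<integral>\<^sup>+x. g i (x(k := t)) \<partial>Pi\<^sub>M (I - {i}) M)" for i t
  have sf: "sigma_finite_measure (Pi\<^sub>M (I - {i}) M)" for i
    using I by (intro sigma_finite) auto
  have J_meas [measurable]: "J i \<in> borel_measurable (M k)" if "i \<in> I" for i
  proof -
    have "(\<lambda>(t, x). g i (x(k := t))) \<in> borel_measurable (M k \<Otimes>\<^sub>M Pi\<^sub>M (I - {i}) M)"
      using measurable_compose[OF measurable_pair_swap' upd[OF that]] by (simp add: case_prod_beta')
    then show ?thesis
      unfolding J_def by (intro sigma_finite_measure.borel_measurable_nn_integral[OF sf])
  qed
  define A where "A t = (\<integral>\<^sup>+x. epowr (g k x) (1 / m) * (\<Prod>i\<in>I. epowr (g i ((restrict x (I - {i}))(k := t))) (1 / m)) \<partial>Pi\<^sub>M I M)" for t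
  have A_le: "A t \<le> epowr (\<integral>\<^sup>+x. g k x \<partial>Pi\<^sub>M I M) (1 / m) * (\<Prod>i\<in>I. epowr (J i t) (1 / m))" if t: "t \<in> space (M k)" for t
  \<comment> \<open>A single remaining coordinate is the true start of the induction: the exponent
    \<open>1 / (m - 1)\<close> of the hypothesis makes no sense there, and \<open>I - {j}\<close> is
    empty, so \<open>J j t\<close> is just a value of \<open>g j\<close>.\<close>
  proof (cases "card I = 1")
    case True
    then obtain j where j: "I = {j}" by (auto simp: card_1_singleton_iff)
    then have "m = 1" by (simp add: m_def)
    moreover have "J j t = g j (\<lambda>a. if a = k then t else undefined)"
      by (simp add: J_def j PiM_empty nn_integral_count_space_finite fun_upd_def)
    moreover have "restrict x {} = (\<lambda>_. undefined)" for x :: "'i \<Rightarrow> 'a" by auto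
    ultimately show ?thesis
      using gk unfolding A_def by (simp add: j nn_integral_multc fun_upd_def)
  next
    case False
    then have m2: "m > 1" and c2: "2 \<le> card I" using m by (auto simp: m_def)
    define H where "H x = (\<Prod>i\<in>I. epowr (g i ((restrict x (I - {i}))(k := t))) (1 / (m - 1)))" for x
    have [measurable]: "(\<lambda>x. g i ((restrict x (I - {i}))(k := t))) \<in> borel_measurable (Pi\<^sub>M I M)" if "i \<in> I" for i
      using measurable_compose[OF measurable_restrict_subset gt[OF that t], of I] by auto
    have [measurable]: "H \<in> borel_measurable (Pi\<^sub>M I M)"
      unfolding H_def by measurable
    have HI: "integral\<^sup>N (Pi\<^sub>M I M) H \<le> (\<Prod>i\<in>I. epowr (J i t) (1 / (m - 1)))"
      unfolding H_def J_def m_def by (rule IH[OF c2, of "\<lambda>i x. g i (x(k := t))"]) (use gt t in auto)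
    \<comment> \<open>Indexing by \<open>bool\<close> encodes the inequality for two factors.
      \<open>H\<close> carries the exponent \<open>1 / (m - 1)\<close>, so the weight
      \<open>(m - 1) / m\<close> turns it into \<open>1 / m\<close>.\<close>
    have "A t = (\<integral>\<^sup>+x. (\<Prod>b\<in>UNIV. epowr (if b then g k x else H x) (if b then 1 / m else (m - 1) / m)) \<partial>Pi\<^sub>M I M)"
      using m2 I unfolding A_def by (intro nn_integral_cong) (simp add: UNIV_bool H_def epowr_prod epowr_epowr field_simps)
    also have "\<dots> \<le> (\<Prod>b\<in>UNIV. epowr (\<integral>\<^sup>+x. (if b then g k x else H x) \<partial>Pi\<^sub>M I M) (if b then 1 / m else (m - 1) / m))"
      using m2 by (intro nn_integral_Hoelder) (auto simp: UNIV_bool field_simps)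
    also have "\<dots> = epowr (\<integral>\<^sup>+x. g k x \<partial>Pi\<^sub>M I M) (1 / m) * epowr (integral\<^sup>N (Pi\<^sub>M I M) H) ((m - 1) / m)"
      by (simp add: UNIV_bool mult.commute)
    also have "\<dots> \<le> epowr (\<integral>\<^sup>+x. g k x \<partial>Pi\<^sub>M I M) (1 / m) * epowr (\<Prod>i\<in>I. epowr (J i t) (1 / (m - 1))) ((m - 1) / m)"
      using m2 by (intro mult_left_mono epowr_mono HI) auto
    also have "\<dots> = epowr (\<integral>\<^sup>+x. g k x \<partial>Pi\<^sub>M I M) (1 / m) * (\<Prod>i\<in>I. epowr (J i t) (1 / m))"
      using m2 I by (simp add: epowr_prod epowr_epowr field_simps)
    finally show ?thesis .
  qed
  let ?h = "\<lambda>x. \<Prod>i\<in>insert k I. epowr (g i (restrict x (insert k I - {i}))) (1 / m)"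
  have h_meas: "?h \<in> borel_measurable (Pi\<^sub>M (insert k I) M)"
  proof (intro borel_measurable_prod_ennreal measurable_epowr)
    fix i assume "i \<in> insert k I"
    then show "(\<lambda>x. g i (restrict x (insert k I - {i}))) \<in> borel_measurable (Pi\<^sub>M (insert k I) M)"
      using measurable_compose[OF measurable_restrict_subset insert.prems(2)[of i]] by blast
  qed
  have "(\<integral>\<^sup>+x. ?h x \<partial>Pi\<^sub>M (insert k I) M) = (\<integral>\<^sup>+t. \<integral>\<^sup>+x. ?h (x(k := t)) \<partial>Pi\<^sub>M I M \<partial>M k)"
    by (intro product_nn_integral_insert_rev I h_meas)
  also have "\<dots> = (\<integral>\<^sup>+t. A t \<partial>M k)"
  proof (intro nn_integral_cong, unfold A_def, intro nn_integral_cong)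
    fix t x assume "t \<in> space (M k)" and x: "x \<in> space (Pi\<^sub>M I M)"
    have "restrict (x(k := t)) (insert k I - {k}) = x"
      using x I by (auto simp: space_PiM PiE_def extensional_def restrict_def fun_eq_iff)
    moreover have "restrict (x(k := t)) (insert k I - {i}) = (restrict x (I - {i}))(k := t)" if "i \<in> I" for i
      using I that by (auto simp: restrict_def fun_eq_iff)
    ultimately show "?h (x(k := t)) = epowr (g k x) (1 / m) * (\<Prod>i\<in>I. epowr (g i ((restrict x (I - {i}))(k := t))) (1 / m))"
      using I by simp
  qed
  also have "\<dots> \<le> (\<integral>\<^sup>+t. epowr (\<integral>\<^sup>+x. g k x \<partial>Pi\<^sub>M I M) (1 / m) * (\<Prod>i\<in>I. epowr (J i t) (1 / m)) \<partial>M k)"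
    by (intro nn_integral_mono A_le)
  also have "\<dots> = epowr (\<integral>\<^sup>+x. g k x \<partial>Pi\<^sub>M I M) (1 / m) * (\<integral>\<^sup>+t. (\<Prod>i\<in>I. epowr (J i t) (1 / m)) \<partial>M k)"
    by (intro nn_integral_cmult) measurable
  \<comment> \<open>Here the \<open>card I\<close> weights are all \<open>1 / m\<close> and hence
    sum to 1.\<close>
  also have "\<dots> \<le> epowr (\<integral>\<^sup>+x. g k x \<partial>Pi\<^sub>M I M) (1 / m) * (\<Prod>i\<in>I. epowr (\<integral>\<^sup>+t. J i t \<partial>M k) (1 / m))"
    using ne I m by (intro mult_left_mono nn_integral_Hoelder) (auto simp: m_def)
  also have "(\<Prod>i\<in>I. epowr (\<integral>\<^sup>+t. J i t \<partial>M k) (1 / m)) =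
      (\<Prod>i\<in>I. epowr (\<integral>\<^sup>+x. g i x \<partial>Pi\<^sub>M (insert k I - {i}) M) (1 / m))"
  proof (intro prod.cong refl)
    fix i assume i: "i \<in> I"
    have "(\<integral>\<^sup>+t. J i t \<partial>M k) = (\<integral>\<^sup>+x. g i x \<partial>Pi\<^sub>M (insert k (I - {i})) M)"
      unfolding J_def using I i by (intro product_nn_integral_insert_rev[symmetric] gi) auto
    then show "epowr (\<integral>\<^sup>+t. J i t \<partial>M k) (1 / m) = epowr (\<integral>\<^sup>+x. g i x \<partial>Pi\<^sub>M (insert k I - {i}) M) (1 / m)"
      using ins[OF i] by simp
  qed
  finally show ?case
    unfolding card using I by (simp add: insert_Diff_if)
qed

section \<open>Test functions\<close>

lemma partial_deriv_eq:
  assumes "(f has_derivative f') (at x)"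
  shows "partial_deriv i f x = f' (axis i 1)"
  unfolding partial_deriv_def using frechet_derivative_at[OF assms] by simp

lemma has_derivative_partial_deriv:
  fixes f :: "real ^ 'n \<Rightarrow> real"
  assumes "f differentiable (at x)"
  shows "(f has_derivative (\<lambda>h. \<Sum>i\<in>UNIV. h $ i * partial_deriv i f x)) (at x)"
proof -
  have d: "(f has_derivative frechet_derivative f (at x)) (at x)"
    using assms frechet_derivative_works by blast
  then interpret linear "frechet_derivative f (at x)" by (rule has_derivative_linear)
  have "frechet_derivative f (at x) h = (\<Sum>i\<in>UNIV. h $ i * partial_deriv i f x)" for h
  proof -
    have "frechet_derivative f (at x) h = frechet_derivative f (at x) (\<Sum>i\<in>UNIV. h $ i *\<^sub>R axis i 1)"
      by (simp add: basis_expansion scalar_mult_eq_scaleR[symmetric])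
    then show ?thesis by (simp add: sum scale partial_deriv_def)
  qed
  then show ?thesis using d by (metis (no_types, lifting) ext)
qed

text \<open>A class of differentiable functions stable under partial derivatives consists of smooth
  functions, by induction on the order. Exhibiting such a class replaces the computation of higher
  derivatives.\<close>

lemma Ck_funI:
  assumes f: "f \<in> S"
    and diff: "\<And>f x. f \<in> S \<Longrightarrow> f differentiable (at x)"
    and part: "\<And>f i. f \<in> S \<Longrightarrow> partial_deriv i f \<in> S"
  shows "Ck_fun k f"
  using f
proof (induction k arbitrary: f)
  case 0
  then show ?case
    using diff by (auto intro!: differentiable_imp_continuous_on differentiable_at_imp_differentiable_on)
next
  case (Suc k)
  then show ?case
    using diff part by (auto intro!: differentiable_at_imp_differentiable_on)
qed

lemma
  assumes "\<phi> \<in> test_funs"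
  shows test_fun_Ck: "Ck_fun k \<phi>"
    and test_fun_differentiable: "\<phi> differentiable (at x)"
    and test_fun_continuous: "continuous_on UNIV \<phi>"
proof -
  have C: "Ck_fun k \<phi>" for k using assms by (simp add: test_funs_def)
  show "Ck_fun k \<phi>" by (rule C)
  show "\<phi> differentiable (at x)" using C[of 1] by (simp add: differentiable_on_def)
  show "continuous_on UNIV \<phi>" using C[of 0] by simp
qed

lemma test_fun_support:
  assumes "\<phi> \<in> test_funs"
  obtains R where "R > 0" "\<And>x. norm x \<ge> R \<Longrightarrow> \<phi> x = 0"
proof -
  have "bounded {x. \<phi> x \<noteq> 0}"
    using assms compact_imp_bounded bounded_subset closure_subset by (fastforce simp: test_funs_def)
  then obtain R where "R > 0" "\<And>x. \<phi> x \<noteq> 0 \<Longrightarrow> norm x \<le> R"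
    by (auto simp: bounded_pos)
  then show ?thesis by (intro that[of "R + 1"]) force+
qed

lemma test_funI:
  assumes "\<And>k. Ck_fun k \<phi>" "\<And>x. norm x \<ge> R \<Longrightarrow> \<phi> x = 0"
  shows "\<phi> \<in> test_funs"
proof -
  have "bounded {x. \<phi> x \<noteq> 0}"
    using assms(2) by (auto simp: bounded_iff) (metis linear)
  then show ?thesis using assms(1) by (simp add: test_funs_def compact_closure)
qed

lemma partial_deriv_zero_outside:
  assumes "\<And>x. norm x \<ge> R \<Longrightarrow> f x = 0" "norm x > R"
  shows "partial_deriv i f x = 0"
proof -
  have "((\<lambda>_. 0) has_derivative (\<lambda>_. 0)) (at x)" by simp
  moreover have "open {y. norm y > R}" by (intro open_Collect_less continuous_intros)
  ultimately have "(f has_derivative (\<lambda>_. 0)) (at x)"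
    using has_derivative_transform_within_open[of "\<lambda>_. 0" "\<lambda>_. 0" x UNIV "{y. norm y > R}" f] assms by auto
  then show ?thesis by (simp add: partial_deriv_eq)
qed

lemma partial_deriv_test_fun:
  assumes "\<phi> \<in> test_funs"
  shows "partial_deriv i \<phi> \<in> test_funs"
proof -
  obtain R where R: "\<And>x. norm x \<ge> R \<Longrightarrow> \<phi> x = 0" using test_fun_support[OF assms] by metis
  show ?thesis
  \<comment> \<open>The radius grows because a derivative is known to vanish only where the function
    vanishes on a whole neighbourhood, that is for \<open>norm x > R\<close>.\<close>
  proof (rule test_funI[of _ "R + 1"])
    show "Ck_fun k (partial_deriv i \<phi>)" for k
      using test_fun_Ck[OF assms, of "Suc k"] by simp
    show "partial_deriv i \<phi> x = 0" if "norm x \<ge> R + 1" for x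
      using that by (intro partial_deriv_zero_outside[OF R]) auto
  qed
qed

lemma test_fun_bounded:
  assumes "\<phi> \<in> test_funs"
  obtains B where "B > 0" "\<And>x. \<bar>\<phi> x\<bar> \<le> B"
proof -
  obtain R where R: "R > 0" "\<And>x. norm x \<ge> R \<Longrightarrow> \<phi> x = 0" using test_fun_support[OF assms] by metis
  have "compact (\<phi> ` cball 0 R)"
    using test_fun_continuous[OF assms] by (intro compact_continuous_image) (auto intro: continuous_on_subset)
  then have "bounded (\<phi> ` cball 0 R)" by (rule compact_imp_bounded)
  then obtain B where B: "B > 0" "\<And>x. x \<in> cball 0 R \<Longrightarrow> \<bar>\<phi> x\<bar> \<le> B"
    unfolding bounded_pos by auto
  have "\<bar>\<phi> x\<bar> \<le> B" for x
    using B R(2)[of x] by (cases "norm x \<le> R") auto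
  then show ?thesis using that B by blast
qed

lemma
  fixes \<phi> :: "real ^ 'n \<Rightarrow> real"
  assumes "\<And>x. \<phi> differentiable (at x)"
  shows partial_deriv_cmult: "partial_deriv i (\<lambda>x. c * \<phi> x) = (\<lambda>x. c * partial_deriv i \<phi> x)"
    and differentiable_cmult: "(\<lambda>x. c * \<phi> x) differentiable (at x)"
proof -
  show "(\<lambda>x. c * \<phi> x) differentiable (at x)" using assms by (intro derivative_intros)
  show "partial_deriv i (\<lambda>x. c * \<phi> x) = (\<lambda>x. c * partial_deriv i \<phi> x)"
  proof
    fix x
    have "((\<lambda>x. c * \<phi> x) has_derivative (\<lambda>h. c * frechet_derivative \<phi> (at x) h)) (at x)"
      using assms frechet_derivative_works by (intro derivative_intros) blast
    then show "partial_deriv i (\<lambda>x. c * \<phi> x) x = c * partial_deriv i \<phi> x"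
      by (subst partial_deriv_eq) (auto simp: partial_deriv_def)
  qed
qed

lemma test_fun_cmult:
  assumes "\<phi> \<in> test_funs"
  shows "(\<lambda>x. c * \<phi> x) \<in> test_funs"
proof -
  obtain R where R: "\<And>x. norm x \<ge> R \<Longrightarrow> \<phi> x = 0" using test_fun_support[OF assms] by metis
  show ?thesis
  proof (rule test_funI)
    show "Ck_fun k (\<lambda>x. c * \<phi> x)" for k
    proof (rule Ck_funI[of _ "{\<lambda>x. c * \<phi> x |\<phi>. \<phi> \<in> test_funs}"])
      show "(\<lambda>x. c * \<phi> x) \<in> {\<lambda>x. c * \<phi> x |\<phi>. \<phi> \<in> test_funs}" using assms by blast
    qed (auto simp: partial_deriv_cmult test_fun_differentiable intro!: differentiable_cmult intro: partial_deriv_test_fun)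
    show "norm x \<ge> R \<Longrightarrow> c * \<phi> x = 0" for x using R by simp
  qed
qed

lemma partial_deriv_zero [simp]: "partial_deriv i (\<lambda>_. 0) = (\<lambda>_. 0)"
proof
  show "partial_deriv i (\<lambda>_. 0) x = 0" for x
    by (rule partial_deriv_eq[of _ "\<lambda>_. 0"]) simp
qed

lemma zero_test_fun: "(\<lambda>_. 0) \<in> test_funs"
proof (rule test_funI[of _ 0])
  show "Ck_fun k (\<lambda>_. 0)" for k by (rule Ck_funI[of _ "{\<lambda>_. 0}"]) auto
qed simp

subsection \<open>A smooth bump function\<close>

text \<open>All derivatives of \<open>exp (- 1 / t)\<close>, extended by 0 to
  \<open>t \<le> 0\<close>, are linear combinations of these functions; the parameter
  \<open>k\<close> closes the family under differentiation.\<close>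

definition flat_exp :: "nat \<Rightarrow> real \<Rightarrow> real" where
  "flat_exp k t = (if t > 0 then (1 / t) ^ k * exp (- (1 / t)) else 0)"

lemma flat_exp_tendsto: "((\<lambda>t. flat_exp k t) \<longlongrightarrow> 0) (at 0)"
proof -
  have "((\<lambda>s::real. s ^ k * exp (- s)) \<longlongrightarrow> 0) at_top"
    using tendsto_power_div_exp_0[of k] by (simp add: exp_minus divide_inverse)
  then have "((\<lambda>t::real. (inverse t) ^ k * exp (- inverse t)) \<longlongrightarrow> 0) (at_right 0)"
    by (rule filterlim_compose[OF _ filterlim_inverse_at_top_right])
  then have "(flat_exp k \<longlongrightarrow> 0) (at_right 0)"
    by (rule Lim_transform_eventually)
      (auto simp: eventually_at_filter flat_exp_def inverse_eq_divide)
  moreover have "(flat_exp k \<longlongrightarrow> 0) (at_left 0)"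
    by (rule Lim_transform_eventually[of "\<lambda>_. 0"]) (auto simp: eventually_at_filter flat_exp_def)
  ultimately show ?thesis by (simp add: filterlim_split_at)
qed

lemma flat_exp_deriv:
  "(flat_exp k has_real_derivative (flat_exp (k + 2) t - real k * flat_exp (k + 1) t)) (at t)"
proof -
  consider "t > 0" | "t < 0" | "t = 0" by linarith
  then show ?thesis
  proof cases
    case 1
    define s where "s = 1 / t"
    have "((\<lambda>t. 1 / t) has_real_derivative - (s * s)) (at t)"
      using 1 by (auto intro!: derivative_eq_intros simp: s_def)
    from DERIV_mult[OF DERIV_power[OF this, of k] DERIV_fun_exp[OF DERIV_minus[OF this]]]
    have "((\<lambda>t. (1 / t) ^ k * exp (- (1 / t))) has_real_derivative
        (real k * s ^ (k - 1) * - (s * s)) * exp (- s) + (exp (- s) * (s * s)) * s ^ k) (at t)"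
      by (simp add: s_def mult_ac)
    also have "(real k * s ^ (k - 1) * - (s * s)) * exp (- s) + (exp (- s) * (s * s)) * s ^ k =
        flat_exp (k + 2) t - real k * flat_exp (k + 1) t"
      using 1 by (cases k) (simp_all add: flat_exp_def s_def[symmetric] algebra_simps)
    finally have "((\<lambda>t. (1 / t) ^ k * exp (- (1 / t))) has_real_derivative
        (flat_exp (k + 2) t - real k * flat_exp (k + 1) t)) (at t)" .
    then show ?thesis
      by (rule has_field_derivative_transform_within_open[of _ _ _ "{0<..}"]) (use 1 in \<open>auto simp: flat_exp_def\<close>)
  next
    case 2
    have "((\<lambda>t. 0) has_real_derivative 0) (at t)" by simp
    then have "(flat_exp k has_real_derivative 0) (at t)"
      by (rule has_field_derivative_transform_within_open[of _ _ _ "{..<0}"]) (use 2 in \<open>auto simp: flat_exp_def\<close>)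
    then show ?thesis using 2 by (simp add: flat_exp_def)
  next
    case 3
    \<comment> \<open>Away from 0 the difference quotient of \<open>flat_exp k\<close> at 0 is
      \<open>flat_exp (k + 1)\<close>, so flatness of the next member of the family gives the
      derivative.\<close>
    have "((\<lambda>h. (flat_exp k (0 + h) - flat_exp k 0) / h) \<longlongrightarrow> 0) (at 0)"
      by (rule Lim_transform_eventually[OF flat_exp_tendsto[of "k + 1"]])
        (auto simp: eventually_at_filter flat_exp_def)
    then show ?thesis using 3 by (simp add: DERIV_def flat_exp_def)
  qed
qed

text \<open>This algebra is closed under directional derivatives, since differentiating a generator
  gives a combination of generators and the product rule stays inside. It serves as the stable class
  from which smoothness of the bump is read off.\<close>

inductive_set bump_algebra :: "(real ^ 'n \<Rightarrow> real) set" where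
  base: "(\<lambda>x. flat_exp k (a + s * x $ i)) \<in> bump_algebra"
| const: "(\<lambda>_. c) \<in> bump_algebra"
| add: "f \<in> bump_algebra \<Longrightarrow> g \<in> bump_algebra \<Longrightarrow> (\<lambda>x. f x + g x) \<in> bump_algebra"
| mult: "f \<in> bump_algebra \<Longrightarrow> g \<in> bump_algebra \<Longrightarrow> (\<lambda>x. f x * g x) \<in> bump_algebra"

lemma bump_algebra_derivative:
  fixes f :: "real ^ 'n \<Rightarrow> real"
  assumes "f \<in> bump_algebra"
  shows "\<exists>f'. (\<forall>x. (f has_derivative f' x) (at x)) \<and> (\<forall>h. (\<lambda>x. f' x h) \<in> bump_algebra)"
  using assms
proof induction
  case (base k a s i)
  let ?d = "\<lambda>t. flat_exp (k + 2) t + (- real k) * flat_exp (k + 1) t"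
  have "((\<lambda>x. flat_exp k (a + s * x $ i)) has_derivative (\<lambda>h. ?d (a + s * x $ i) * (s * h $ i))) (at x)" for x :: "real ^ 'n"
  proof -
    have "((\<lambda>x. a + s * x $ i) has_derivative (\<lambda>h. s * h $ i)) (at x)"
      by (auto intro!: derivative_eq_intros bounded_linear_imp_has_derivative bounded_linear_vec_nth)
    from has_derivative_compose[OF this flat_exp_deriv[unfolded has_field_derivative_def]]
    show ?thesis by (simp add: has_field_derivative_def mult.commute)
  qed
  moreover have "(\<lambda>x. ?d (a + s * x $ i) * (s * h $ i)) \<in> bump_algebra" for h :: "real ^ 'n"
    by (intro bump_algebra.intros)
  ultimately show ?case by (intro exI[of _ "\<lambda>x h. ?d (a + s * x $ i) * (s * h $ i)"]) auto
next
  case (const c)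
  show ?case by (intro exI[of _ "\<lambda>_ _. 0"]) (simp add: bump_algebra.const)
next
  case (add f g)
  then obtain f' g' where
    "\<And>x. (f has_derivative f' x) (at x)" "\<And>h. (\<lambda>x. f' x h) \<in> bump_algebra"
    "\<And>x. (g has_derivative g' x) (at x)" "\<And>h. (\<lambda>x. g' x h) \<in> bump_algebra" by auto
  then show ?case
    by (intro exI[of _ "\<lambda>x h. f' x h + g' x h"]) (auto intro!: derivative_intros bump_algebra.add)
next
  case (mult f g)
  then obtain f' g' where
    "\<And>x. (f has_derivative f' x) (at x)" "\<And>h. (\<lambda>x. f' x h) \<in> bump_algebra"
    "\<And>x. (g has_derivative g' x) (at x)" "\<And>h. (\<lambda>x. g' x h) \<in> bump_algebra" by auto
  with mult.hyps show ?case
    by (intro exI[of _ "\<lambda>x h. f x * g' x h + f' x h * g x"])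
      (auto intro!: derivative_intros bump_algebra.add bump_algebra.mult)
qed

lemma bump_algebra_Ck_fun:
  fixes f :: "real ^ 'n \<Rightarrow> real"
  assumes "f \<in> bump_algebra"
  shows "Ck_fun k f"
  using assms
proof (rule Ck_funI)
  fix f :: "real ^ 'n \<Rightarrow> real" assume "f \<in> bump_algebra"
  from bump_algebra_derivative[OF this] obtain f' where
    f': "\<And>x. (f has_derivative f' x) (at x)" "\<And>h. (\<lambda>x. f' x h) \<in> bump_algebra" by auto
  show "f differentiable (at x)" for x using f' by (auto simp: differentiable_def)
  have "partial_deriv i f = (\<lambda>x. f' x (axis i 1))" for i
    using partial_deriv_eq[OF f'(1)] by auto
  then show "partial_deriv i f \<in> bump_algebra" for i using f'(2) by simp
qed

text \<open>A normalised product of one-dimensional bumps. The factors with arguments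
  \<open>d - x $ i\<close> and \<open>d + x $ i\<close> confine each coordinate to an interval and
  are exchanged by \<open>x \<mapsto> - x\<close>, which makes the kernel even.\<close>

lemma mollifier_exists:
  assumes "e > 0"
  obtains \<psi> :: "real ^ 'n \<Rightarrow> real" where "\<psi> \<in> test_funs" "\<And>x. \<psi> x \<ge> 0" "\<And>x. \<psi> (- x) = \<psi> x"
    "\<And>x. norm x \<ge> e \<Longrightarrow> \<psi> x = 0" "integral\<^sup>L lborel \<psi> = 1"
proof -
  \<comment> \<open>The Euclidean norm is at most the sum of the \<open>CARD('n)\<close> absolute
    coordinates, so outside the ball of radius \<open>e\<close> some coordinate is at least
    \<open>d\<close> in absolute value.\<close>
  define d where "d = e / real CARD('n)"
  have d: "d > 0" using assms by (simp add: d_def)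
  define \<phi> :: "real ^ 'n \<Rightarrow> real" where
    "\<phi> x = (\<Prod>i\<in>UNIV. flat_exp 0 (d + (- 1) * x $ i) * flat_exp 0 (d + 1 * x $ i))" for x
  have prod: "(\<lambda>x. \<Prod>i\<in>A. flat_exp 0 (d + (- 1) * x $ i) * flat_exp 0 (d + 1 * x $ i)) \<in> bump_algebra"
    if "finite A" for A :: "'n set"
    using that
  proof induction
    case empty
    show ?case by (simp add: bump_algebra.const)
  next
    case (insert j A)
    have "(\<lambda>x. flat_exp 0 (d + (- 1) * x $ j) * flat_exp 0 (d + 1 * x $ j) *
        (\<Prod>i\<in>A. flat_exp 0 (d + (- 1) * x $ i) * flat_exp 0 (d + 1 * x $ i))) \<in> bump_algebra"
      by (intro bump_algebra.mult bump_algebra.base insert.IH)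
    then show ?case using insert.hyps by (simp only: prod.insert not_False_eq_True if_False)
  qed
  then have Ck: "Ck_fun k \<phi>" for k
    unfolding \<phi>_def by (intro bump_algebra_Ck_fun) simp
  have supp: "\<phi> x = 0" if "norm x \<ge> e" for x
  proof -
    have "\<exists>i. \<bar>x $ i\<bar> \<ge> d"
    proof (rule ccontr)
      assume "\<not> ?thesis"
      then have "(\<Sum>i\<in>UNIV. \<bar>x $ i\<bar>) < (\<Sum>i\<in>(UNIV::'n set). d)"
        by (intro sum_strict_mono) (auto simp: not_le)
      moreover have "norm x \<le> (\<Sum>i\<in>UNIV. \<bar>x $ i\<bar>)" by (rule norm_le_l1_cart)
      ultimately show False using that by (simp add: d_def)
    qed
    then obtain i where "\<bar>x $ i\<bar> \<ge> d" ..
    then have "flat_exp 0 (d + (- 1) * x $ i) * flat_exp 0 (d + 1 * x $ i) = 0"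
      by (auto simp: flat_exp_def)
    then show ?thesis unfolding \<phi>_def by (intro prod_zero) auto
  qed
  have \<phi>: "\<phi> \<in> test_funs" by (rule test_funI[OF Ck supp])
  have nn: "\<phi> x \<ge> 0" for x by (auto simp: \<phi>_def flat_exp_def intro!: prod_nonneg)
  have even: "\<phi> (- x) = \<phi> x" for x by (simp add: \<phi>_def mult.commute)
  have pos: "\<phi> 0 > 0" using d by (auto simp: \<phi>_def flat_exp_def intro!: prod_pos)
  have cont: "continuous_on UNIV \<phi>" by (rule test_fun_continuous[OF \<phi>])
  have supp': "\<phi> = (\<lambda>x. indicator (cball 0 e) x *\<^sub>R \<phi> x)"
    using supp by (force simp: indicator_def)
  have int: "integrable lborel \<phi>"
    by (subst supp', intro borel_integrable_compact continuous_on_subset[OF cont]) auto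
  \<comment> \<open>Otherwise the zero set would have full measure; being closed, it would be
    everything and contain the origin, where \<open>\<phi>\<close> is positive.\<close>
  have "integral\<^sup>L lborel \<phi> \<noteq> 0"
  proof
    assume "integral\<^sup>L lborel \<phi> = 0"
    then have "AE x in lborel. \<phi> x = 0"
      using integral_nonneg_eq_0_iff_AE[OF int] nn by auto
    then have "AE x in lebesgue. x \<in> {x. \<phi> x = 0}"
      using AE_completion by auto
    moreover have "closed {x. \<phi> x = 0}"
      using cont by (intro closed_Collect_eq) auto
    ultimately have "0 \<in> {x. \<phi> x = 0}" by (rule mem_closed_if_AE_lebesgue[rotated])
    then show False using pos by auto
  qed
  moreover have "integral\<^sup>L lborel \<phi> \<ge> 0" using nn by (intro integral_nonneg_AE) auto
  ultimately have I: "integral\<^sup>L lborel \<phi> > 0" by simp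
  show ?thesis
  proof (rule that[of "\<lambda>x. (1 / integral\<^sup>L lborel \<phi>) * \<phi> x"])
    show "(\<lambda>x. 1 / integral\<^sup>L lborel \<phi> * \<phi> x) \<in> test_funs" by (rule test_fun_cmult[OF \<phi>])
  qed (use I nn even supp in auto)
qed

section \<open>Convolution with test functions\<close>

text \<open>Borel rather than Lebesgue measurability is required, so that Fubini's theorem applies
  on the product of \<open>lborel\<close> with itself.\<close>

definition locally_integrable :: "('a::euclidean_space \<Rightarrow> real) \<Rightarrow> bool" where
  "locally_integrable f \<longleftrightarrow> f \<in> borel_measurable borel \<and> (\<forall>R. integrable lborel (\<lambda>x. indicator (cball 0 R) x * f x))"

definition convol :: "('a::euclidean_space \<Rightarrow> real) \<Rightarrow> ('a \<Rightarrow> real) \<Rightarrow> 'a \<Rightarrow> real" where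
  "convol f \<psi> x = (LINT y|lborel. f y * \<psi> (x - y))"

lemma test_fun_measurable:
  assumes "\<phi> \<in> test_funs"
  shows "\<phi> \<in> borel_measurable borel"
  using test_fun_continuous[OF assms] by (rule borel_measurable_continuous_onI)

lemma locally_integrable_times:
  fixes f :: "real ^ 'n \<Rightarrow> real"
  assumes f: "locally_integrable f" and [measurable]: "g \<in> borel_measurable borel"
    and B: "\<And>x. \<bar>g x\<bar> \<le> B" and R: "\<And>x. norm x > R \<Longrightarrow> g x = 0"
  shows "integrable lborel (\<lambda>x. f x * g x)"
proof -
  have [measurable]: "f \<in> borel_measurable borel" using f by (simp add: locally_integrable_def)
  have "integrable lborel (\<lambda>x. B * (indicator (cball 0 R) x * f x))"
    using f unfolding locally_integrable_def by (intro integrable_mult_right) blast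
  then show ?thesis
  proof (rule Bochner_Integration.integrable_bound)
    show "AE x in lborel. norm (f x * g x) \<le> norm (B * (indicator (cball 0 R) x * f x))"
    proof (rule AE_I2)
      fix x
      have "\<bar>f x\<bar> * \<bar>g x\<bar> \<le> \<bar>f x\<bar> * \<bar>B\<bar>" using B[of x] by (intro mult_left_mono) auto
      then show "norm (f x * g x) \<le> norm (B * (indicator (cball 0 R) x * f x))"
        using R[of x] by (cases "norm x \<le> R") (auto simp: abs_mult mult.commute)
    qed
  qed measurable
qed

lemma integrable_convol:
  fixes f :: "real ^ 'n \<Rightarrow> real"
  assumes "locally_integrable f" "\<psi> \<in> test_funs"
  shows "integrable lborel (\<lambda>y. f y * \<psi> (x - y))"
proof -
  have [measurable]: "\<psi> \<in> borel_measurable borel" by (rule test_fun_measurable[OF assms(2)])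
  obtain R where R: "\<And>x. norm x \<ge> R \<Longrightarrow> \<psi> x = 0" using test_fun_support[OF assms(2)] by metis
  obtain B where B: "\<And>x. \<bar>\<psi> x\<bar> \<le> B" using test_fun_bounded[OF assms(2)] by metis
  show ?thesis
  proof (rule locally_integrable_times[OF assms(1), of _ B "norm x + R"])
    show "\<psi> (x - y) = 0" if "norm y > norm x + R" for y
      using that norm_triangle_ineq2[of y x] by (intro R) (simp add: norm_minus_commute)
  qed (use B in auto)
qed

lemma test_fun_uniformly_continuous:
  fixes \<phi> :: "real ^ 'n \<Rightarrow> real"
  assumes "\<phi> \<in> test_funs" "e > 0"
  obtains d where "d > 0" "\<And>x y. norm (x - y) < d \<Longrightarrow> \<bar>\<phi> x - \<phi> y\<bar> < e"
proof -
  obtain R where R: "R > 0" "\<And>x. norm x \<ge> R \<Longrightarrow> \<phi> x = 0" using test_fun_support[OF assms(1)] by metis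
  have "uniformly_continuous_on (cball 0 (R + 1)) \<phi>"
    using test_fun_continuous[OF assms(1)] by (intro compact_uniformly_continuous) (auto intro: continuous_on_subset)
  then obtain d where d: "d > 0"
    "\<And>x y. x \<in> cball 0 (R + 1) \<Longrightarrow> y \<in> cball 0 (R + 1) \<Longrightarrow> dist x y < d \<Longrightarrow> dist (\<phi> x) (\<phi> y) < e"
    unfolding uniformly_continuous_on_def using assms(2) by metis
  have "\<bar>\<phi> x - \<phi> y\<bar> < e" if "norm (x - y) < min d 1" for x y
  proof (cases "norm x \<le> R \<or> norm y \<le> R")
    case True
    then have "norm x \<le> R + 1" "norm y \<le> R + 1"
      using that norm_triangle_sub[of x y] norm_triangle_sub[of y x] by (auto simp: norm_minus_commute)
    then show ?thesis using d(2)[of x y] that by (simp add: dist_norm)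
  next
    case False
    then show ?thesis using R(2)[of x] R(2)[of y] assms(2) by simp
  qed
  then show ?thesis using d(1) by (intro that[of "min d 1"]) auto
qed

text \<open>Mean value theorem on the segment from \<open>x\<close> to \<open>x + h\<close>. The
  bound does not depend on \<open>x\<close>, which is what differentiation under the integral sign
  needs.\<close>

lemma test_fun_linearization:
  fixes \<phi> :: "real ^ 'n \<Rightarrow> real"
  assumes \<phi>: "\<phi> \<in> test_funs"
    and d: "\<And>i x y. norm (x - y) < d \<Longrightarrow> \<bar>partial_deriv i \<phi> x - partial_deriv i \<phi> y\<bar> \<le> e"
    and h: "norm h < d"
  shows "\<bar>\<phi> (x + h) - \<phi> x - (\<Sum>i\<in>UNIV. h $ i * partial_deriv i \<phi> x)\<bar> \<le> real CARD('n) * norm h * e"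
proof -
  let ?D = "\<lambda>x h. \<Sum>i\<in>UNIV. h $ i * partial_deriv i \<phi> x"
  have D: "((\<lambda>t. \<phi> (x + t *\<^sub>R h)) has_derivative (\<lambda>s. ?D (x + t *\<^sub>R h) (s *\<^sub>R h))) (at t within S)" for t S
    by (rule has_derivative_compose[OF _ has_derivative_partial_deriv[OF test_fun_differentiable[OF \<phi>]]])
      (auto intro!: derivative_eq_intros)
  obtain t where t: "0 < t" "t < 1" and "\<phi> (x + 1 *\<^sub>R h) - \<phi> (x + 0 *\<^sub>R h) = ?D (x + t *\<^sub>R h) ((1 - 0) *\<^sub>R h)"
    using mvt_simple[OF zero_less_one D] by (auto simp: greaterThanLessThan_iff)
  then have "\<phi> (x + h) - \<phi> x - ?D x h = (\<Sum>i\<in>UNIV. h $ i * (partial_deriv i \<phi> (x + t *\<^sub>R h) - partial_deriv i \<phi> x))"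
    by (simp add: sum_subtractf algebra_simps)
  also have "\<bar>\<dots>\<bar> \<le> (\<Sum>i\<in>UNIV. \<bar>h $ i * (partial_deriv i \<phi> (x + t *\<^sub>R h) - partial_deriv i \<phi> x)\<bar>)" by (rule sum_abs)
  also have "\<dots> \<le> (\<Sum>i\<in>(UNIV::'n set). norm h * e)"
  proof (intro sum_mono)
    fix i :: 'n
    have "norm (x + t *\<^sub>R h - x) < d" using h t mult_left_le_one_le[of "norm h" t] by simp
    then show "\<bar>h $ i * (partial_deriv i \<phi> (x + t *\<^sub>R h) - partial_deriv i \<phi> x)\<bar> \<le> norm h * e"
      unfolding abs_mult by (intro mult_mono component_le_norm_cart d) auto
  qed
  finally show ?thesis by (simp add: algebra_simps)
qed

text \<open>The linearization error of \<open>\<psi>\<close> is uniformly small relative to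
  \<open>norm h\<close> and vanishes outside one fixed ball around the origin, on which
  \<open>f\<close> is integrable. Integrating it against \<open>f\<close> gives the error for the
  convolution.\<close>

lemma convol_has_derivative:
  fixes f :: "real ^ 'n \<Rightarrow> real"
  assumes f: "locally_integrable f" and \<psi>: "\<psi> \<in> test_funs"
  shows "(convol f \<psi> has_derivative (\<lambda>h. \<Sum>i\<in>UNIV. h $ i * convol f (partial_deriv i \<psi>) x)) (at x)"
  unfolding has_derivative_at_alt
proof (intro conjI allI impI)
  show "bounded_linear (\<lambda>h. \<Sum>i\<in>UNIV. h $ i * convol f (partial_deriv i \<psi>) x)"
    by (intro bounded_linear_sum bounded_linear_mult_const bounded_linear_vec_nth)
next
  fix e :: real assume e: "e > 0"
  have [measurable]: "f \<in> borel_measurable borel" using f by (simp add: locally_integrable_def)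
  obtain R where R: "R > 0" "\<And>x. norm x \<ge> R \<Longrightarrow> \<psi> x = 0" using test_fun_support[OF \<psi>] by metis
  \<comment> \<open>For \<open>norm h < 1\<close> and \<open>norm z > S\<close>, both
    \<open>x - z\<close> and \<open>y - z\<close> lie beyond the support radius \<open>R\<close>,
    the former strictly, so the derivatives at \<open>x - z\<close> vanish too.\<close>
  define S where "S = norm x + R + 2"
  let ?g = "\<lambda>y. \<bar>indicator (cball 0 S) y * f y\<bar>"
  have g: "integrable lborel ?g" using f unfolding locally_integrable_def by (intro integrable_abs) blast
  define K where "K = integral\<^sup>L lborel ?g"
  have K: "K \<ge> 0" unfolding K_def by (intro integral_nonneg_AE) auto
  \<comment> \<open>Chosen so that the final bound \<open>CARD('n) * norm h * e' * K\<close> is at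
    most \<open>e * norm h\<close>; the summand 1 protects against \<open>K = 0\<close>.\<close>
  define e' where "e' = e / (real CARD('n) * (K + 1))"
  have e': "e' > 0" using e K by (simp add: e'_def)
  have "\<exists>d>0. \<forall>x y. norm (x - y) < d \<longrightarrow> \<bar>partial_deriv i \<psi> x - partial_deriv i \<psi> y\<bar> \<le> e'" for i
    using test_fun_uniformly_continuous[OF partial_deriv_test_fun[OF \<psi>, of i] e'] by (metis less_imp_le)
  then obtain \<delta> where \<delta>: "\<And>i. \<delta> i > 0"
    "\<And>i x y. norm (x - y) < \<delta> i \<Longrightarrow> \<bar>partial_deriv i \<psi> x - partial_deriv i \<psi> y\<bar> \<le> e'" by metis
  define d where "d = min 1 (Min (range \<delta>))"
  have d: "d > 0" "d \<le> 1" "\<And>i. d \<le> \<delta> i" using \<delta>(1) by (auto simp: d_def min.coboundedI2)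
  have *: "norm (convol f \<psi> y - convol f \<psi> x - (\<Sum>i\<in>UNIV. (y - x) $ i * convol f (partial_deriv i \<psi>) x)) \<le> e * norm (y - x)"
    if "norm (y - x) < d" for y
  proof -
    define h where "h = y - x"
    have h: "norm h < d" "norm h < 1" using that d by (auto simp: h_def)
    let ?r = "\<lambda>z. \<psi> (y - z) - \<psi> (x - z) - (\<Sum>i\<in>UNIV. h $ i * partial_deriv i \<psi> (x - z))"
    note int = integrable_convol[OF f \<psi>] integrable_convol[OF f partial_deriv_test_fun[OF \<psi>]]
    have eq: "convol f \<psi> y - convol f \<psi> x - (\<Sum>i\<in>UNIV. h $ i * convol f (partial_deriv i \<psi>) x) = (LINT z|lborel. f z * ?r z)"
    proof -
      have "(\<Sum>i\<in>UNIV. h $ i * convol f (partial_deriv i \<psi>) x) = (LINT z|lborel. (\<Sum>i\<in>UNIV. h $ i * (f z * partial_deriv i \<psi> (x - z))))"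
        unfolding convol_def using int by (subst Bochner_Integration.integral_sum) auto
      then have "convol f \<psi> y - convol f \<psi> x - (\<Sum>i\<in>UNIV. h $ i * convol f (partial_deriv i \<psi>) x) =
          (LINT z|lborel. f z * \<psi> (y - z) - f z * \<psi> (x - z) - (\<Sum>i\<in>UNIV. h $ i * (f z * partial_deriv i \<psi> (x - z))))"
        unfolding convol_def using int by simp
      also have "\<dots> = (LINT z|lborel. f z * ?r z)"
        by (intro Bochner_Integration.integral_cong) (auto simp: algebra_simps sum_distrib_left)
      finally show ?thesis .
    qed
    let ?c = "real CARD('n) * norm h * e'"
    have "norm (LINT z|lborel. f z * ?r z) \<le> (LINT z|lborel. ?c * ?g z)"
    proof (rule Bochner_Integration.integral_norm_bound_integral)
      have "integrable lborel (\<lambda>z. f z * \<psi> (y - z) - f z * \<psi> (x - z) - (\<Sum>i\<in>UNIV. h $ i * (f z * partial_deriv i \<psi> (x - z))))"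
        using int by auto
      then show "integrable lborel (\<lambda>z. f z * ?r z)" by (simp add: algebra_simps sum_distrib_left)
      show "integrable lborel (\<lambda>z. ?c * ?g z)" using g by (rule integrable_mult_right)
      fix z
      show "norm (f z * ?r z) \<le> ?c * ?g z"
      proof (cases "norm z \<le> S")
        case True
        have "\<bar>\<psi> (x - z + h) - \<psi> (x - z) - (\<Sum>i\<in>UNIV. h $ i * partial_deriv i \<psi> (x - z))\<bar> \<le> ?c"
          by (rule test_fun_linearization[OF \<psi> _ h(1)]) (use \<delta>(2) d(3) less_le_trans in blast)
        moreover have "x - z + h = y - z" by (simp add: h_def)
        ultimately have "\<bar>?r z\<bar> \<le> ?c" by simp
        then have "\<bar>f z\<bar> * \<bar>?r z\<bar> \<le> \<bar>f z\<bar> * ?c" by (rule mult_left_mono) simp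
        then show ?thesis using True by (simp add: abs_mult mult.commute)
      next
        case False
        then have z: "norm z > norm x + R + 2" by (simp add: S_def)
        have 1: "norm (x - z) > R + 2" using z norm_triangle_ineq2[of z x] by (simp add: norm_minus_commute)
        have "norm (y - z) \<ge> R" using 1 h(2) norm_triangle_ineq2[of "x - z" "x - y"] by (simp add: h_def norm_minus_commute)
        then have "?r z = 0" using 1 R(2) partial_deriv_zero_outside[of R \<psi> "x - z"] R by simp
        then show ?thesis using e' by simp
      qed
    qed
    also have "\<dots> = ?c * K" by (simp add: K_def)
    also have "\<dots> = e * norm h * (K / (K + 1))" using K by (simp add: e'_def)
    also have "\<dots> \<le> e * norm h * 1" using K e by (intro mult_left_mono) auto
    finally show ?thesis unfolding eq[unfolded h_def] by (simp add: h_def)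
  qed
  then show "\<exists>d>0. \<forall>y. norm (y - x) < d \<longrightarrow> norm (convol f \<psi> y - convol f \<psi> x - (\<Sum>i\<in>UNIV. (y - x) $ i * convol f (partial_deriv i \<psi>) x)) \<le> e * norm (y - x)"
    using d(1) by blast
qed

lemma
  fixes f :: "real ^ 'n \<Rightarrow> real"
  assumes "locally_integrable f" "\<psi> \<in> test_funs"
  shows convol_differentiable: "convol f \<psi> differentiable (at x)"
    and partial_deriv_convol: "partial_deriv i (convol f \<psi>) = convol f (partial_deriv i \<psi>)"
    and convol_continuous: "continuous_on A (convol f \<psi>)"
proof -
  note D = convol_has_derivative[OF assms]
  show "convol f \<psi> differentiable (at x)" using D by (auto simp: differentiable_def)
  show "partial_deriv i (convol f \<psi>) = convol f (partial_deriv i \<psi>)"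
  proof
    fix x
    have "(\<Sum>j\<in>UNIV. axis i 1 $ j * convol f (partial_deriv j \<psi>) x) =
        (\<Sum>j\<in>UNIV. if j = i then convol f (partial_deriv j \<psi>) x else 0)"
      by (intro sum.cong) (auto simp: axis_def)
    then show "partial_deriv i (convol f \<psi>) x = convol f (partial_deriv i \<psi>) x"
      unfolding partial_deriv_eq[OF D] by simp
  qed
  show "continuous_on A (convol f \<psi>)"
    using has_derivative_continuous[OF D] by (simp add: continuous_at_imp_continuous_on)
qed

text \<open>The convolutions of \<open>f\<close> with all test functions form a class stable under
  partial derivatives, and support radii add.\<close>

lemma convol_test_fun:
  fixes f :: "real ^ 'n \<Rightarrow> real"
  assumes f: "locally_integrable f" and S: "\<And>x. norm x > S \<Longrightarrow> f x = 0" and \<psi>: "\<psi> \<in> test_funs"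
  shows "convol f \<psi> \<in> test_funs"
proof -
  obtain R where R: "R > 0" "\<And>x. norm x \<ge> R \<Longrightarrow> \<psi> x = 0" using test_fun_support[OF \<psi>] by metis
  show ?thesis
  proof (rule test_funI)
    show "Ck_fun k (convol f \<psi>)" for k
    proof (rule Ck_funI[of _ "convol f ` test_funs"])
      show "convol f \<psi> \<in> convol f ` test_funs" using \<psi> by blast
    qed (auto simp: convol_differentiable[OF f] partial_deriv_convol[OF f] intro: partial_deriv_test_fun)
    show "convol f \<psi> x = 0" if "norm x \<ge> S + R" for x
    proof -
      have "f y * \<psi> (x - y) = 0" for y
        using S[of y] R(2)[of "x - y"] that norm_triangle_ineq2[of x y] by (cases "norm y > S") auto
      then show ?thesis by (simp only: convol_def Bochner_Integration.integral_zero)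
    qed
  qed
qed

lemma integrable_tensor:
  fixes f g :: "real ^ 'n \<Rightarrow> real"
  assumes f: "integrable lborel f" and g: "integrable lborel g"
  shows "integrable (lborel \<Otimes>\<^sub>M lborel) (\<lambda>(x, y). f x * g y)"
proof (rule lborel_pair.Fubini_integrable)
  have [measurable]: "f \<in> borel_measurable lborel" "g \<in> borel_measurable lborel" using f g by auto
  show "(\<lambda>(x, y). f x * g y) \<in> borel_measurable (lborel \<Otimes>\<^sub>M lborel)" by measurable
  show "integrable lborel (\<lambda>x. LINT y|lborel. norm (case (x, y) of (x, y) \<Rightarrow> f x * g y))"
    using f by (simp add: abs_mult)
qed (use g in auto)

text \<open>Fubini's theorem; exchanging the variables reflects the kernel. This is the device that
  carries a mollifier, or its derivative, between \<open>u\<close> and the function paired with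
  it.\<close>

lemma convol_duality:
  fixes u s :: "real ^ 'n \<Rightarrow> real"
  assumes u: "locally_integrable u" and [measurable]: "s \<in> borel_measurable borel"
    and B: "\<And>x. \<bar>s x\<bar> \<le> B" and S: "\<And>x. norm x > S \<Longrightarrow> s x = 0" and \<theta>: "\<theta> \<in> test_funs"
  shows "(LINT x|lborel. u x * convol s \<theta> x) = (LINT y|lborel. s y * convol u (\<lambda>z. \<theta> (- z)) y)"
proof -
  have [measurable]: "u \<in> borel_measurable borel" using u by (simp add: locally_integrable_def)
  have [measurable]: "\<theta> \<in> borel_measurable borel" by (rule test_fun_measurable[OF \<theta>])
  obtain R where R: "R > 0" "\<And>x. norm x \<ge> R \<Longrightarrow> \<theta> x = 0" using test_fun_support[OF \<theta>] by metis
  obtain C where C: "C > 0" "\<And>x. \<bar>\<theta> x\<bar> \<le> C" using test_fun_bounded[OF \<theta>] by metis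
  have B0: "B \<ge> 0" using B[of 0] by simp
  \<comment> \<open>The double integrand is nonzero only for \<open>norm y \<le> S\<close> and
    \<open>norm (x - y) < R\<close>, hence only for \<open>norm x \<le> S + R\<close>; a tensor
    product of cut-off functions dominates it.\<close>
  have "integrable lborel (\<lambda>x. \<bar>indicator (cball 0 (S + R)) x * u x\<bar>)"
    using u unfolding locally_integrable_def by (intro integrable_abs) blast
  moreover have "integrable lborel (\<lambda>y::real^'n. B * C * indicator (cball 0 S) y)"
    by (intro integrable_mult_right integrable_real_indicator emeasure_lborel_cball_finite) auto
  ultimately have "integrable (lborel \<Otimes>\<^sub>M lborel) (\<lambda>(x, y :: real ^ 'n). \<bar>indicator (cball 0 (S + R)) x * u x\<bar> * (B * C * indicator (cball 0 S) y))"
    by (rule integrable_tensor)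
  then have int: "integrable (lborel \<Otimes>\<^sub>M lborel) (\<lambda>(x, y). u x * (s y * \<theta> (x - y)))"
  proof (rule Bochner_Integration.integrable_bound)
    show "(\<lambda>(x, y). u x * (s y * \<theta> (x - y))) \<in> borel_measurable (lborel \<Otimes>\<^sub>M lborel)"
      by measurable
    show "AE p in lborel \<Otimes>\<^sub>M lborel. norm (case p of (x, y) \<Rightarrow> u x * (s y * \<theta> (x - y)))
      \<le> norm (case p of (x, y) \<Rightarrow> \<bar>indicator (cball 0 (S + R)) x * u x\<bar> * (B * C * indicator (cball 0 S) y))"
    proof (rule AE_I2, clarify)
      fix x y :: "real ^ 'n"
      show "norm (u x * (s y * \<theta> (x - y))) \<le> norm (\<bar>indicator (cball 0 (S + R)) x * u x\<bar> * (B * C * indicator (cball 0 S) y))"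
      proof (cases "norm y \<le> S \<and> norm (x - y) < R")
        case True
        then have "norm x \<le> S + R" using norm_triangle_sub[of x y] by linarith
        moreover have "\<bar>s y\<bar> * \<bar>\<theta> (x - y)\<bar> \<le> B * C" using B C B0 by (intro mult_mono) auto
        ultimately show ?thesis using True B0 C by (simp add: abs_mult mult_left_mono)
      next
        case False
        then have "u x * (s y * \<theta> (x - y)) = 0" using S[of y] R(2)[of "x - y"] by (auto simp: not_le not_less)
        then show ?thesis by (simp only: norm_zero norm_ge_zero)
      qed
    qed
  qed
  have "(LINT x|lborel. u x * convol s \<theta> x) = (LINT x|lborel. LINT y|lborel. u x * (s y * \<theta> (x - y)))"
    by (simp add: convol_def)
  also have "\<dots> = (LINT y|lborel. LINT x|lborel. u x * (s y * \<theta> (x - y)))"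
    using lborel_pair.Fubini_integral[OF int] by simp
  also have "\<dots> = (LINT y|lborel. s y * convol u (\<lambda>z. \<theta> (- z)) y)"
    unfolding convol_def integral_mult_right_zero[symmetric]
    by (intro Bochner_Integration.integral_cong) (auto simp: algebra_simps)
  finally show ?thesis .
qed

section \<open>The Gagliardo--Nirenberg--Sobolev inequality\<close>

lemma measurable_vec_lambda_PiM [measurable]:
  "(\<lambda>x. \<chi> i. x i) \<in> (\<Pi>\<^sub>M i\<in>UNIV. lborel) \<rightarrow>\<^sub>M (borel :: (real ^ 'n) measure)"
  by (subst borel_measurable_euclidean_space) (auto simp: Basis_vec_def inner_axis)

text \<open>Both measures agree on boxes. This carries the Loomis-Whitney inequality from product
  measures to \<open>real ^ 'n\<close>.\<close>

lemma lborel_eq_distr_PiM: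
  "(lborel :: (real ^ 'n) measure) = distr (\<Pi>\<^sub>M i\<in>UNIV. lborel) borel (\<lambda>x. \<chi> i. x i)"
proof (rule lborel_eqI)
  interpret product_sigma_finite "\<lambda>_::'n. lborel :: real measure" ..
  fix l u :: "real ^ 'n"
  assume lu: "\<And>b. b \<in> Basis \<Longrightarrow> l \<bullet> b \<le> u \<bullet> b"
  have "axis i 1 \<in> (Basis :: (real ^ 'n) set)" for i by (auto simp: Basis_vec_def)
  from lu[OF this] have le: "l $ i \<le> u $ i" for i by (simp add: inner_axis)
  have "emeasure (distr (\<Pi>\<^sub>M i\<in>UNIV. lborel) borel (\<lambda>x. \<chi> i. x i)) (box l u) =
      emeasure (\<Pi>\<^sub>M i\<in>UNIV. lborel) (\<Pi>\<^sub>E i\<in>(UNIV::'n set). {l $ i <..< u $ i})"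
    by (subst emeasure_distr) (auto intro!: arg_cong[where f = "emeasure _"] simp: mem_box_cart space_PiM PiE_def Pi_def)
  also have "\<dots> = (\<Prod>i\<in>UNIV. ennreal (u $ i - l $ i))"
    using le by (subst emeasure_PiM) auto
  also have "\<dots> = (\<Prod>b\<in>Basis. ennreal ((u - l) \<bullet> b))"
  proof -
    have "Basis = (\<lambda>i::'n. axis i (1::real)) ` UNIV" by (auto simp: Basis_vec_def)
    moreover have "inj (\<lambda>i::'n. axis i (1::real))" by (auto simp: inj_def axis_eq_axis)
    ultimately show ?thesis by (subst \<open>Basis = _\<close>, subst prod.reindex) (auto simp: inner_axis inner_diff_left)
  qed
  also have "\<dots> = ennreal (\<Prod>b\<in>Basis. (u - l) \<bullet> b)"
    using lu by (intro prod_ennreal) (simp add: inner_diff_left)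
  finally show "emeasure (distr (\<Pi>\<^sub>M i\<in>UNIV. lborel) borel (\<lambda>x. \<chi> i. x i)) (box l u) = ennreal (\<Prod>b\<in>Basis. (u - l) \<bullet> b)" .
qed simp

text \<open>\<open>D i\<close> stands for the absolute value of the partial derivative in direction
  \<open>i\<close>. The power \<open>m / (m - 1)\<close> of \<open>w\<close> is a product of
  \<open>m\<close> powers \<open>1 / (m - 1)\<close>, and bounding each copy along a different axis
  produces factors to which Loomis-Whitney applies.\<close>

theorem Gagliardo_nn_integral:
  fixes w :: "real ^ 'n \<Rightarrow> ennreal"
  assumes n: "CARD('n) \<ge> 2"
    and [measurable]: "w \<in> borel_measurable borel" "\<And>i. D i \<in> borel_measurable borel"
    and line: "\<And>i x. w x \<le> (\<integral>\<^sup>+t. D i (\<chi> j. if j = i then t else x $ j) \<partial>lborel)"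
  shows "(\<integral>\<^sup>+x. epowr (w x) (real CARD('n) / (real CARD('n) - 1)) \<partial>lborel)
    \<le> (\<Prod>i\<in>UNIV. epowr (\<integral>\<^sup>+x. D i x \<partial>lborel) (1 / (real CARD('n) - 1)))"
proof -
  interpret product_sigma_finite "\<lambda>_::'n. lborel :: real measure" ..
  define m where "m = real CARD('n)"
  have m: "m > 1" using n by (simp add: m_def)
  let ?v = "\<lambda>x. (\<chi> i. x i) :: real ^ 'n"
  let ?P = "\<lambda>I. \<Pi>\<^sub>M i\<in>I. (lborel :: real measure)"
  \<comment> \<open>The update at \<open>i\<close> overwrites that coordinate, so \<open>g i\<close>
    is a function of the remaining ones, as Loomis-Whitney demands.\<close>
  define g where "g i y = (\<integral>\<^sup>+t. D i (?v (y(i := t))) \<partial>lborel)" for i y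
  have ins: "insert i (UNIV - {i}) = UNIV" for i :: 'n by auto
  have Dv: "(\<lambda>x. D i (?v x)) \<in> borel_measurable (?P (insert i (UNIV - {i})))" for i
    unfolding ins by measurable
  have "(\<lambda>(y, t). D i (?v (y(i := t)))) \<in> borel_measurable (?P (UNIV - {i}) \<Otimes>\<^sub>M lborel)" for i
    using measurable_compose[OF measurable_add_dim Dv] by (simp add: case_prod_beta')
  then have g [measurable]: "g i \<in> borel_measurable (?P (UNIV - {i}))" for i
    unfolding g_def by (rule lborel.borel_measurable_nn_integral)
  have gint: "(\<integral>\<^sup>+y. g i y \<partial>?P (UNIV - {i})) = (\<integral>\<^sup>+x. D i x \<partial>lborel)" for i
  proof -
    have "(\<integral>\<^sup>+y. g i y \<partial>?P (UNIV - {i})) = (\<integral>\<^sup>+x. D i (?v x) \<partial>?P (insert i (UNIV - {i})))"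
      unfolding g_def by (rule product_nn_integral_insert[OF _ _ Dv, symmetric]) auto
    then show ?thesis by (simp add: ins lborel_eq_distr_PiM nn_integral_distr)
  qed
  have "(\<integral>\<^sup>+x. epowr (w x) (m / (m - 1)) \<partial>lborel) = (\<integral>\<^sup>+x. epowr (w (?v x)) (m / (m - 1)) \<partial>?P UNIV)"
    by (simp add: lborel_eq_distr_PiM nn_integral_distr)
  also have "\<dots> \<le> (\<integral>\<^sup>+x. (\<Prod>i\<in>UNIV. epowr (g i (restrict x (UNIV - {i}))) (1 / (m - 1))) \<partial>?P UNIV)"
  proof (intro nn_integral_mono)
    fix x
    have le: "w (?v x) \<le> g i (restrict x (UNIV - {i}))" for i
    proof -
      have "?v ((restrict x (UNIV - {i}))(i := t)) = (\<chi> j. if j = i then t else ?v x $ j)" for t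
        by (simp add: vec_eq_iff)
      then show ?thesis using line[of "?v x" i] by (simp add: g_def)
    qed
    have "epowr (w (?v x)) (m / (m - 1)) = (\<Prod>i\<in>(UNIV::'n set). epowr (w (?v x)) (1 / (m - 1)))"
      using m by (subst prod_epowr_const) (auto simp: m_def)
    also have "\<dots> \<le> (\<Prod>i\<in>UNIV. epowr (g i (restrict x (UNIV - {i}))) (1 / (m - 1)))"
      using m by (intro prod_mono_ennreal epowr_mono le) auto
    finally show "epowr (w (?v x)) (m / (m - 1)) \<le> \<dots>" .
  qed
  also have "\<dots> \<le> (\<Prod>i\<in>UNIV. epowr (\<integral>\<^sup>+x. g i x \<partial>?P (UNIV - {i})) (1 / (m - 1)))"
    using n unfolding m_def by (intro Loomis_Whitney) auto
  finally show ?thesis by (simp add: gint m_def)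
qed

section \<open>Decay of mollifications and the bound by line integrals\<close>

lemma cball_in_sets_borel [measurable]: "cball x r \<in> sets borel"
  by simp

text \<open>Values below the threshold \<open>d\<close> are absorbed by \<open>d\<close>; above it
  the decreasing factor \<open>\<bar>a\<bar> powr (1 - p)\<close> is at most
  \<open>d powr (1 - p)\<close>. The free threshold later makes the first summand small.\<close>

lemma abs_le_add_powr:
  fixes a d p :: real
  assumes "d > 0" "p \<ge> 1"
  shows "\<bar>a\<bar> \<le> d + d powr (1 - p) * \<bar>a\<bar> powr p"
proof (cases "\<bar>a\<bar> \<le> d")
  case True
  moreover have "0 \<le> d powr (1 - p) * \<bar>a\<bar> powr p" by simp
  ultimately show ?thesis by linarith
next
  case False
  then have a: "\<bar>a\<bar> > d" by simp
  have "\<bar>a\<bar> = \<bar>a\<bar> powr (1 - p) * \<bar>a\<bar> powr p"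
    using a assms by (simp flip: powr_add)
  also have "\<dots> \<le> d powr (1 - p) * \<bar>a\<bar> powr p"
    using a assms by (intro mult_right_mono powr_mono2') auto
  finally show ?thesis using assms by simp
qed

lemma locally_integrable_powr:
  fixes u :: "real ^ 'n \<Rightarrow> real"
  assumes [measurable]: "u \<in> borel_measurable borel" and p: "p \<ge> 1"
    and int: "integrable lborel (\<lambda>x. \<bar>u x\<bar> powr p)"
  shows "locally_integrable u"
  unfolding locally_integrable_def
proof (intro conjI allI)
  fix R
  have "integrable lborel (\<lambda>x::real^'n. indicator (cball 0 R) x + \<bar>u x\<bar> powr p)"
    using int by (intro Bochner_Integration.integrable_add integrable_real_indicator emeasure_lborel_cball_finite) auto
  then show "integrable lborel (\<lambda>x. indicator (cball 0 R) x * u x)"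
  proof (rule Bochner_Integration.integrable_bound)
    show "AE x in lborel. norm (indicator (cball 0 R) x * u x) \<le> norm (indicator (cball 0 R) x + \<bar>u x\<bar> powr p)"
      using abs_le_add_powr[OF zero_less_one p] by (intro AE_I2) (auto simp: indicator_def)
  qed measurable
qed measurable

text \<open>By dominated convergence the integral of \<open>\<bar>u\<bar> powr p\<close> over a ball
  of fixed radius escaping to infinity tends to 0. Splitting \<open>\<bar>u\<bar>\<close> at a small
  threshold turns this into smallness of its integral over that ball.\<close>

lemma convol_decay:
  fixes u :: "real ^ 'n \<Rightarrow> real"
  assumes [measurable]: "u \<in> borel_measurable borel" and p: "p \<ge> 1"
    and int: "integrable lborel (\<lambda>x. \<bar>u x\<bar> powr p)"
    and \<psi>: "\<psi> \<in> test_funs" and z: "filterlim (\<lambda>n. norm (z n)) at_top sequentially"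
  shows "(\<lambda>n. convol u \<psi> (z n)) \<longlonglongrightarrow> 0"
proof (rule LIMSEQ_I)
  fix e :: real assume e: "e > 0"
  have loc: "locally_integrable u" by (rule locally_integrable_powr) fact+
  have [measurable]: "\<psi> \<in> borel_measurable borel" by (rule test_fun_measurable[OF \<psi>])
  obtain R where R: "R > 0" "\<And>x. norm x \<ge> R \<Longrightarrow> \<psi> x = 0" using test_fun_support[OF \<psi>] by metis
  obtain B where B: "B > 0" "\<And>x. \<bar>\<psi> x\<bar> \<le> B" using test_fun_bounded[OF \<psi>] by metis
  define K where "K = measure lborel (cball (0::real^'n) R)"
  \<comment> \<open>The part of \<open>u\<close> below the threshold contributes at most
    \<open>B * d * K\<close>, and this choice keeps that below \<open>e / 2\<close>;
    \<open>K + 1\<close> avoids dividing by 0.\<close>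
  define d where "d = e / 2 / (K + 1) / B"
  have K: "K \<ge> 0" "K = measure lborel (cball (x::real^'n) R)" for x
    by (use R(1) in \<open>auto simp: K_def content_cball\<close>)
  have d: "d > 0" using e B K(1) by (simp add: d_def)
  let ?I = "\<lambda>n. LINT y|lborel. indicator (cball (z n) R) y * \<bar>u y\<bar> powr p"
  have "?I \<longlonglongrightarrow> (LINT y|(lborel :: (real^'n) measure). 0)"
  proof (rule integral_dominated_convergence[OF _ _ int])
    show "AE y in lborel. (\<lambda>n. indicator (cball (z n) R) y * \<bar>u y\<bar> powr p) \<longlonglongrightarrow> 0"
    proof (rule AE_I2)
      fix y :: "real ^ 'n"
      have "eventually (\<lambda>n. norm (z n) > norm y + R) sequentially"
        using z by (simp add: filterlim_at_top_dense)
      then have "eventually (\<lambda>n. indicator (cball (z n) R) y * \<bar>u y\<bar> powr p = 0) sequentially"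
      proof eventually_elim
        case (elim n)
        then have "y \<notin> cball (z n) R" using norm_triangle_ineq2[of "z n" y] by (auto simp: dist_norm)
        then show ?case by simp
      qed
      then show "(\<lambda>n. indicator (cball (z n) R) y * \<bar>u y\<bar> powr p) \<longlonglongrightarrow> 0" by (rule tendsto_eventually)
    qed
  qed (auto simp: indicator_def)
  then have "(\<lambda>n. B * (d powr (1 - p) * ?I n)) \<longlonglongrightarrow> B * (d powr (1 - p) * 0)"
    by (intro tendsto_intros) simp
  then have "eventually (\<lambda>n. B * (d powr (1 - p) * ?I n) < e / 2) sequentially"
    using e by (intro order_tendstoD(2)[of _ 0]) auto
  then obtain N where N: "\<And>n. n \<ge> N \<Longrightarrow> B * (d powr (1 - p) * ?I n) < e / 2"
    by (auto simp: eventually_sequentially)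
  have "norm (convol u \<psi> (z n) - 0) < e" if "n \<ge> N" for n
  proof -
    have iI: "integrable lborel (\<lambda>y. indicator (cball (z n) R) y * \<bar>u y\<bar> powr p)"
      using int by (rule Bochner_Integration.integrable_bound) (auto simp: indicator_def)
    have "norm (convol u \<psi> (z n)) \<le> (LINT y|lborel. B * (d * indicator (cball (z n) R) y + d powr (1 - p) * (indicator (cball (z n) R) y * \<bar>u y\<bar> powr p)))"
      unfolding convol_def
    proof (rule Bochner_Integration.integral_norm_bound_integral)
      show "integrable lborel (\<lambda>y. u y * \<psi> (z n - y))" by (rule integrable_convol[OF loc \<psi>])
      show "integrable lborel (\<lambda>y. B * (d * indicator (cball (z n) R) y + d powr (1 - p) * (indicator (cball (z n) R) y * \<bar>u y\<bar> powr p)))"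
        by (intro integrable_mult_right Bochner_Integration.integrable_add iI integrable_real_indicator emeasure_lborel_cball_finite) auto
      fix y :: "real ^ 'n"
      show "norm (u y * \<psi> (z n - y)) \<le> B * (d * indicator (cball (z n) R) y + d powr (1 - p) * (indicator (cball (z n) R) y * \<bar>u y\<bar> powr p))"
      proof (cases "norm (z n - y) \<le> R")
        case True
        have "\<bar>\<psi> (z n - y)\<bar> * \<bar>u y\<bar> \<le> B * (d + d powr (1 - p) * \<bar>u y\<bar> powr p)"
          using B by (intro mult_mono abs_le_add_powr d p) auto
        then show ?thesis using True by (simp add: abs_mult dist_norm mult.commute)
      next
        case False
        then show ?thesis using R(2)[of "z n - y"] B d by simp
      qed
    qed
    also have "\<dots> = B * (d * K + d powr (1 - p) * ?I n)"
      using iI K(2)[of "z n"] by (subst integral_mult_right_zero, subst Bochner_Integration.integral_add)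
        (auto intro!: integrable_mult_right integrable_real_indicator emeasure_lborel_cball_finite)
    also have "\<dots> < e / 2 + e / 2"
    proof -
      have "B * (d * K) = e / 2 * (K / (K + 1))" using B(1) by (simp add: d_def)
      also have "\<dots> \<le> e / 2 * 1" using e K(1) by (intro mult_left_mono) auto
      finally show ?thesis using N[OF that] by (simp add: distrib_left)
    qed
    finally show ?thesis by simp
  qed
  then show "\<exists>N. \<forall>n\<ge>N. norm (convol u \<psi> (z n) - 0) < e" by blast
qed

text \<open>Fundamental theorem of calculus on the line through \<open>x\<close> parallel to axis
  \<open>i\<close>, starting at a point that moves to minus infinity; the boundary value there
  disappears by the decay of the convolution.\<close>

lemma convol_le_line_integral:
  fixes u :: "real ^ 'n \<Rightarrow> real"
  assumes u: "u \<in> borel_measurable borel" and p: "p \<ge> 1"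
    and int: "integrable lborel (\<lambda>x. \<bar>u x\<bar> powr p)" and \<psi>: "\<psi> \<in> test_funs"
  shows "ennreal \<bar>convol u \<psi> x\<bar>
    \<le> (\<integral>\<^sup>+t. ennreal \<bar>convol u (partial_deriv i \<psi>) (\<chi> j. if j = i then t else x $ j)\<bar> \<partial>lborel)"
    (is "_ \<le> ?J")
proof -
  have loc: "locally_integrable u" by (rule locally_integrable_powr) fact+
  define l where "l t = (\<chi> j. if j = i then t else x $ j)" for t
  have l_eq: "l t = x + (t - x $ i) *\<^sub>R axis i 1" for t
    by (simp add: l_def vec_eq_iff axis_def)
  have l_cont: "continuous_on A l" for A
    unfolding l_eq[abs_def] by (intro continuous_intros)
  let ?w = "convol u \<psi>" and ?dw = "\<lambda>t. convol u (partial_deriv i \<psi>) (l t)"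
  have D: "((\<lambda>t. ?w (l t)) has_vector_derivative ?dw t) (at t within A)" for t A
  proof -
    have "(l has_derivative (\<lambda>h. h *\<^sub>R axis i 1)) (at t within A)"
      unfolding l_eq[abs_def] by (auto intro!: derivative_eq_intros)
    from has_derivative_compose[OF this convol_has_derivative[OF loc \<psi>]]
    have "((\<lambda>t. ?w (l t)) has_derivative (\<lambda>h. \<Sum>j\<in>UNIV. (h *\<^sub>R axis i 1) $ j * convol u (partial_deriv j \<psi>) (l t))) (at t within A)" .
    moreover have "(\<Sum>j\<in>UNIV. (h *\<^sub>R axis i 1) $ j * convol u (partial_deriv j \<psi>) (l t)) = h *\<^sub>R ?dw t" for h
    proof -
      have "(\<Sum>j\<in>UNIV. (h *\<^sub>R axis i 1) $ j * convol u (partial_deriv j \<psi>) (l t)) =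
          (\<Sum>j\<in>UNIV. if j = i then h * convol u (partial_deriv j \<psi>) (l t) else 0)"
        by (intro sum.cong) (auto simp: axis_def)
      then show ?thesis by simp
    qed
    ultimately show ?thesis by (simp add: has_vector_derivative_def)
  qed
  have dw_cont: "continuous_on A ?dw" for A
    by (rule continuous_on_compose2[OF convol_continuous[OF loc partial_deriv_test_fun[OF \<psi>], of UNIV] l_cont]) auto
  have bound: "ennreal \<bar>?w x\<bar> \<le> ennreal \<bar>?w (l a)\<bar> + ?J" if a: "a \<le> x $ i" for a
  proof -
    have lx: "l (x $ i) = x" by (simp add: l_eq)
    have "(LINT t|lborel. indicator {a..x $ i} t *\<^sub>R ?dw t) = ?w (l (x $ i)) - ?w (l a)"
      by (rule integral_FTC_Icc[OF a D dw_cont])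
    moreover have "integrable lborel (\<lambda>t. indicator {a..x $ i} t *\<^sub>R ?dw t)"
      by (intro borel_integrable_compact dw_cont) auto
    ultimately have "ennreal (norm (?w x - ?w (l a))) \<le> (\<integral>\<^sup>+t. norm (indicator {a..x $ i} t *\<^sub>R ?dw t) \<partial>lborel)"
      using integral_norm_bound_ennreal lx by metis
    also have "\<dots> \<le> ?J"
      unfolding l_def by (intro nn_integral_mono) (auto simp: indicator_def)
    finally have le: "ennreal \<bar>?w x - ?w (l a)\<bar> \<le> ?J" by simp
    have "ennreal \<bar>?w x\<bar> \<le> ennreal (\<bar>?w (l a)\<bar> + \<bar>?w x - ?w (l a)\<bar>)" by (intro ennreal_leI) simp
    also have "\<dots> = ennreal \<bar>?w (l a)\<bar> + ennreal \<bar>?w x - ?w (l a)\<bar>" by simp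
    also have "\<dots> \<le> ennreal \<bar>?w (l a)\<bar> + ?J" using le by (rule add_left_mono)
    finally show ?thesis .
  qed
  \<comment> \<open>Subtracting \<open>\<bar>x $ i\<bar>\<close> guarantees both
    \<open>a n \<le> x $ i\<close> and \<open>real n \<le> \<bar>a n\<bar>\<close>.\<close>
  define a where "a n = - real n - \<bar>x $ i\<bar>" for n
  have "filterlim (\<lambda>n. norm (l (a n))) at_top sequentially"
  proof (rule filterlim_at_top_mono[OF filterlim_real_sequentially])
    show "eventually (\<lambda>n. real n \<le> norm (l (a n))) sequentially"
    proof (rule always_eventually, rule allI)
      fix n
      have "real n \<le> \<bar>l (a n) $ i\<bar>" by (simp add: l_def a_def)
      also have "\<dots> \<le> norm (l (a n))" by (rule component_le_norm_cart)
      finally show "real n \<le> norm (l (a n))" .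
    qed
  qed
  then have "(\<lambda>n. ?w (l (a n))) \<longlonglongrightarrow> 0" by (rule convol_decay[OF u p int \<psi>])
  then have "(\<lambda>n. ennreal \<bar>?w (l (a n))\<bar> + ?J) \<longlonglongrightarrow> ennreal 0 + ?J"
    by (intro tendsto_add tendsto_ennrealI tendsto_const tendsto_rabs_zero)
  moreover have "ennreal \<bar>?w x\<bar> \<le> ennreal \<bar>?w (l (a n))\<bar> + ?J" for n
    by (rule bound) (simp add: a_def)
  ultimately have "ennreal \<bar>?w x\<bar> \<le> ennreal 0 + ?J"
    by (intro LIMSEQ_le_const) auto
  then show ?thesis by simp
qed

lemma partial_deriv_even:
  fixes \<psi> :: "real ^ 'n \<Rightarrow> real"
  assumes \<psi>: "\<And>x. \<psi> differentiable (at x)" and even: "\<And>x. \<psi> (- x) = \<psi> x"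
  shows "partial_deriv i \<psi> (- x) = - partial_deriv i \<psi> x"
proof -
  have "((\<lambda>x. \<psi> (- x)) has_derivative (\<lambda>h. \<Sum>i\<in>UNIV. (- h) $ i * partial_deriv i \<psi> (- x))) (at x)"
    by (rule has_derivative_compose[OF _ has_derivative_partial_deriv[OF \<psi>]]) (auto intro!: derivative_eq_intros)
  then have "(\<psi> has_derivative (\<lambda>h. \<Sum>i\<in>UNIV. (- h) $ i * partial_deriv i \<psi> (- x))) (at x)"
    by (simp add: even)
  from partial_deriv_eq[OF this, of i]
  have "partial_deriv i \<psi> x = (\<Sum>j\<in>UNIV. (- axis i 1) $ j * partial_deriv j \<psi> (- x))" .
  also have "\<dots> = (\<Sum>j\<in>UNIV. if j = i then - partial_deriv j \<psi> (- x) else 0)"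
    by (intro sum.cong) (auto simp: axis_def)
  finally show ?thesis by simp
qed

lemma
  fixes \<psi> :: "real ^ 'n \<Rightarrow> real"
  assumes \<psi>: "\<psi> \<in> test_funs" "\<And>x. \<psi> x \<ge> 0" "\<And>x. \<psi> (- x) = \<psi> x" "integral\<^sup>L lborel \<psi> = 1"
  shows mollifier_translate_integrable: "integrable lborel (\<lambda>y. \<psi> (x - y))"
    and mollifier_translate_integral: "(LINT y|lborel. \<psi> (x - y)) = 1"
    and convol_bounded: "locally_integrable f \<Longrightarrow> (\<And>y. \<bar>f y\<bar> \<le> B) \<Longrightarrow> \<bar>convol f \<psi> x\<bar> \<le> B"
proof -
  have [measurable]: "\<psi> \<in> borel_measurable borel" by (rule test_fun_measurable[OF \<psi>(1)])
  have "locally_integrable (\<lambda>_::real^'n. 1)"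
    by (auto simp: locally_integrable_def intro!: integrable_real_indicator emeasure_lborel_cball_finite)
  from integrable_convol[OF this \<psi>(1), of x]
  show int: "integrable lborel (\<lambda>y. \<psi> (x - y))" by simp
  have "integral\<^sup>L lborel \<psi> = integral\<^sup>L (distr lborel borel ((+) (- x))) \<psi>"
    by (simp add: lborel_distr_plus)
  also have "\<dots> = (LINT y|lborel. \<psi> (- x + y))" by (subst integral_distr) auto
  also have "\<dots> = (LINT y|lborel. \<psi> (x - y))"
    using \<psi>(3)[of "x - _"] by (intro Bochner_Integration.integral_cong) (auto simp: algebra_simps)
  finally show one: "(LINT y|lborel. \<psi> (x - y)) = 1" using \<psi>(4) by simp
  assume f: "locally_integrable f" and B: "\<And>y. \<bar>f y\<bar> \<le> B"
  have "norm (convol f \<psi> x) \<le> (LINT y|lborel. B * \<psi> (x - y))"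
    unfolding convol_def
  proof (rule Bochner_Integration.integral_norm_bound_integral)
    show "norm (f y * \<psi> (x - y)) \<le> B * \<psi> (x - y)" for y
      using B[of y] \<psi>(2)[of "x - y"] by (simp add: abs_mult mult_right_mono)
  qed (use int integrable_convol[OF f \<psi>(1)] in auto)
  then show "\<bar>convol f \<psi> x\<bar> \<le> B" using one by simp
qed

lemma nn_integral_partial_convol_le:
  fixes u :: "real ^ 'n \<Rightarrow> real"
  assumes loc: "locally_integrable u"
    and V: "\<And>\<phi>. \<phi> \<in> test_funs \<Longrightarrow> (\<And>x. \<bar>\<phi> x\<bar> \<le> 1) \<Longrightarrow> (LINT x|lborel. u x * partial_deriv i \<phi> x) \<le> V"
    and \<psi>: "\<psi> \<in> test_funs" "\<And>x. \<psi> x \<ge> 0" "\<And>x. \<psi> (- x) = \<psi> x" "integral\<^sup>L lborel \<psi> = 1"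
  shows "(\<integral>\<^sup>+x. ennreal \<bar>convol u (partial_deriv i \<psi>) x\<bar> \<partial>lborel) \<le> ennreal V"
proof -
  let ?D = "convol u (partial_deriv i \<psi>)"
  have [measurable]: "?D \<in> borel_measurable borel"
    by (intro borel_measurable_continuous_onI convol_continuous loc partial_deriv_test_fun \<psi>)
  have psi_meas [measurable]: "\<psi> \<in> borel_measurable borel" by (rule test_fun_measurable[OF \<psi>(1)])
  \<comment> \<open>The \<open>L\<^sub>1\<close> norm of \<open>?D\<close> is attained by duality: the mollification of \<open>s k\<close> is an admissible test function.\<close>
  define s where "s k x = - sgn (?D x) * indicator (cball 0 (real k)) x" for k :: nat and x
  have [measurable]: "s k \<in> borel_measurable borel" for k unfolding s_def by measurable
  have s1: "\<bar>s k x\<bar> \<le> 1" for k x by (auto simp: s_def indicator_def sgn_if)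
  have s0: "s k x = 0" if "norm x > real k" for k x using that by (simp add: s_def)
  have s_loc: "locally_integrable (s k)" for k
    unfolding locally_integrable_def
  proof (intro conjI allI)
    fix R
    have "integrable lborel (\<lambda>x. indicator (cball 0 R) x :: real)"
      by (intro integrable_real_indicator emeasure_lborel_cball_finite) auto
    then show "integrable lborel (\<lambda>x. indicator (cball 0 R) x * s k x)"
      by (rule Bochner_Integration.integrable_bound) (use s1 in \<open>auto simp: indicator_def\<close>)
  qed measurable
  have bound: "(\<integral>\<^sup>+x. ennreal (\<bar>?D x\<bar> * indicator (cball 0 (real k)) x) \<partial>lborel) \<le> ennreal V" for k
  proof -
    let ?\<phi> = "convol (s k) \<psi>"
    have \<phi>: "?\<phi> \<in> test_funs" by (rule convol_test_fun[OF s_loc s0 \<psi>(1)])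
    have "\<bar>?\<phi> x\<bar> \<le> 1" for x
      by (rule convol_bounded[OF \<psi> s_loc s1])
    then have "(LINT x|lborel. u x * partial_deriv i ?\<phi> x) \<le> V" by (rule V[OF \<phi>])
    moreover have "partial_deriv i ?\<phi> = convol (s k) (partial_deriv i \<psi>)"
      by (rule partial_deriv_convol[OF s_loc \<psi>(1)])
    moreover have "(LINT x|lborel. u x * convol (s k) (partial_deriv i \<psi>) x) =
        (LINT x|lborel. s k x * convol u (\<lambda>z. partial_deriv i \<psi> (- z)) x)"
      by (rule convol_duality[OF loc _ s1 s0 partial_deriv_test_fun[OF \<psi>(1)]]) measurable
    \<comment> \<open>Two signs cancel: the derivative of an even kernel is odd, and
      \<open>s k\<close> was defined with a minus sign.\<close>
    moreover have "s k x * convol u (\<lambda>z. partial_deriv i \<psi> (- z)) x = \<bar>?D x\<bar> * indicator (cball 0 (real k)) x" for x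
      using partial_deriv_even[OF test_fun_differentiable[OF \<psi>(1)] \<psi>(3)]
      by (simp add: s_def convol_def abs_sgn[of "convol u (partial_deriv i \<psi>) x", unfolded convol_def])
    ultimately have le: "(LINT x|lborel. \<bar>?D x\<bar> * indicator (cball 0 (real k)) x) \<le> V" by simp
    have "integrable lborel (\<lambda>x. indicator (cball 0 (real k)) x *\<^sub>R \<bar>?D x\<bar>)"
      by (intro borel_integrable_compact continuous_intros convol_continuous loc partial_deriv_test_fun \<psi>) auto
    then have "(\<integral>\<^sup>+x. ennreal (\<bar>?D x\<bar> * indicator (cball 0 (real k)) x) \<partial>lborel) =
        ennreal (LINT x|lborel. \<bar>?D x\<bar> * indicator (cball 0 (real k)) x)"
      by (intro nn_integral_eq_integral) (auto simp: mult.commute)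
    also have "\<dots> \<le> ennreal V" by (intro ennreal_leI le)
    finally show ?thesis .
  qed
  \<comment> \<open>Fatou's lemma lets the truncation radius \<open>k\<close> tend to
    infinity.\<close>
  have "(\<integral>\<^sup>+x. ennreal \<bar>?D x\<bar> \<partial>lborel) \<le> (\<integral>\<^sup>+x. liminf (\<lambda>k. ennreal (\<bar>?D x\<bar> * indicator (cball 0 (real k)) x)) \<partial>lborel)"
  proof (intro nn_integral_mono Liminf_bounded)
    fix x :: "real ^ 'n"
    show "eventually (\<lambda>k. ennreal \<bar>?D x\<bar> \<le> ennreal (\<bar>?D x\<bar> * indicator (cball 0 (real k)) x)) sequentially"
      using eventually_ge_at_top[of "nat \<lceil>norm x\<rceil>"] by eventually_elim (auto simp: indicator_def nat_le_iff ceiling_le_iff)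
  qed
  also have "\<dots> \<le> liminf (\<lambda>k. \<integral>\<^sup>+x. ennreal (\<bar>?D x\<bar> * indicator (cball 0 (real k)) x) \<partial>lborel)"
    by (rule nn_integral_liminf) measurable
  also have "\<dots> \<le> liminf (\<lambda>k. ennreal V)"
    by (intro Liminf_mono always_eventually allI bound)
  finally show ?thesis by (simp add: Liminf_const)
qed

text \<open>Each of the \<open>CARD('n)\<close> factors in the Gagliardo estimate is at most
  \<open>V powr (1 / (CARD('n) - 1))\<close>, and their product is \<open>V powr p\<close>. The
  bound is the same for every mollifier.\<close>

theorem Sobolev_convol:
  fixes u :: "real ^ 'n \<Rightarrow> real"
  defines "p \<equiv> real CARD('n) / (real CARD('n) - 1)"
  assumes n: "CARD('n) \<ge> 2" and u: "u \<in> borel_measurable borel"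
    and int: "integrable lborel (\<lambda>x. \<bar>u x\<bar> powr p)" and V0: "V \<ge> 0"
    and V: "\<And>i \<phi>. \<phi> \<in> test_funs \<Longrightarrow> (\<And>x. \<bar>\<phi> x\<bar> \<le> 1) \<Longrightarrow> (LINT x|lborel. u x * partial_deriv i \<phi> x) \<le> V"
    and \<psi>: "\<psi> \<in> test_funs" "\<And>x. \<psi> x \<ge> 0" "\<And>x. \<psi> (- x) = \<psi> x" "integral\<^sup>L lborel \<psi> = 1"
  shows "(\<integral>\<^sup>+x. ennreal (\<bar>convol u \<psi> x\<bar> powr p) \<partial>lborel) \<le> ennreal (V powr p)"
proof -
  have p: "p \<ge> 1" using n by (simp add: p_def field_simps)
  have loc: "locally_integrable u" by (rule locally_integrable_powr) fact+
  have [measurable]: "convol u \<psi> \<in> borel_measurable borel" "convol u (partial_deriv i \<psi>) \<in> borel_measurable borel" for i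
    by (intro borel_measurable_continuous_onI convol_continuous loc partial_deriv_test_fun \<psi>)+
  have "(\<integral>\<^sup>+x. ennreal (\<bar>convol u \<psi> x\<bar> powr p) \<partial>lborel) = (\<integral>\<^sup>+x. epowr (ennreal \<bar>convol u \<psi> x\<bar>) p \<partial>lborel)"
    by (simp add: epowr_ennreal)
  also have "\<dots> \<le> (\<Prod>i\<in>UNIV. epowr (\<integral>\<^sup>+x. ennreal \<bar>convol u (partial_deriv i \<psi>) x\<bar> \<partial>lborel) (1 / (real CARD('n) - 1)))"
    unfolding p_def by (intro Gagliardo_nn_integral n convol_le_line_integral[OF u p int \<psi>(1)]) measurable
  also have "\<dots> \<le> (\<Prod>i\<in>(UNIV::'n set). epowr (ennreal V) (1 / (real CARD('n) - 1)))"
    using n by (intro prod_mono_ennreal epowr_mono nn_integral_partial_convol_le[OF loc V \<psi>]) auto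
  also have "\<dots> = ennreal (V powr p)"
    using n V0 by (subst prod_epowr_const) (auto simp: p_def epowr_ennreal)
  finally show ?thesis .
qed

section \<open>Hoelder's inequality for real integrals\<close>

lemma abs_mult_le_powr_add_powr:
  fixes a b p q :: real
  assumes p: "p > 1" "q > 1" "1 / p + 1 / q = 1"
  shows "\<bar>a * b\<bar> \<le> \<bar>a\<bar> powr p + \<bar>b\<bar> powr q"
proof -
  have "(\<Prod>i\<in>UNIV. (if i then \<bar>a\<bar> powr p else \<bar>b\<bar> powr q) powr (if i then 1 / p else 1 / q)) \<le>
      (\<Sum>i\<in>UNIV. (if i then 1 / p else 1 / q) * (if i then \<bar>a\<bar> powr p else \<bar>b\<bar> powr q))"
    using p by (intro weighted_AM_GM) (auto simp: UNIV_bool)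
  then have "\<bar>a\<bar> * \<bar>b\<bar> \<le> 1 / q * \<bar>b\<bar> powr q + 1 / p * \<bar>a\<bar> powr p"
    using p by (simp add: UNIV_bool powr_powr mult.commute)
  also have "\<dots> \<le> 1 * \<bar>b\<bar> powr q + 1 * \<bar>a\<bar> powr p"
    using p by (intro add_mono mult_right_mono) auto
  finally show ?thesis by (simp add: abs_mult)
qed

lemma integrable_mult_powr:
  fixes u f :: "'a \<Rightarrow> real"
  assumes p: "p > 1" "q > 1" "1 / p + 1 / q = 1"
    and [measurable]: "u \<in> borel_measurable M" "f \<in> borel_measurable M"
    and int: "integrable M (\<lambda>x. \<bar>u x\<bar> powr p)" "integrable M (\<lambda>x. \<bar>f x\<bar> powr q)"
  shows "integrable M (\<lambda>x. u x * f x)"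
  by (rule Bochner_Integration.integrable_bound[OF Bochner_Integration.integrable_add[OF int]])
    (use abs_mult_le_powr_add_powr[OF p] in auto)

text \<open>The norm of \<open>u\<close> is replaced by any \<open>V\<close> with the stated bound
  on an extended integral, the form in which the Sobolev estimate for convolutions delivers
  it.\<close>

lemma integral_Hoelder:
  fixes u f :: "'a \<Rightarrow> real"
  assumes p: "p > 1" "q > 1" "1 / p + 1 / q = 1"
    and [measurable]: "u \<in> borel_measurable M" "f \<in> borel_measurable M"
    and V: "V \<ge> 0" "(\<integral>\<^sup>+x. ennreal (\<bar>u x\<bar> powr p) \<partial>M) \<le> ennreal (V powr p)"
    and int: "integrable M (\<lambda>x. \<bar>f x\<bar> powr q)" "integrable M (\<lambda>x. u x * f x)"
  shows "\<bar>LINT x|M. u x * f x\<bar> \<le> V * (LINT x|M. \<bar>f x\<bar> powr q) powr (1 / q)"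
proof -
  have "ennreal (norm (LINT x|M. u x * f x)) \<le> (\<integral>\<^sup>+x. norm (u x * f x) \<partial>M)"
    by (rule integral_norm_bound_ennreal) fact
  also have "\<dots> = (\<integral>\<^sup>+x. (\<Prod>i\<in>UNIV. epowr (ennreal (if i then \<bar>u x\<bar> powr p else \<bar>f x\<bar> powr q)) (if i then 1 / p else 1 / q)) \<partial>M)"
    using p by (intro nn_integral_cong) (simp add: UNIV_bool epowr_ennreal powr_powr abs_mult mult.commute flip: ennreal_mult)
  also have "\<dots> \<le> (\<Prod>i\<in>UNIV. epowr (\<integral>\<^sup>+x. ennreal (if i then \<bar>u x\<bar> powr p else \<bar>f x\<bar> powr q) \<partial>M) (if i then 1 / p else 1 / q))"
    using p by (intro nn_integral_Hoelder) (auto simp: UNIV_bool)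
  also have "\<dots> = epowr (\<integral>\<^sup>+x. ennreal (\<bar>u x\<bar> powr p) \<partial>M) (1 / p) * epowr (\<integral>\<^sup>+x. ennreal (\<bar>f x\<bar> powr q) \<partial>M) (1 / q)"
    by (simp add: UNIV_bool mult.commute)
  also have "\<dots> \<le> epowr (ennreal (V powr p)) (1 / p) * epowr (ennreal (LINT x|M. \<bar>f x\<bar> powr q)) (1 / q)"
    using p V int by (intro mult_mono epowr_mono) (auto simp: nn_integral_eq_integral)
  also have "\<dots> = ennreal (V * (LINT x|M. \<bar>f x\<bar> powr q) powr (1 / q))"
    using p V by (simp add: epowr_ennreal powr_powr ennreal_mult)
  finally show ?thesis using V by simp
qed

definition clamp_abs :: "real \<Rightarrow> real \<Rightarrow> real" where
  "clamp_abs K t = max (- K) (min K t)"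

text \<open>Proved in three stages of growing generality for the second factor: continuous with
  bounded support, bounded measurable with bounded support, and arbitrary. Each stage is a limit in
  which only the pairing with the fixed \<open>u\<close> has to converge.\<close>

theorem Sobolev_dual:
  fixes u :: "real ^ 'n \<Rightarrow> real"
  defines "p \<equiv> real CARD('n) / (real CARD('n) - 1)" and "q \<equiv> real CARD('n)"
  assumes n: "CARD('n) \<ge> 2" and u [measurable]: "u \<in> borel_measurable borel"
    and int: "integrable lborel (\<lambda>x. \<bar>u x\<bar> powr p)" and V0: "V \<ge> 0"
    and V: "\<And>i \<phi>. \<phi> \<in> test_funs \<Longrightarrow> (\<And>x. \<bar>\<phi> x\<bar> \<le> 1) \<Longrightarrow> (LINT x|lborel. u x * partial_deriv i \<phi> x) \<le> V"
    and f [measurable]: "f \<in> borel_measurable borel" and f_int: "integrable lborel (\<lambda>x. \<bar>f x\<bar> powr q)"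
  shows "\<bar>LINT x|lborel. u x * f x\<bar> \<le> V * (LINT x|lborel. \<bar>f x\<bar> powr q) powr (1 / q)"
proof -
  have p: "p > 1" and q: "q > 1" and pq: "1 / p + 1 / q = 1"
    using n by (auto simp: p_def q_def field_simps)
  have loc: "locally_integrable u" by (rule locally_integrable_powr[OF u less_imp_le[OF p] int])
  have bdd_int: "integrable lborel (\<lambda>x. \<bar>g x\<bar> powr r)"
    if [measurable]: "g \<in> borel_measurable borel" and "\<And>x. \<bar>g x\<bar> \<le> K" "\<And>x. norm x > S \<Longrightarrow> g x = 0" "r \<ge> 0"
    for g :: "real ^ 'n \<Rightarrow> real" and K S r
  proof -
    have "integrable lborel (\<lambda>x::real^'n. K powr r * indicator (cball 0 S) x)"
      by (intro integrable_mult_right integrable_real_indicator emeasure_lborel_cball_finite) auto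
    then show ?thesis
    proof (rule Bochner_Integration.integrable_bound)
      show "AE x in lborel. norm (\<bar>g x\<bar> powr r) \<le> norm (K powr r * indicator (cball 0 S) x)"
      proof (rule AE_I2)
        show "norm (\<bar>g x\<bar> powr r) \<le> norm (K powr r * indicator (cball 0 S) x)" for x
          using that(2)[of x] that(3)[of x] that(4) by (cases "norm x \<le> S") (auto intro: powr_mono2)
      qed
    qed measurable
  qed
  have cont: "\<bar>LINT x|lborel. u x * g x\<bar> \<le> V * (LINT x|lborel. \<bar>g x\<bar> powr q) powr (1 / q)"
    if g: "continuous_on UNIV g" and K: "\<And>x. \<bar>g x\<bar> \<le> K" and S: "\<And>x. norm x > S \<Longrightarrow> g x = 0"
    for g :: "real ^ 'n \<Rightarrow> real" and K S
  proof -
    have [measurable]: "g \<in> borel_measurable borel" using g by (rule borel_measurable_continuous_onI)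
    have gq: "integrable lborel (\<lambda>x. \<bar>g x\<bar> powr q)" by (rule bdd_int[OF _ K S]) (use q in auto)
    have g_loc: "locally_integrable g"
      using bdd_int[OF _ K S, where r = p] p by (intro locally_integrable_powr[where p = p]) auto
    have "\<exists>\<psi> :: real ^ 'n \<Rightarrow> real. \<psi> \<in> test_funs \<and> (\<forall>x. \<psi> x \<ge> 0) \<and> (\<forall>x. \<psi> (- x) = \<psi> x) \<and>
        (\<forall>x. norm x \<ge> 1 / real (Suc k) \<longrightarrow> \<psi> x = 0) \<and> integral\<^sup>L lborel \<psi> = 1" for k
      by (rule mollifier_exists[of "1 / real (Suc k)"]) auto
    then obtain \<psi> :: "nat \<Rightarrow> real ^ 'n \<Rightarrow> real" where \<psi>: "\<And>k. \<psi> k \<in> test_funs" "\<And>k x. \<psi> k x \<ge> 0"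
      "\<And>k x. \<psi> k (- x) = \<psi> k x" "\<And>k. integral\<^sup>L lborel (\<psi> k) = 1"
      and \<psi>_supp: "\<And>k x. norm x \<ge> 1 / real (Suc k) \<Longrightarrow> \<psi> k x = 0" by metis
    have [measurable]: "convol u (\<psi> k) \<in> borel_measurable borel" "convol g (\<psi> k) \<in> borel_measurable borel" for k
      by (intro borel_measurable_continuous_onI convol_continuous loc g_loc \<psi>)+
    have bound: "\<bar>LINT x|lborel. u x * convol g (\<psi> k) x\<bar> \<le> V * (LINT x|lborel. \<bar>g x\<bar> powr q) powr (1 / q)" for k
    proof -
      have c_loc: "locally_integrable (convol u (\<psi> k))"
      proof -
        have "integrable lborel (\<lambda>x. indicator (cball 0 R) x *\<^sub>R convol u (\<psi> k) x)" for R
          by (intro borel_integrable_compact convol_continuous loc \<psi>) simp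
        then show ?thesis by (simp add: locally_integrable_def)
      qed
      \<comment> \<open>Since the kernel is even, the mollifier passes from \<open>g\<close> to
        \<open>u\<close>, where the uniform Sobolev bound applies and yields the norm of
        \<open>g\<close> itself.\<close>
      have "(LINT x|lborel. u x * convol g (\<psi> k) x) = (LINT x|lborel. convol u (\<psi> k) x * g x)"
        using convol_duality[OF loc _ K S \<psi>(1)] by (simp add: \<psi>(3) mult.commute)
      also have "\<bar>\<dots>\<bar> \<le> V * (LINT x|lborel. \<bar>g x\<bar> powr q) powr (1 / q)"
      proof (rule integral_Hoelder[OF p q pq _ _ V0 _ gq])
        show "(\<integral>\<^sup>+x. ennreal (\<bar>convol u (\<psi> k) x\<bar> powr p) \<partial>lborel) \<le> ennreal (V powr p)"
          using int unfolding p_def by (intro Sobolev_convol n u V0 V \<psi>)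
        show "integrable lborel (\<lambda>x. convol u (\<psi> k) x * g x)"
          by (rule locally_integrable_times[OF c_loc _ K S]) measurable
      qed measurable
      finally show ?thesis .
    qed
    have conv: "(\<lambda>k. convol g (\<psi> k) x) \<longlonglongrightarrow> g x" for x
    proof (rule LIMSEQ_I)
      fix e :: real assume e: "e > 0"
      then obtain d where d: "d > 0" "\<And>y. norm (y - x) < d \<Longrightarrow> \<bar>g y - g x\<bar> < e / 2"
        using g unfolding continuous_on_iff by (metis UNIV_I dist_norm half_gt_zero real_norm_def)
      obtain N where N: "1 / real (Suc N) < d" using d(1) nat_approx_posE by blast
      have "norm (convol g (\<psi> k) x - g x) < e" if "k \<ge> N" for k
      proof -
        note int1 = mollifier_translate_integrable[OF \<psi>, of k x] and one = mollifier_translate_integral[OF \<psi>, of k x]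
        have "convol g (\<psi> k) x - g x = (LINT y|lborel. g y * \<psi> k (x - y)) - g x * (LINT y|lborel. \<psi> k (x - y))"
          by (simp add: convol_def one)
        also have "\<dots> = (LINT y|lborel. g y * \<psi> k (x - y) - g x * \<psi> k (x - y))"
          using integrable_convol[OF g_loc \<psi>(1)] int1 by (subst Bochner_Integration.integral_diff) auto
        also have "norm \<dots> \<le> (LINT y|lborel. e / 2 * \<psi> k (x - y))"
        proof (rule Bochner_Integration.integral_norm_bound_integral)
          show "norm (g y * \<psi> k (x - y) - g x * \<psi> k (x - y)) \<le> e / 2 * \<psi> k (x - y)" for y
          proof (cases "norm (x - y) < d")
            case True
            then have "\<bar>g y - g x\<bar> * \<psi> k (x - y) \<le> e / 2 * \<psi> k (x - y)"
              using d(2)[of y] \<psi>(2) by (intro mult_right_mono) (auto simp: norm_minus_commute less_imp_le)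
            then show ?thesis using \<psi>(2)[of k "x - y"] by (simp add: abs_mult flip: left_diff_distrib)
          next
            case False
            have "1 / real (Suc k) \<le> 1 / real (Suc N)" using that by (intro divide_left_mono) auto
            then have "\<psi> k (x - y) = 0" using False N by (intro \<psi>_supp) linarith
            then show ?thesis by simp
          qed
        qed (use integrable_convol[OF g_loc \<psi>(1)] int1 in auto)
        also have "\<dots> = e / 2" by (simp add: one)
        finally show ?thesis using e by simp
      qed
      then show "\<exists>N. \<forall>k\<ge>N. norm (convol g (\<psi> k) x - g x) < e" by blast
    qed
    have supp: "convol g (\<psi> k) x = 0" if "norm x > S + 1" for k x
    proof -
      have "g y * \<psi> k (x - y) = 0" for y
      proof (cases "norm y > S")
        case False
        then have "norm (x - y) \<ge> 1" using that norm_triangle_ineq2[of x y] by simp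
        moreover have "1 / real (Suc k) \<le> 1" by simp
        ultimately have "\<psi> k (x - y) = 0" by (intro \<psi>_supp) linarith
        then show ?thesis by simp
      qed (simp add: S)
      then show ?thesis by (simp only: convol_def Bochner_Integration.integral_zero)
    qed
    have "(\<lambda>k. LINT x|lborel. u x * convol g (\<psi> k) x) \<longlonglongrightarrow> (LINT x|lborel. u x * g x)"
    proof (rule integral_dominated_convergence)
      show "integrable lborel (\<lambda>x. K * \<bar>indicator (cball 0 (S + 1)) x * u x\<bar>)"
        using loc unfolding locally_integrable_def by (intro integrable_mult_right integrable_abs) blast
      show "AE x in lborel. (\<lambda>k. u x * convol g (\<psi> k) x) \<longlonglongrightarrow> u x * g x"
        by (intro AE_I2 tendsto_mult tendsto_const conv)
      show "AE x in lborel. norm (u x * convol g (\<psi> k) x) \<le> K * \<bar>indicator (cball 0 (S + 1)) x * u x\<bar>" for k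
      proof (rule AE_I2)
        fix x
        show "norm (u x * convol g (\<psi> k) x) \<le> K * \<bar>indicator (cball 0 (S + 1)) x * u x\<bar>"
        proof (cases "norm x \<le> S + 1")
          case True
          have "\<bar>u x\<bar> * \<bar>convol g (\<psi> k) x\<bar> \<le> \<bar>u x\<bar> * K"
            by (intro mult_left_mono convol_bounded[OF \<psi> g_loc K]) auto
          then show ?thesis using True by (simp add: abs_mult mult.commute)
        qed (simp add: supp)
      qed
    qed measurable
    then show ?thesis
      by (intro LIMSEQ_le_const2[OF tendsto_rabs]) (use bound in auto)
  qed
  \<comment> \<open>Second stage: \<open>g\<close> is only measurable, but bounded and zero outside
    a ball.\<close>
  have bdd: "\<bar>LINT x|lborel. u x * g x\<bar> \<le> V * (LINT x|lborel. \<bar>g x\<bar> powr q) powr (1 / q)"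
    if [measurable]: "g \<in> borel_measurable borel" and K: "\<And>x. \<bar>g x\<bar> \<le> K" and S: "\<And>x. norm x > S \<Longrightarrow> g x = 0"
    for g :: "real ^ 'n \<Rightarrow> real" and K S
  proof -
    have K0: "K \<ge> 0" using K[of 0] by simp
    have "g \<in> borel_measurable lebesgue" using that(1) by (auto intro: measurable_completion)
    \<comment> \<open>This supplies continuous functions converging to \<open>g\<close> off a
      negligible set, with no common bound or support. Clamping at \<open>K\<close> and multiplying
      by \<open>cut\<close> restore both without disturbing the limit.\<close>
    then have "g measurable_on UNIV" by (rule lebesgue_measurable_imp_measurable_on_real) simp
    then obtain N h where N: "negligible N" and h: "\<And>k. continuous_on UNIV (h k)"
      and lim: "\<And>x. x \<notin> N \<Longrightarrow> (\<lambda>k. h k x) \<longlonglongrightarrow> g x"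
      by (auto simp: measurable_on_def)
    have "AE x in lebesgue. x \<notin> N" using N by (simp add: negligible_iff_null_sets AE_not_in)
    then have AE: "AE x in lborel. (\<lambda>k. h k x) \<longlonglongrightarrow> g x"
      using lim by (simp add: AE_completion_iff) (auto elim: eventually_mono)
    \<comment> \<open>A continuous cut-off that is 1 for \<open>norm x \<le> S\<close> and 0 for
      \<open>norm x \<ge> S + 1\<close>; hence the radius \<open>S + 1\<close> in the dominating
      functions.\<close>
    define cut :: "real ^ 'n \<Rightarrow> real" where "cut x = max 0 (min 1 (S + 1 - norm x))" for x
    define H where "H k x = clamp_abs K (h k x) * cut x" for k x
    have H_cont: "continuous_on UNIV (H k)" for k
      unfolding H_def clamp_abs_def cut_def by (intro continuous_intros h)
    then have [measurable]: "H k \<in> borel_measurable borel" for k by (rule borel_measurable_continuous_onI)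
    have H_bound: "\<bar>H k x\<bar> \<le> K" for k x
    proof -
      have "\<bar>clamp_abs K (h k x)\<bar> * \<bar>cut x\<bar> \<le> K * 1"
        using K0 by (intro mult_mono) (auto simp: clamp_abs_def cut_def)
      then show ?thesis by (simp add: H_def abs_mult)
    qed
    have H_supp: "H k x = 0" if "norm x > S + 1" for k x
      using that by (simp add: H_def cut_def)
    have H_lim: "AE x in lborel. (\<lambda>k. H k x) \<longlonglongrightarrow> g x"
      using AE
    proof eventually_elim
      case (elim x)
      then have "(\<lambda>k. H k x) \<longlonglongrightarrow> clamp_abs K (g x) * cut x"
        unfolding H_def clamp_abs_def by (intro tendsto_intros)
      moreover have "clamp_abs K (g x) = g x" using K[of x] by (auto simp: clamp_abs_def)
      moreover have "g x * cut x = g x" using S[of x] by (cases "norm x > S") (auto simp: cut_def)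
      ultimately show ?case by simp
    qed
    have 1: "(\<lambda>k. LINT x|lborel. u x * H k x) \<longlonglongrightarrow> (LINT x|lborel. u x * g x)"
    proof (rule integral_dominated_convergence)
      show "integrable lborel (\<lambda>x. K * \<bar>indicator (cball 0 (S + 1)) x * u x\<bar>)"
        using loc unfolding locally_integrable_def by (intro integrable_mult_right integrable_abs) blast
      show "AE x in lborel. (\<lambda>k. u x * H k x) \<longlonglongrightarrow> u x * g x"
        using H_lim by eventually_elim (intro tendsto_intros)
      show "AE x in lborel. norm (u x * H k x) \<le> K * \<bar>indicator (cball 0 (S + 1)) x * u x\<bar>" for k
      proof (rule AE_I2)
        fix x
        show "norm (u x * H k x) \<le> K * \<bar>indicator (cball 0 (S + 1)) x * u x\<bar>"
        proof (cases "norm x \<le> S + 1")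
          case True
          have "\<bar>u x\<bar> * \<bar>H k x\<bar> \<le> \<bar>u x\<bar> * K"
            by (intro mult_left_mono H_bound) auto
          then show ?thesis using True by (simp add: abs_mult mult.commute)
        qed (simp add: H_supp)
      qed
    qed measurable
    have 2: "(\<lambda>k. LINT x|lborel. \<bar>H k x\<bar> powr q) \<longlonglongrightarrow> (LINT x|lborel. \<bar>g x\<bar> powr q)"
    proof (rule integral_dominated_convergence)
      show "integrable lborel (\<lambda>x::real^'n. K powr q * indicator (cball 0 (S + 1)) x)"
        by (intro integrable_mult_right integrable_real_indicator emeasure_lborel_cball_finite) auto
      show "AE x in lborel. (\<lambda>k. \<bar>H k x\<bar> powr q) \<longlonglongrightarrow> \<bar>g x\<bar> powr q"
        using H_lim by eventually_elim (intro tendsto_powr' tendsto_rabs tendsto_const, use q in auto)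
      show "AE x in lborel. norm (\<bar>H k x\<bar> powr q) \<le> K powr q * indicator (cball 0 (S + 1)) x" for k
      proof (rule AE_I2)
        show "norm (\<bar>H k x\<bar> powr q) \<le> K powr q * indicator (cball 0 (S + 1)) x" for x
          using H_bound[of k x] H_supp[of x k] q by (cases "norm x \<le> S + 1") (auto intro: powr_mono2)
      qed
    qed measurable
    have "(\<lambda>k. V * (LINT x|lborel. \<bar>H k x\<bar> powr q) powr (1 / q)) \<longlonglongrightarrow> V * (LINT x|lborel. \<bar>g x\<bar> powr q) powr (1 / q)"
      using q by (intro tendsto_mult tendsto_const tendsto_powr' 2) (auto intro!: always_eventually Bochner_Integration.integral_nonneg)
    from LIMSEQ_le[OF tendsto_rabs[OF 1] this] show ?thesis
      using cont[OF H_cont H_bound H_supp] by blast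
  qed
  \<comment> \<open>Third stage: truncating \<open>f\<close> both in value and in space, which never
    increases \<open>\<bar>f\<bar>\<close>, so \<open>u * f\<close> dominates and the norms stay
    below that of \<open>f\<close>.\<close>
  define F where "F k x = (if \<bar>f x\<bar> \<le> real k \<and> norm x \<le> real k then f x else 0)" for k x
  have [measurable]: "F k \<in> borel_measurable borel" for k unfolding F_def by measurable
  have F_lim: "(\<lambda>k. F k x) \<longlonglongrightarrow> f x" for x
  proof (rule tendsto_eventually)
    obtain N where N: "real N \<ge> max \<bar>f x\<bar> (norm x)" using real_arch_simple by blast
    show "eventually (\<lambda>k. F k x = f x) sequentially"
      using eventually_ge_at_top[of N] by eventually_elim (use N in \<open>auto simp: F_def\<close>)
  qed
  have uf: "integrable lborel (\<lambda>x. u x * f x)"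
    by (rule integrable_mult_powr[OF p q pq _ _ int f_int]) measurable
  have "(\<lambda>k. LINT x|lborel. u x * F k x) \<longlonglongrightarrow> (LINT x|lborel. u x * f x)"
  proof (rule integral_dominated_convergence[OF _ _ integrable_abs[OF uf]])
    show "AE x in lborel. (\<lambda>k. u x * F k x) \<longlonglongrightarrow> u x * f x"
      by (intro AE_I2 tendsto_mult tendsto_const F_lim)
    show "AE x in lborel. norm (u x * F k x) \<le> \<bar>u x * f x\<bar>" for k
      by (intro AE_I2) (simp add: F_def)
  qed measurable
  moreover have "\<bar>LINT x|lborel. u x * F k x\<bar> \<le> V * (LINT x|lborel. \<bar>f x\<bar> powr q) powr (1 / q)" for k
  proof -
    have "\<bar>LINT x|lborel. u x * F k x\<bar> \<le> V * (LINT x|lborel. \<bar>F k x\<bar> powr q) powr (1 / q)"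
      by (rule bdd[of _ "real k" "real k"]) (auto simp: F_def)
    also have "\<dots> \<le> V * (LINT x|lborel. \<bar>f x\<bar> powr q) powr (1 / q)"
      using V0 q
      by (intro mult_left_mono powr_mono2 integral_mono_AE' f_int) (auto simp: F_def intro!: Bochner_Integration.integral_nonneg)
    finally show ?thesis .
  qed
  ultimately show ?thesis
    by (intro LIMSEQ_le_const2[OF tendsto_rabs]) auto
qed

section \<open>Functions of bounded variation\<close>

text \<open>Used to represent the derivative of a sum: for two differences of finite measures, the
  positive parts are added and so are the negative parts.\<close>

definition add_measure :: "'a measure \<Rightarrow> 'a measure \<Rightarrow> 'a measure" where
  "add_measure M N = measure_of (space M) (sets M) (\<lambda>A. emeasure M A + emeasure N A)"

lemma
  shows space_add_measure [simp]: "space (add_measure M N) = space M"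
    and sets_add_measure [simp, measurable_cong]: "sets (add_measure M N) = sets M"
  by (auto simp: add_measure_def)

lemma emeasure_add_measure:
  assumes "sets N = sets M" "A \<in> sets M"
  shows "emeasure (add_measure M N) A = emeasure M A + emeasure N A"
proof (rule emeasure_measure_of[OF add_measure_def])
  show "countably_additive (sets (add_measure M N)) (\<lambda>A. emeasure M A + emeasure N A)"
  proof (rule countably_additiveI)
    fix A :: "nat \<Rightarrow> 'a set"
    assume "range A \<subseteq> sets (add_measure M N)" "disjoint_family A"
    then show "(\<Sum>i. emeasure M (A i) + emeasure N (A i)) = emeasure M (\<Union> (range A)) + emeasure N (\<Union> (range A))"
      using assms by (simp add: suminf_add[symmetric] suminf_emeasure)
  qed
qed (use assms sets.space_closed in \<open>auto simp: positive_def\<close>)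

lemma nn_integral_add_measure:
  assumes N: "sets N = sets M" and "f \<in> borel_measurable M"
  shows "(\<integral>\<^sup>+x. f x \<partial>add_measure M N) = (\<integral>\<^sup>+x. f x \<partial>M) + (\<integral>\<^sup>+x. f x \<partial>N)"
  using assms(2)
proof (induction f rule: borel_measurable_induct)
  have sp: "space N = space M" using N by (rule sets_eq_imp_space_eq)
  note [measurable_cong] = N
  {
    case (cong f g)
    have "(\<integral>\<^sup>+x. f x \<partial>L) = (\<integral>\<^sup>+x. g x \<partial>L)" if "space L = space M" for L
      using cong(3) that by (intro nn_integral_cong) auto
    then show ?case using cong sp by simp
  next
    case (set A)
    then show ?case using N by (simp add: emeasure_add_measure)
  next
    case (mult u c)
    note [measurable] = mult.hyps(2)
    show ?case using mult by (simp add: nn_integral_cmult distrib_left)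
  next
    case (add u v)
    note [measurable] = add.hyps(1,3)
    show ?case using add by (simp add: nn_integral_add ac_simps)
  next
    case (seq U)
    note [measurable] = seq.hyps(1)
    have mono: "incseq (\<lambda>i. \<integral>\<^sup>+x. U i x \<partial>L)" for L
      using seq.hyps(3) by (auto simp: incseq_def le_fun_def intro!: nn_integral_mono)
    have "(\<integral>\<^sup>+x. (SUP i. U i x) \<partial>add_measure M N) = (SUP i. \<integral>\<^sup>+x. U i x \<partial>add_measure M N)"
      by (intro nn_integral_monotone_convergence_SUP seq.hyps) measurable
    also have "\<dots> = (SUP i. (\<integral>\<^sup>+x. U i x \<partial>M) + (\<integral>\<^sup>+x. U i x \<partial>N))" by (simp add: seq.IH)
    also have "\<dots> = (SUP i. \<integral>\<^sup>+x. U i x \<partial>M) + (SUP i. \<integral>\<^sup>+x. U i x \<partial>N)"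
      by (intro ennreal_SUP_add mono)
    also have "(SUP i. \<integral>\<^sup>+x. U i x \<partial>M) = (\<integral>\<^sup>+x. (SUP i. U i x) \<partial>M)"
      by (intro nn_integral_monotone_convergence_SUP[symmetric] seq.hyps) measurable
    also have "(SUP i. \<integral>\<^sup>+x. U i x \<partial>N) = (\<integral>\<^sup>+x. (SUP i. U i x) \<partial>N)"
      by (intro nn_integral_monotone_convergence_SUP[symmetric] seq.hyps) measurable
    finally show ?case by (simp add: image_comp)
  }
qed

lemma finite_measure_add_measure:
  assumes "finite_measure M" "finite_measure N" "sets N = sets M"
  shows "finite_measure (add_measure M N)"
proof (rule finite_measureI)
  have "space N = space M" using assms(3) by (rule sets_eq_imp_space_eq)
  then have "emeasure N (space M) \<noteq> \<infinity>" using finite_measure.emeasure_finite[OF assms(2)] by simp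
  then show "emeasure (add_measure M N) (space (add_measure M N)) \<noteq> \<infinity>"
    using assms finite_measure.emeasure_finite[OF assms(1)] by (simp add: emeasure_add_measure)
qed

lemma integral_add_measure:
  fixes f :: "'a \<Rightarrow> real"
  assumes N: "sets N = sets M" and "integrable M f" "integrable N f"
  shows "(LINT x|add_measure M N. f x) = (LINT x|M. f x) + (LINT x|N. f x)"
proof -
  have [measurable]: "f \<in> borel_measurable M" using assms by auto
  have nn: "(\<integral>\<^sup>+x. ennreal (g x) \<partial>add_measure M N) = (\<integral>\<^sup>+x. ennreal (g x) \<partial>M) + (\<integral>\<^sup>+x. ennreal (g x) \<partial>N)"
    if [measurable]: "g \<in> borel_measurable M" for g :: "'a \<Rightarrow> real"
    by (rule nn_integral_add_measure[OF N]) measurable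
  have fin: "(\<integral>\<^sup>+x. ennreal (norm (f x)) \<partial>M) < \<infinity>" "(\<integral>\<^sup>+x. ennreal (norm (f x)) \<partial>N) < \<infinity>"
    using assms by (auto simp: integrable_iff_bounded)
  have int: "integrable (add_measure M N) f"
    unfolding integrable_iff_bounded using fin nn[of "\<lambda>x. norm (f x)"] by simp
  have e: "(\<integral>\<^sup>+x. ennreal (f x) \<partial>L) < top \<and> (\<integral>\<^sup>+x. ennreal (- f x) \<partial>L) < top"
    if "integrable L f" for L
  proof -
    have "(\<integral>\<^sup>+x. ennreal (f x) \<partial>L) \<le> (\<integral>\<^sup>+x. ennreal (norm (f x)) \<partial>L)"
      "(\<integral>\<^sup>+x. ennreal (- f x) \<partial>L) \<le> (\<integral>\<^sup>+x. ennreal (norm (f x)) \<partial>L)"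
      by (auto intro!: nn_integral_mono ennreal_leI)
    then show ?thesis using that by (auto simp: integrable_iff_bounded intro: le_less_trans)
  qed
  show ?thesis
    using e[OF assms(2)] e[OF assms(3)] nn[of f] nn[of "\<lambda>x. - f x"]
    by (simp add: real_lebesgue_integral_def[OF int] real_lebesgue_integral_def[OF assms(2)]
        real_lebesgue_integral_def[OF assms(3)] enn2real_plus)
qed

lemma integrable_test_fun:
  assumes "finite_measure M" "sets M = sets borel" "\<phi> \<in> test_funs"
  shows "integrable M \<phi>"
proof -
  obtain B where "\<And>x. \<bar>\<phi> x\<bar> \<le> B" using test_fun_bounded[OF assms(3)] by metis
  moreover have "\<phi> \<in> borel_measurable M"
    using test_fun_measurable[OF assms(3)] measurable_cong_sets[OF assms(2) refl] by blast
  ultimately show ?thesis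
    by (intro finite_measure.integrable_const_bound[OF assms(1)]) auto
qed

section \<open>The spaces \<open>Lp\<close> and Borel representatives\<close>

lemma Lp_add:
  assumes u: "u \<in> Lp p" and v: "v \<in> Lp p" and p: "p > 0"
  shows "(\<lambda>x. u x + v x) \<in> Lp p"
proof -
  have [measurable]: "u \<in> borel_measurable lebesgue" "v \<in> borel_measurable lebesgue"
    using u v by (auto simp: Lp_def)
  have "integrable lebesgue (\<lambda>x. 2 powr p * (\<bar>u x\<bar> powr p + \<bar>v x\<bar> powr p))"
    using u v by (auto simp: Lp_def intro!: integrable_mult_right Bochner_Integration.integrable_add)
  then have "integrable lebesgue (\<lambda>x. \<bar>u x + v x\<bar> powr p)"
  proof (rule Bochner_Integration.integrable_bound)
    show "AE x in lebesgue. norm (\<bar>u x + v x\<bar> powr p) \<le> norm (2 powr p * (\<bar>u x\<bar> powr p + \<bar>v x\<bar> powr p))"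
    proof (rule AE_I2)
      fix x
      have "\<bar>u x + v x\<bar> powr p \<le> (2 * max \<bar>u x\<bar> \<bar>v x\<bar>) powr p" using p by (intro powr_mono2) auto
      also have "\<dots> = 2 powr p * max \<bar>u x\<bar> \<bar>v x\<bar> powr p" by (simp add: powr_mult)
      also have "\<dots> \<le> 2 powr p * (\<bar>u x\<bar> powr p + \<bar>v x\<bar> powr p)"
        by (intro mult_left_mono) (auto simp: max_def)
      finally show "norm (\<bar>u x + v x\<bar> powr p) \<le> norm (2 powr p * (\<bar>u x\<bar> powr p + \<bar>v x\<bar> powr p))" by simp
    qed
  qed measurable
  then show ?thesis by (simp add: Lp_def)
qed

lemma Lp_cmult: "u \<in> Lp p \<Longrightarrow> (\<lambda>x. c * u x) \<in> Lp p"
  by (auto simp: Lp_def abs_mult powr_mult)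

lemma zero_Lp: "(\<lambda>_. 0) \<in> Lp p"
  by (auto simp: Lp_def)

lemma test_fun_Lp:
  assumes "\<phi> \<in> test_funs" "p > 0"
  shows "\<phi> \<in> Lp p"
proof -
  obtain R where R: "\<And>x. norm x \<ge> R \<Longrightarrow> \<phi> x = 0" using test_fun_support[OF assms(1)] by metis
  have [measurable]: "\<phi> \<in> borel_measurable borel" by (rule test_fun_measurable[OF assms(1)])
  have eq: "(\<lambda>x. \<bar>\<phi> x\<bar> powr p) = (\<lambda>x. indicator (cball 0 R) x *\<^sub>R (\<bar>\<phi> x\<bar> powr p))"
    using R by (force simp: indicator_def)
  have "continuous_on (cball 0 R) (\<lambda>x. \<bar>\<phi> x\<bar> powr p)"
    using continuous_on_subset[OF test_fun_continuous[OF assms(1)], of "cball 0 R"] assms(2)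
    by (intro continuous_on_powr' continuous_intros) auto
  then have "integrable lborel (\<lambda>x. \<bar>\<phi> x\<bar> powr p)"
    by (subst eq, intro borel_integrable_compact) auto
  then have "integrable lebesgue (\<lambda>x. \<bar>\<phi> x\<bar> powr p)"
    by (subst integrable_completion) auto
  then show ?thesis by (auto simp: Lp_def intro: measurable_completion)
qed

text \<open>Members of \<open>BV\<close> and \<open>Lp\<close> are merely Lebesgue measurable,
  whereas the Sobolev inequality was proved for Borel functions; this and the next lemma carry
  integrals across.\<close>

lemma AE_lebesgue_borel_version:
  fixes u :: "'a::euclidean_space \<Rightarrow> real"
  assumes "u \<in> borel_measurable lebesgue"
  obtains u' where "u' \<in> borel_measurable borel" "AE x in lebesgue. u x = u' x"
  using completion_ex_borel_measurable_real[OF assms] AE_completion by auto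

lemma lebesgue_integral_borel_version:
  fixes f :: "'a::euclidean_space \<Rightarrow> real"
  assumes [measurable]: "f \<in> borel_measurable lebesgue" "g \<in> borel_measurable borel" and AE: "AE x in lebesgue. f x = g x"
  shows "integral\<^sup>L lebesgue f = integral\<^sup>L lborel g" "integrable lebesgue f \<longleftrightarrow> integrable lborel g"
proof -
  have [measurable]: "g \<in> borel_measurable lebesgue" using assms(2) by (auto intro: measurable_completion)
  have "integral\<^sup>L lebesgue f = integral\<^sup>L lebesgue g" by (rule integral_cong_AE) (use AE in auto)
  also have "\<dots> = integral\<^sup>L lborel g" by (rule integral_completion) simp
  finally show "integral\<^sup>L lebesgue f = integral\<^sup>L lborel g" .
  have "integrable lebesgue f \<longleftrightarrow> integrable lebesgue g" by (rule integrable_cong_AE) (use AE in auto)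
  also have "\<dots> \<longleftrightarrow> integrable lborel g" by (rule integrable_completion) simp
  finally show "integrable lebesgue f \<longleftrightarrow> integrable lborel g" .
qed

section \<open>\<open>BV\<close> as a vector space with seminorm \<open>TV\<close>\<close>

locale bv_space =
  fixes dim_type :: "'n::finite itself"
  assumes dim2: "CARD('n) \<ge> 2"
begin

text \<open>This is the exponent \<open>1*\<close>; its Hoelder conjugate \<open>q\<close> is the
  dimension.\<close>

definition p :: real where "p = real CARD('n) / (real CARD('n) - 1)"
definition q :: real where "q = real CARD('n)"

lemma pq: "p > 1" "q > 1" "1 / p + 1 / q = 1"
  using dim2 by (auto simp: p_def q_def field_simps)

lemma BV_Lp: "u \<in> BV \<Longrightarrow> u \<in> Lp p" for u :: "real ^ 'n \<Rightarrow> real"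
  by (simp add: BV_def p_def)

lemma integrable_Lp_mult:
  fixes u f :: "real ^ 'n \<Rightarrow> real"
  assumes "u \<in> Lp p" "f \<in> Lp q"
  shows "integrable lebesgue (\<lambda>x. u x * f x)"
  using assms by (intro integrable_mult_powr[OF pq]) (auto simp: Lp_def)

lemma integrable_Lp_partial_deriv:
  fixes u :: "real ^ 'n \<Rightarrow> real"
  assumes "u \<in> Lp p" "\<phi> \<in> test_funs"
  shows "integrable lebesgue (\<lambda>x. u x * partial_deriv i \<phi> x)"
  using pq by (intro integrable_Lp_mult[OF assms(1)] test_fun_Lp partial_deriv_test_fun[OF assms(2)]) simp

lemma distr_partial_add:
  fixes u v :: "real ^ 'n \<Rightarrow> real"
  assumes u: "u \<in> Lp p" "distr_partial_is_measure i u" and v: "v \<in> Lp p" "distr_partial_is_measure i v"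
  shows "distr_partial_is_measure i (\<lambda>x. u x + v x)"
proof -
  obtain M N where M: "finite_measure M" "sets M = sets borel" and N: "finite_measure N" "sets N = sets borel"
    and MN: "\<And>\<phi>. \<phi> \<in> test_funs \<Longrightarrow> (LINT x|lebesgue. u x * partial_deriv i \<phi> x) = - ((LINT x|M. \<phi> x) - (LINT x|N. \<phi> x))"
    using u(2) by (auto simp: distr_partial_is_measure_def)
  obtain M' N' where M': "finite_measure M'" "sets M' = sets borel" and N': "finite_measure N'" "sets N' = sets borel"
    and MN': "\<And>\<phi>. \<phi> \<in> test_funs \<Longrightarrow> (LINT x|lebesgue. v x * partial_deriv i \<phi> x) = - ((LINT x|M'. \<phi> x) - (LINT x|N'. \<phi> x))"
    using v(2) by (auto simp: distr_partial_is_measure_def)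
  show ?thesis
    unfolding distr_partial_is_measure_def
  proof (rule exI[of _ "add_measure M M'"], rule exI[of _ "add_measure N N'"], intro conjI ballI)
    show "finite_measure (add_measure M M')" "finite_measure (add_measure N N')"
      using M M' N N' by (auto intro: finite_measure_add_measure)
    fix \<phi> :: "real ^ 'n \<Rightarrow> real" assume \<phi>: "\<phi> \<in> test_funs"
    have "(LINT x|lebesgue. (u x + v x) * partial_deriv i \<phi> x) =
        (LINT x|lebesgue. u x * partial_deriv i \<phi> x) + (LINT x|lebesgue. v x * partial_deriv i \<phi> x)"
      using integrable_Lp_partial_deriv[OF u(1) \<phi>] integrable_Lp_partial_deriv[OF v(1) \<phi>]
      by (simp add: distrib_right)
    then show "(LINT x|lebesgue. (u x + v x) * partial_deriv i \<phi> x) =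
        - ((LINT x|add_measure M M'. \<phi> x) - (LINT x|add_measure N N'. \<phi> x))"
      using M M' N N' by (simp add: MN[OF \<phi>] MN'[OF \<phi>] integral_add_measure integrable_test_fun \<phi>)
  qed (use M N in auto)
qed

lemma distr_partial_cmult:
  fixes u :: "real ^ 'n \<Rightarrow> real"
  assumes u: "distr_partial_is_measure i u"
  shows "distr_partial_is_measure i (\<lambda>x. c * u x)"
proof -
  \<comment> \<open>Both measures are scaled by \<open>\<bar>a\<bar>\<close>, and the hypothesis
    \<open>MN\<close> carries the sign of \<open>a\<close>. For a negative factor it is met by
    exchanging the two measures.\<close>
  have *: "distr_partial_is_measure i (\<lambda>x. a * u x)"
    if "finite_measure M" "sets M = sets borel" "finite_measure N" "sets N = sets borel" and a: "\<bar>a\<bar> = b"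
    and MN: "\<And>\<phi>. \<phi> \<in> test_funs \<Longrightarrow> (LINT x|lebesgue. u x * partial_deriv i \<phi> x) = - sgn a * ((LINT x|M. \<phi> x) - (LINT x|N. \<phi> x))"
    for a b M N
  proof -
    have b: "b \<ge> 0" "a * sgn a = b" using a abs_ge_zero[of a] by (auto simp: abs_sgn simp del: abs_ge_zero)
    have fin: "finite_measure (density L (\<lambda>_. ennreal b))" if "finite_measure L" for L :: "(real ^ 'n) measure"
      using finite_measure.emeasure_finite[OF that]
      by (intro finite_measureI) (auto simp: emeasure_density nn_integral_cmult_indicator ennreal_mult_eq_top_iff)
    have int: "(LINT x|density L (\<lambda>_. ennreal b). \<phi> x) = b * (LINT x|L. \<phi> x)"
      if "sets L = sets borel" "\<phi> \<in> test_funs" for L and \<phi> :: "real ^ 'n \<Rightarrow> real"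
    proof -
      have "\<phi> \<in> borel_measurable L"
        using test_fun_measurable[OF that(2)] measurable_cong_sets[OF that(1) refl] by blast
      then show ?thesis using b by (subst integral_density) auto
    qed
    show ?thesis
      unfolding distr_partial_is_measure_def
    proof (rule exI[of _ "density M (\<lambda>_. ennreal b)"], rule exI[of _ "density N (\<lambda>_. ennreal b)"], intro conjI ballI fin that)
      fix \<phi> :: "real ^ 'n \<Rightarrow> real" assume \<phi>: "\<phi> \<in> test_funs"
      have "(LINT x|lebesgue. a * u x * partial_deriv i \<phi> x) = a * (LINT x|lebesgue. u x * partial_deriv i \<phi> x)"
        by (simp add: mult.assoc)
      also have "\<dots> = - (a * sgn a) * ((LINT x|M. \<phi> x) - (LINT x|N. \<phi> x))"
        by (simp add: MN[OF \<phi>])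
      also have "\<dots> = - ((LINT x|density M (\<lambda>_. ennreal b). \<phi> x) - (LINT x|density N (\<lambda>_. ennreal b). \<phi> x))"
        by (simp add: int[OF that(2) \<phi>] int[OF that(4) \<phi>] b(2) algebra_simps)
      finally show "(LINT x|lebesgue. a * u x * partial_deriv i \<phi> x) = \<dots>" .
    qed (use that in auto)
  qed
  obtain M N where M: "finite_measure M" "sets M = sets borel" and N: "finite_measure N" "sets N = sets borel"
    and MN: "\<And>\<phi>. \<phi> \<in> test_funs \<Longrightarrow> (LINT x|lebesgue. u x * partial_deriv i \<phi> x) = - ((LINT x|M. \<phi> x) - (LINT x|N. \<phi> x))"
    using u by (auto simp: distr_partial_is_measure_def)
  consider "c > 0" | "c < 0" | "c = 0" by linarith
  then show ?thesis
  proof cases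
    case 1
    then show ?thesis using *[OF M N refl, of c] MN by simp
  next
    case 2
    then show ?thesis using *[OF N M refl, of c] MN by simp
  next
    case 3
    show ?thesis
      unfolding distr_partial_is_measure_def
      by (rule exI[of _ M], rule exI[of _ M]) (use M 3 in simp)
  qed
qed

lemma BV_add:
  fixes u v :: "real ^ 'n \<Rightarrow> real"
  shows "u \<in> BV \<Longrightarrow> v \<in> BV \<Longrightarrow> (\<lambda>x. u x + v x) \<in> BV"
  using pq BV_Lp[of u] BV_Lp[of v] by (auto simp: BV_def Lp_add distr_partial_add simp flip: p_def)

lemma BV_cmult:
  fixes u :: "real ^ 'n \<Rightarrow> real"
  shows "u \<in> BV \<Longrightarrow> (\<lambda>x. c * u x) \<in> BV"
  by (auto simp: BV_def Lp_cmult distr_partial_cmult)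

lemma zero_BV: "(\<lambda>_ :: real ^ 'n. 0) \<in> BV"
proof -
  have "finite_measure (null_measure borel :: (real ^ 'n) measure)" by (intro finite_measureI) simp
  then show ?thesis
    unfolding BV_def distr_partial_is_measure_def
    by (auto simp: zero_Lp intro!: exI[of _ "null_measure borel"])
qed

lemma integral_divergence:
  fixes u :: "real ^ 'n \<Rightarrow> real"
  assumes "u \<in> Lp p" "v \<in> test_fields"
  shows "integrable lebesgue (\<lambda>x. u x * divergence v x)"
    and "(LINT x|lebesgue. u x * divergence v x) = (\<Sum>i\<in>UNIV. LINT x|lebesgue. u x * partial_deriv i (\<lambda>y. v y $ i) x)"
proof -
  have "integrable lebesgue (\<lambda>x. u x * partial_deriv i (\<lambda>y. v y $ i) x)" for i
    using assms by (intro integrable_Lp_partial_deriv) (auto simp: test_fields_def)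
  then show "integrable lebesgue (\<lambda>x. u x * divergence v x)"
    and "(LINT x|lebesgue. u x * divergence v x) = (\<Sum>i\<in>UNIV. LINT x|lebesgue. u x * partial_deriv i (\<lambda>y. v y $ i) x)"
    by (auto simp: divergence_def sum_distrib_left)
qed

text \<open>The supremum defining \<open>TV\<close> is meaningful only if bounded above. A bound is
  the total mass of all measures representing the partial derivatives, since each component of an
  admissible field is at most 1 in absolute value.\<close>

lemma integral_divergence_le_TV:
  fixes u :: "real ^ 'n \<Rightarrow> real"
  assumes u: "u \<in> BV" and v: "v \<in> test_fields" "\<And>x. norm (v x) \<le> 1"
  shows "(LINT x|lebesgue. u x * divergence v x) \<le> TV u"
  unfolding TV_def
proof (rule cSUP_upper)
  have "\<forall>i. \<exists>M N. finite_measure M \<and> sets M = sets borel \<and> finite_measure N \<and> sets N = sets borel \<and>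
      (\<forall>\<phi>\<in>test_funs. (LINT x|lebesgue. u x * partial_deriv i \<phi> x) = - ((LINT x|M. \<phi> x) - (LINT x|N. \<phi> x)))"
    using u by (simp add: BV_def distr_partial_is_measure_def)
  from choice[OF this] obtain M where "\<forall>i. \<exists>N. finite_measure (M i) \<and> sets (M i) = sets borel \<and> finite_measure N \<and> sets N = sets borel \<and>
      (\<forall>\<phi>\<in>test_funs. (LINT x|lebesgue. u x * partial_deriv i \<phi> x) = - ((LINT x|M i. \<phi> x) - (LINT x|N. \<phi> x)))" ..
  from choice[OF this] obtain N where MN0: "\<forall>i. finite_measure (M i) \<and> sets (M i) = sets borel \<and> finite_measure (N i) \<and> sets (N i) = sets borel \<and>
      (\<forall>\<phi>\<in>test_funs. (LINT x|lebesgue. u x * partial_deriv i \<phi> x) = - ((LINT x|M i. \<phi> x) - (LINT x|N i. \<phi> x)))" ..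
  have M: "\<And>i. finite_measure (M i)" "\<And>i. sets (M i) = sets borel"
    and N: "\<And>i. finite_measure (N i)" "\<And>i. sets (N i) = sets borel"
    and MN: "\<And>i \<phi>. \<phi> \<in> test_funs \<Longrightarrow> (LINT x|lebesgue. u x * partial_deriv i \<phi> x) = - ((LINT x|M i. \<phi> x) - (LINT x|N i. \<phi> x))"
    using MN0 by blast+
  have le: "\<bar>LINT x|L. \<phi> x\<bar> \<le> measure L UNIV"
    if "finite_measure L" "sets L = sets borel" "\<phi> \<in> test_funs" "\<And>x. \<bar>\<phi> x\<bar> \<le> 1"
    for L and \<phi> :: "real ^ 'n \<Rightarrow> real"
  proof -
    have "norm (LINT x|L. \<phi> x) \<le> (LINT x|L. 1)"
      using that finite_measure.integrable_const[OF that(1)]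
      by (intro Bochner_Integration.integral_norm_bound_integral integrable_test_fun[OF that(1-3)]) auto
    moreover have "space L = UNIV" using sets_eq_imp_space_eq[OF that(2)] by simp
    ultimately show ?thesis by simp
  qed
  show "bdd_above ((\<lambda>v. LINT x|lebesgue. u x * divergence v x) ` {v \<in> test_fields. \<forall>x. norm (v x) \<le> 1})"
  proof (rule bdd_aboveI2)
    fix v :: "real ^ 'n \<Rightarrow> real ^ 'n" assume v: "v \<in> {v \<in> test_fields. \<forall>x. norm (v x) \<le> 1}"
    have comp: "(\<lambda>x. v x $ i) \<in> test_funs" "\<bar>v x $ i\<bar> \<le> 1" for i x
      using v order_trans[OF component_le_norm_cart, of "v x" 1 i] by (auto simp: test_fields_def)
    have "(LINT x|lebesgue. u x * divergence v x) = (\<Sum>i\<in>UNIV. - ((LINT x|M i. v x $ i) - (LINT x|N i. v x $ i)))"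
      using v by (subst integral_divergence[OF BV_Lp[OF u]]) (auto simp: MN comp)
    also have "\<dots> \<le> (\<Sum>i\<in>UNIV. measure (M i) UNIV + measure (N i) UNIV)"
    proof (rule sum_mono)
      fix i
      show "- ((LINT x|M i. v x $ i) - (LINT x|N i. v x $ i)) \<le> measure (M i) UNIV + measure (N i) UNIV"
      proof -
        have "\<bar>LINT x|M i. v x $ i\<bar> \<le> measure (M i) UNIV" "\<bar>LINT x|N i. v x $ i\<bar> \<le> measure (N i) UNIV"
          by (rule le[OF M comp], rule le[OF N comp])
        then show ?thesis by linarith
      qed
    qed
    finally show "(LINT x|lebesgue. u x * divergence v x) \<le> (\<Sum>i\<in>UNIV. measure (M i) UNIV + measure (N i) UNIV)" .
  qed
qed (use v in auto)

lemma zero_test_field: "(\<lambda>_. 0) \<in> {v \<in> test_fields. \<forall>x. norm (v x) \<le> 1}"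
  by (simp add: test_fields_def zero_test_fun)

lemma TV_nonneg:
  fixes u :: "real ^ 'n \<Rightarrow> real"
  assumes "u \<in> BV"
  shows "TV u \<ge> 0"
  using integral_divergence_le_TV[OF assms, of "\<lambda>_. 0"] zero_test_field by (auto simp: divergence_def)

lemma TV_leI:
  assumes "\<And>v. v \<in> test_fields \<Longrightarrow> (\<And>x. norm (v x) \<le> 1) \<Longrightarrow> (LINT x|lebesgue. u x * divergence v x) \<le> B"
  shows "TV u \<le> B"
  unfolding TV_def by (rule cSUP_least) (use zero_test_field assms in blast)+

lemma TV_add:
  fixes u v :: "real ^ 'n \<Rightarrow> real"
  assumes u: "u \<in> BV" and v: "v \<in> BV"
  shows "TV (\<lambda>x. u x + v x) \<le> TV u + TV v"
proof (rule TV_leI)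
  fix w :: "real ^ 'n \<Rightarrow> real ^ 'n" assume w: "w \<in> test_fields" "\<And>x. norm (w x) \<le> 1"
  have "(LINT x|lebesgue. (u x + v x) * divergence w x) =
      (LINT x|lebesgue. u x * divergence w x) + (LINT x|lebesgue. v x * divergence w x)"
    using integral_divergence(1)[OF BV_Lp[OF u] w(1)] integral_divergence(1)[OF BV_Lp[OF v] w(1)]
    by (simp add: distrib_right)
  then show "(LINT x|lebesgue. (u x + v x) * divergence w x) \<le> TV u + TV v"
    using integral_divergence_le_TV[OF u w] integral_divergence_le_TV[OF v w] by simp
qed

lemma TV_cmult:
  fixes u :: "real ^ 'n \<Rightarrow> real"
  assumes u: "u \<in> BV"
  shows "TV (\<lambda>x. c * u x) \<le> \<bar>c\<bar> * TV u"
proof (rule TV_leI)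
  fix w :: "real ^ 'n \<Rightarrow> real ^ 'n" assume w: "w \<in> test_fields" "\<And>x. norm (w x) \<le> 1"
  \<comment> \<open>The sign of \<open>c\<close> is absorbed into the test field, whose norm it
    leaves unchanged.\<close>
  define s where "s = (if c < 0 then - 1 else 1 :: real)"
  have sc: "c = \<bar>c\<bar> * s" by (simp add: s_def)
  have comp: "(\<lambda>x. w x $ i) \<in> test_funs" for i using w(1) by (simp add: test_fields_def)
  have "divergence (\<lambda>x. s *\<^sub>R w x) x = s * divergence w x" for x
    using partial_deriv_cmult[OF test_fun_differentiable[OF comp]] by (simp add: divergence_def sum_distrib_left)
  then have "(LINT x|lebesgue. c * u x * divergence w x) = (LINT x|lebesgue. \<bar>c\<bar> * (u x * divergence (\<lambda>x. s *\<^sub>R w x) x))"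
    by (subst sc) (simp add: ac_simps)
  also have "\<dots> = \<bar>c\<bar> * (LINT x|lebesgue. u x * divergence (\<lambda>x. s *\<^sub>R w x) x)" by simp
  also have "\<dots> \<le> \<bar>c\<bar> * TV u"
    using w test_fun_cmult[OF comp]
    by (intro mult_left_mono integral_divergence_le_TV u) (auto simp: test_fields_def s_def)
  finally show "(LINT x|lebesgue. c * u x * divergence w x) \<le> \<bar>c\<bar> * TV u" .
qed

text \<open>Reduction to Borel representatives, with \<open>V = TV u\<close>: changing
  \<open>u\<close> and \<open>f\<close> on a null set affects none of the integrals
  involved.\<close>

theorem Sobolev_BV:
  fixes u f :: "real ^ 'n \<Rightarrow> real"
  assumes u: "u \<in> BV" and f: "f \<in> Lp q"
  shows "\<bar>LINT x|lebesgue. u x * f x\<bar> \<le> TV u * Lp_norm q f"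
proof -
  have u_Lp: "u \<in> Lp p" by (rule BV_Lp[OF u])
  then have um [measurable]: "u \<in> borel_measurable lebesgue" by (simp add: Lp_def)
  have fm [measurable]: "f \<in> borel_measurable lebesgue" using f by (simp add: Lp_def)
  obtain u' where u' [measurable]: "u' \<in> borel_measurable borel" and uu': "AE x in lebesgue. u x = u' x"
    using AE_lebesgue_borel_version[OF um] by metis
  obtain f' where f' [measurable]: "f' \<in> borel_measurable borel" and ff': "AE x in lebesgue. f x = f' x"
    using AE_lebesgue_borel_version[OF fm] by metis
  have int_u': "integrable lborel (\<lambda>x. \<bar>u' x\<bar> powr p)"
  proof (subst lebesgue_integral_borel_version(2)[symmetric, of "\<lambda>x. \<bar>u x\<bar> powr p"])
    show "AE x in lebesgue. \<bar>u x\<bar> powr p = \<bar>u' x\<bar> powr p" using uu' by eventually_elim simp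
  qed (use u_Lp in \<open>auto simp: Lp_def\<close>)
  have AEf: "AE x in lebesgue. \<bar>f x\<bar> powr q = \<bar>f' x\<bar> powr q" using ff' by eventually_elim simp
  have int_f': "integrable lborel (\<lambda>x. \<bar>f' x\<bar> powr q)"
    using f by (subst lebesgue_integral_borel_version(2)[symmetric, OF _ _ AEf]) (auto simp: Lp_def)
  have V: "(LINT x|lborel. u' x * partial_deriv i \<phi> x) \<le> TV u"
    if \<phi>: "\<phi> \<in> test_funs" "\<And>x. \<bar>\<phi> x\<bar> \<le> 1" for i \<phi>
  proof -
    \<comment> \<open>A scalar test function bounded by 1, pointing along axis \<open>i\<close>, is
      an admissible field with divergence \<open>partial_deriv i \<phi>\<close>; hence
      \<open>TV u\<close> bounds every single directional derivative.\<close>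
    define v where "v x = \<phi> x *\<^sub>R axis i (1::real)" for x
    have comp: "(\<lambda>x. v x $ j) = (if j = i then \<phi> else (\<lambda>_. 0))" for j
      by (auto simp: v_def axis_def)
    have v: "v \<in> test_fields" using \<phi> zero_test_fun by (auto simp: test_fields_def comp)
    have div: "divergence v x = partial_deriv i \<phi> x" for x
    proof -
      have "divergence v x = (\<Sum>j\<in>UNIV. if j = i then partial_deriv j \<phi> x else 0)"
        unfolding divergence_def comp by (intro sum.cong) auto
      then show ?thesis by simp
    qed
    have [measurable]: "partial_deriv i \<phi> \<in> borel_measurable borel"
      by (intro test_fun_measurable partial_deriv_test_fun \<phi>)
    then have [measurable]: "partial_deriv i \<phi> \<in> borel_measurable lebesgue" by (auto intro: measurable_completion)
    have "AE x in lebesgue. u x * partial_deriv i \<phi> x = u' x * partial_deriv i \<phi> x"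
      using uu' by eventually_elim simp
    then have "(LINT x|lborel. u' x * partial_deriv i \<phi> x) = (LINT x|lebesgue. u x * partial_deriv i \<phi> x)"
      by (intro lebesgue_integral_borel_version(1)[symmetric]) auto
    also have "\<dots> \<le> TV u"
      using integral_divergence_le_TV[OF u v] \<phi>(2) by (simp add: div v_def)
    finally show ?thesis .
  qed
  have "AE x in lebesgue. u x * f x = u' x * f' x" using uu' ff' by eventually_elim simp
  then have "(LINT x|lebesgue. u x * f x) = (LINT x|lborel. u' x * f' x)"
    by (intro lebesgue_integral_borel_version(1)) auto
  also have "\<bar>\<dots>\<bar> \<le> TV u * (LINT x|lborel. \<bar>f' x\<bar> powr q) powr (1 / q)"
    using int_u' int_f' unfolding p_def q_def by (intro Sobolev_dual dim2 u' f' TV_nonneg u V)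
  also have "(LINT x|lborel. \<bar>f' x\<bar> powr q) = (LINT x|lebesgue. \<bar>f x\<bar> powr q)"
    by (rule lebesgue_integral_borel_version(1)[symmetric, OF _ _ AEf]) auto
  finally show ?thesis by (simp add: Lp_norm_def)
qed

end

section \<open>Forms dominated on a subspace of finite codimension\<close>

text \<open>Pure linearity relative to a set, so that it can be restricted to common kernels inside
  \<open>BV\<close>.\<close>

definition linear_form_on :: "('a \<Rightarrow> real) set \<Rightarrow> (('a \<Rightarrow> real) \<Rightarrow> real) \<Rightarrow> bool" where
  "linear_form_on X F \<longleftrightarrow>
    (\<forall>u\<in>X. \<forall>v\<in>X. F (\<lambda>x. u x + v x) = F u + F v) \<and> (\<forall>c. \<forall>u\<in>X. F (\<lambda>x. c * u x) = c * F u)"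

lemma linear_form_onD:
  assumes "linear_form_on X F"
  shows "u \<in> X \<Longrightarrow> v \<in> X \<Longrightarrow> F (\<lambda>x. u x + v x) = F u + F v"
    and "u \<in> X \<Longrightarrow> F (\<lambda>x. c * u x) = c * F u"
  using assms by (auto simp: linear_form_on_def)

lemma linear_form_on_subset: "linear_form_on X F \<Longrightarrow> Y \<subseteq> X \<Longrightarrow> linear_form_on Y F"
  by (auto simp: linear_form_on_def subset_iff)

lemma linear_form_on_diff_scale:
  assumes "linear_form_on X F" "linear_form_on X G"
  shows "linear_form_on X (\<lambda>u. F u - c * G u)"
  using assms by (simp add: linear_form_on_def algebra_simps)

text \<open>One step of the Hahn--Banach extension, from the kernel of \<open>G\<close> to the whole space.\<close>

lemma dominated_modulo_form:
  fixes X :: "('a \<Rightarrow> real) set"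
  assumes add: "\<And>u v. u \<in> X \<Longrightarrow> v \<in> X \<Longrightarrow> (\<lambda>x. u x + v x) \<in> X"
    and cmult: "\<And>c u. u \<in> X \<Longrightarrow> (\<lambda>x. c * u x) \<in> X"
    and p_add: "\<And>u v. u \<in> X \<Longrightarrow> v \<in> X \<Longrightarrow> p (\<lambda>x. u x + v x) \<le> p u + p v"
    and p_cmult: "\<And>c u. u \<in> X \<Longrightarrow> p (\<lambda>x. c * u x) \<le> \<bar>c\<bar> * p u"
    and F: "linear_form_on X F" and G: "linear_form_on X G"
    and ker: "\<And>u. u \<in> X \<Longrightarrow> G u = 0 \<Longrightarrow> \<bar>F u\<bar> \<le> p u"
  shows "\<exists>c. \<forall>u\<in>X. \<bar>F u - c * G u\<bar> \<le> p u"
proof (cases "\<forall>u\<in>X. G u = 0")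
  case True
  then show ?thesis using ker by (intro exI[of _ 0]) auto
next
  case False
  then obtain u1 where u1: "u1 \<in> X" "G u1 \<noteq> 0" by blast
  \<comment> \<open>By homogeneity it suffices to control \<open>F - c\<close> on the affine
    hyperplane where \<open>G\<close> equals 1. Differences of its points lie in the kernel of
    \<open>G\<close>, where domination is known.\<close>
  define Y where "Y = {v \<in> X. G v = 1}"
  have "(\<lambda>x. inverse (G u1) * u1 x) \<in> Y"
    using u1 cmult linear_form_onD(2)[OF G] by (simp add: Y_def)
  then have Y_ne: "Y \<noteq> {}" by blast
  have le: "F v - p v \<le> F w + p w" if "v \<in> Y" "w \<in> Y" for v w
  proof -
    have v: "v \<in> X" "G v = 1" and w: "w \<in> X" "G w = 1" using that by (auto simp: Y_def)
    have w': "(\<lambda>x. - 1 * w x) \<in> X" "G (\<lambda>x. - 1 * w x) = - 1" "F (\<lambda>x. - 1 * w x) = - F w" "p (\<lambda>x. - 1 * w x) \<le> p w"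
      using cmult[OF w(1), of "- 1"] linear_form_onD(2)[OF G w(1), of "- 1"] linear_form_onD(2)[OF F w(1), of "- 1"]
        p_cmult[OF w(1), of "- 1"] w(2) by simp_all
    have "G (\<lambda>x. v x + - 1 * w x) = 0" using linear_form_onD(1)[OF G v(1) w'(1)] v w' by simp
    then have "\<bar>F (\<lambda>x. v x + - 1 * w x)\<bar> \<le> p (\<lambda>x. v x + - 1 * w x)" by (intro ker add v w')
    also have "\<dots> \<le> p v + p w" using p_add[OF v(1) w'(1)] w'(4) by simp
    finally show ?thesis using linear_form_onD(1)[OF F v(1) w'(1)] w'(3) by simp
  qed
  \<comment> \<open>Any number separating the values \<open>F v - p v\<close> from the values
    \<open>F w + p w\<close> over \<open>Y\<close> would do; the supremum of the former is
    one.\<close>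
  define c where "c = (SUP v\<in>Y. F v - p v)"
  have c1: "F v - p v \<le> c" if "v \<in> Y" for v
    unfolding c_def using that le by (intro cSUP_upper bdd_aboveI2[where M = "F v + p v"]) auto
  have c2: "c \<le> F v + p v" if "v \<in> Y" for v
    unfolding c_def using that le Y_ne by (intro cSUP_least) auto
  have "\<bar>F u - c * G u\<bar> \<le> p u" if u: "u \<in> X" for u
  proof (cases "G u = 0")
    case True
    then show ?thesis using ker u by simp
  next
    case False
    \<comment> \<open>Division by \<open>t\<close> moves \<open>u\<close> to \<open>Y\<close>;
      multiplication by \<open>\<bar>t\<bar>\<close> afterwards returns the estimate to
      \<open>u\<close>.\<close>
    define t where "t = G u"
    have t: "t \<noteq> 0" using False by (simp add: t_def)
    let ?v = "\<lambda>x. inverse t * u x"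
    have v: "?v \<in> Y" using cmult[OF u] linear_form_onD(2)[OF G u, of "inverse t"] t by (simp add: Y_def t_def)
    have "\<bar>F ?v - c\<bar> \<le> p ?v" using c1[OF v] c2[OF v] by (simp add: abs_le_iff)
    also have "\<dots> \<le> \<bar>inverse t\<bar> * p u" by (rule p_cmult[OF u])
    finally have "\<bar>inverse t * F u - c\<bar> \<le> \<bar>inverse t\<bar> * p u"
      by (simp only: linear_form_onD(2)[OF F u])
    then have "\<bar>t\<bar> * \<bar>inverse t * F u - c\<bar> \<le> \<bar>t\<bar> * (\<bar>inverse t\<bar> * p u)" by (rule mult_left_mono) simp
    moreover have "t * (inverse t * F u - c) = F u - c * t" using t by (simp add: field_simps)
    then have "\<bar>t\<bar> * \<bar>inverse t * F u - c\<bar> = \<bar>F u - c * t\<bar>" by (simp flip: abs_mult)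
    moreover have "\<bar>t\<bar> * (\<bar>inverse t\<bar> * p u) = p u" using t by (simp add: abs_inverse)
    ultimately have "\<bar>F u - c * t\<bar> \<le> p u" by linarith
    then show ?thesis by (simp add: t_def)
  qed
  then show ?thesis by blast
qed

text \<open>Induction on \<open>E\<close>, for all \<open>F\<close> at once, because each step
  replaces \<open>F\<close> by \<open>F\<close> minus a multiple of the form just removed.\<close>

theorem dominated_modulo_forms:
  fixes X :: "('a \<Rightarrow> real) set"
  assumes "finite E"
    and add: "\<And>u v. u \<in> X \<Longrightarrow> v \<in> X \<Longrightarrow> (\<lambda>x. u x + v x) \<in> X"
    and cmult: "\<And>c u. u \<in> X \<Longrightarrow> (\<lambda>x. c * u x) \<in> X"
    and p_add: "\<And>u v. u \<in> X \<Longrightarrow> v \<in> X \<Longrightarrow> p (\<lambda>x. u x + v x) \<le> p u + p v"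
    and p_cmult: "\<And>c u. u \<in> X \<Longrightarrow> p (\<lambda>x. c * u x) \<le> \<bar>c\<bar> * p u"
    and "linear_form_on X F" and "\<And>e. e \<in> E \<Longrightarrow> linear_form_on X (\<Lambda> e)"
    and "\<And>u. u \<in> X \<Longrightarrow> (\<And>e. e \<in> E \<Longrightarrow> \<Lambda> e u = 0) \<Longrightarrow> \<bar>F u\<bar> \<le> p u"
  shows "\<exists>a. \<forall>u\<in>X. \<bar>F u - (\<Sum>e\<in>E. a e * \<Lambda> e u)\<bar> \<le> p u"
  using assms(1,6-)
proof (induction E arbitrary: F rule: finite_induct)
  case empty
  then show ?case by simp
next
  case (insert e E)
  \<comment> \<open>On the common kernel of the forms from \<open>E\<close>, only
    \<open>\<Lambda> e\<close> still separates \<open>F\<close> from being dominated, so the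
    one-form case applies there.\<close>
  define N where "N = {u \<in> X. \<forall>e'\<in>E. \<Lambda> e' u = 0}"
  have NX: "N \<subseteq> X" by (auto simp: N_def)
  have lin: "linear_form_on X (\<Lambda> e')" if "e' \<in> insert e E" for e' by (rule insert.prems(2)[OF that])
  have "\<exists>c. \<forall>u\<in>N. \<bar>F u - c * \<Lambda> e u\<bar> \<le> p u"
  proof (rule dominated_modulo_form)
    show "(\<lambda>x. u x + v x) \<in> N" if "u \<in> N" "v \<in> N" for u v
      using that add linear_form_onD(1)[OF lin] by (auto simp: N_def)
    show "(\<lambda>x. c * u x) \<in> N" if "u \<in> N" for c u
      using that cmult linear_form_onD(2)[OF lin] by (auto simp: N_def)
    show "p (\<lambda>x. u x + v x) \<le> p u + p v" if "u \<in> N" "v \<in> N" for u v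
      using that p_add NX by blast
    show "p (\<lambda>x. c * u x) \<le> \<bar>c\<bar> * p u" if "u \<in> N" for c u
      using that p_cmult NX by blast
    show "linear_form_on N F" "linear_form_on N (\<Lambda> e)"
      using insert.prems(1) lin NX by (auto intro: linear_form_on_subset)
    show "\<bar>F u\<bar> \<le> p u" if "u \<in> N" "\<Lambda> e u = 0" for u
      using that by (intro insert.prems(3)) (auto simp: N_def)
  qed
  then obtain c where c: "\<And>u. u \<in> N \<Longrightarrow> \<bar>F u - c * \<Lambda> e u\<bar> \<le> p u" by blast
  \<comment> \<open>The choice of \<open>c\<close> makes \<open>F - c * \<Lambda> e\<close>
    dominated on the common kernel of \<open>E\<close>, which is exactly the hypothesis for the
    smaller set.\<close>
  have "\<exists>a. \<forall>u\<in>X. \<bar>(F u - c * \<Lambda> e u) - (\<Sum>e\<in>E. a e * \<Lambda> e u)\<bar> \<le> p u"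
    by (rule insert.IH) (use c insert.prems lin in \<open>auto simp: N_def intro: linear_form_on_diff_scale\<close>)
  then obtain a where a: "\<And>u. u \<in> X \<Longrightarrow> \<bar>(F u - c * \<Lambda> e u) - (\<Sum>e\<in>E. a e * \<Lambda> e u)\<bar> \<le> p u" by blast
  have "(\<Sum>e'\<in>insert e E. (a(e := c)) e' * \<Lambda> e' u) = c * \<Lambda> e u + (\<Sum>e\<in>E. a e * \<Lambda> e u)" for u
    using insert.hyps by (simp add: sum.insert) (intro sum.cong, auto)
  then show ?case using a by (intro exI[of _ "a(e := c)"]) (simp only: diff_diff_eq, blast)
qed

section \<open>The two inclusions\<close>

context bv_space
begin

lemma linear_form_on_integral:
  fixes f :: "real ^ 'n \<Rightarrow> real"
  assumes f: "f \<in> Lp q"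
  shows "linear_form_on BV (\<lambda>u. LINT x|lebesgue. u x * f x)"
  unfolding linear_form_on_def
proof (intro conjI ballI allI)
  fix u v :: "real ^ 'n \<Rightarrow> real" and c :: real assume u: "u \<in> BV" and v: "v \<in> BV"
  show "(LINT x|lebesgue. (u x + v x) * f x) = (LINT x|lebesgue. u x * f x) + (LINT x|lebesgue. v x * f x)"
    using integrable_Lp_mult[OF BV_Lp[OF u] f] integrable_Lp_mult[OF BV_Lp[OF v] f]
    by (simp add: distrib_right)
next
  fix u :: "real ^ 'n \<Rightarrow> real" and c :: real
  show "(LINT x|lebesgue. c * u x * f x) = c * (LINT x|lebesgue. u x * f x)" by (simp add: mult.assoc)
qed

text \<open>Homogeneity reduces to \<open>TV u \<le> 1\<close>. The auxiliary bound by
  \<open>C * TV u\<close> makes the supremum in \<open>BV_dual_norm\<close> a genuine one and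
  settles the case \<open>TV u = 0\<close>, where \<open>u\<close> cannot be normalised.\<close>

lemma BV_dual_norm_less_imp_le:
  fixes G :: "(real ^ 'n \<Rightarrow> real) \<Rightarrow> real"
  assumes G: "linear_form_on BV G" and bdd: "\<And>u. u \<in> BV \<Longrightarrow> \<bar>G u\<bar> \<le> C * TV u"
    and less: "BV_dual_norm G < e" and u: "u \<in> BV"
  shows "\<bar>G u\<bar> \<le> e * TV u"
proof (cases "TV u = 0")
  case True
  then show ?thesis using bdd[OF u] by simp
next
  case False
  then have pos: "TV u > 0" using TV_nonneg[OF u] by simp
  define v where "v x = 1 / TV u * u x" for x
  have v: "v \<in> BV" unfolding v_def by (rule BV_cmult[OF u])
  have "TV v \<le> \<bar>1 / TV u\<bar> * TV u" unfolding v_def by (rule TV_cmult[OF u])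
  then have TV1: "TV v \<le> 1" using pos by simp
  have "\<bar>G v\<bar> \<le> BV_dual_norm G"
    unfolding BV_dual_norm_def
  proof (rule cSUP_upper)
    show "bdd_above ((\<lambda>u. \<bar>G u\<bar>) ` {u \<in> BV. TV u \<le> 1})"
    proof (rule bdd_aboveI2)
      fix w :: "real ^ 'n \<Rightarrow> real" assume "w \<in> {u \<in> BV. TV u \<le> 1}"
      then have w: "w \<in> BV" "TV w \<le> 1" by auto
      have "\<bar>G w\<bar> \<le> C * TV w" by (rule bdd[OF w(1)])
      also have "\<dots> \<le> \<bar>C\<bar> * 1" using w TV_nonneg[OF w(1)] by (intro mult_mono) auto
      finally show "\<bar>G w\<bar> \<le> \<bar>C\<bar>" by simp
    qed
  qed (use v TV1 in simp)
  moreover have "G v = 1 / TV u * G u" unfolding v_def by (rule linear_form_onD(2)[OF G u])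
  ultimately have "\<bar>G u\<bar> / TV u < e" using less pos by (simp add: abs_divide)
  then show ?thesis using pos by (simp add: field_simps)
qed

lemma BV_dual_norm_leI:
  fixes G :: "(real ^ 'n \<Rightarrow> real) \<Rightarrow> real"
  assumes "e \<ge> 0" "\<And>u. u \<in> BV \<Longrightarrow> \<bar>G u\<bar> \<le> e * TV u"
  shows "BV_dual_norm G \<le> e"
  unfolding BV_dual_norm_def
proof (rule cSUP_least)
  have "TV (\<lambda>_ :: real ^ 'n. 0) \<le> 0" by (rule TV_leI) simp
  then have "(\<lambda>_ :: real ^ 'n. 0) \<in> {u \<in> BV. TV u \<le> 1}" using zero_BV by simp
  then show "{u \<in> BV. TV u \<le> 1} \<noteq> ({} :: (real ^ 'n \<Rightarrow> real) set)" by blast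
  fix u :: "real ^ 'n \<Rightarrow> real" assume u: "u \<in> {u \<in> BV. TV u \<le> 1}"
  then have "\<bar>G u\<bar> \<le> e * TV u" using assms(2) by simp
  also have "\<dots> \<le> e * 1" using u assms(1) by (intro mult_left_mono) auto
  finally show "\<bar>G u\<bar> \<le> e" by simp
qed

text \<open>The indicator of the unit cube. It fills the non-empty set \<open>E\<close> when the
  approximating function has norm 0 and cannot be normalised.\<close>

lemma unit_Lp_exists: "\<exists>f :: real ^ 'n \<Rightarrow> real. f \<in> Lp q \<and> Lp_norm q f = 1"
proof (intro exI conjI)
  let ?f = "indicator (cbox 0 One) :: real ^ 'n \<Rightarrow> real"
  have pw: "?f x powr q = ?f x" for x by (simp add: indicator_def)
  have int: "integrable lebesgue ?f" by (intro integrable_real_indicator) (auto simp: emeasure_lborel_cbox_eq)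
  then show "?f \<in> Lp q" using borel_measurable_integrable[OF int] by (simp add: Lp_def pw)
  show "Lp_norm q ?f = 1" by (simp add: Lp_norm_def pw)
qed

lemma BV_linear_form_on: "BV_linear_form F \<Longrightarrow> linear_form_on (BV :: (real ^ 'n \<Rightarrow> real) set) F"
  unfolding BV_linear_form_def linear_form_on_def by blast

text \<open>A single function suffices for \<open>E\<close>: the approximating \<open>f\<close>
  divided by its norm, with that norm as \<open>\<theta>\<close>.\<close>

lemma SCH0_subset: "(SCH0 :: ((real ^ 'n \<Rightarrow> real) \<Rightarrow> real) set) \<subseteq> SCH0W"
proof
  fix F :: "(real ^ 'n \<Rightarrow> real) \<Rightarrow> real" assume F: "F \<in> SCH0"
  then have lin: "BV_linear_form F" and "F \<in> BV_dual" by (auto simp: SCH0_def BV_dual_def)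
  then obtain C where C: "\<And>u. u \<in> BV \<Longrightarrow> \<bar>F u\<bar> \<le> C * TV u" by (auto simp: BV_dual_def)
  have "\<exists>E \<theta>. finite E \<and> E \<noteq> {} \<and> E \<subseteq> {f \<in> Lp q. Lp_norm q f = 1} \<and> \<theta> > 0 \<and>
      (\<forall>u\<in>BV. \<bar>F u\<bar> \<le> \<theta> * Max ((\<lambda>f. \<bar>LINT x|lebesgue. u x * f x\<bar>) ` E) + e * TV u)" if e: "e > 0" for e
  proof -
    obtain f where f: "f \<in> Lp q" and less: "BV_dual_norm (\<lambda>u. F u - integral_form f u) < e"
      using F e by (auto simp: SCH0_def q_def)
    let ?G = "\<lambda>u. F u - integral_form f u"
    have form: "integral_form f u = (LINT x|lebesgue. u x * f x)" if "u \<in> BV" for u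
      using that by (simp add: integral_form_def)
    have "linear_form_on BV (integral_form f)"
      using linear_form_on_integral[OF f] BV_add BV_cmult by (simp add: linear_form_on_def form)
    from linear_form_on_diff_scale[OF BV_linear_form_on[OF lin] this, of 1]
    have G: "linear_form_on BV ?G" by simp
    \<comment> \<open>This is where the Sobolev inequality enters: without it the supremum defining
      the dual norm of the difference might not be bounded.\<close>
    have G_bdd: "\<bar>?G u\<bar> \<le> (C + Lp_norm q f) * TV u" if u: "u \<in> BV" for u
    proof -
      have "\<bar>?G u\<bar> \<le> \<bar>F u\<bar> + \<bar>LINT x|lebesgue. u x * f x\<bar>" using form[OF u] by simp
      then show ?thesis using C[OF u] Sobolev_BV[OF u f] by (simp add: algebra_simps)
    qed
    have est: "\<bar>F u\<bar> \<le> \<bar>LINT x|lebesgue. u x * f x\<bar> + e * TV u" if u: "u \<in> BV" for u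
      using BV_dual_norm_less_imp_le[OF G G_bdd less u] form[OF u] by linarith
    show ?thesis
    proof (cases "Lp_norm q f = 0")
      \<comment> \<open>By the Sobolev inequality the pairing with \<open>f\<close> then vanishes,
        so \<open>F\<close> is dominated by \<open>e * TV\<close> alone and any normalised
        \<open>f0\<close> may serve.\<close>
      case True
      obtain f0 :: "real ^ 'n \<Rightarrow> real" where f0: "f0 \<in> Lp q" "Lp_norm q f0 = 1" using unit_Lp_exists by blast
      have "\<bar>F u\<bar> \<le> 1 * Max ((\<lambda>f. \<bar>LINT x|lebesgue. u x * f x\<bar>) ` {f0}) + e * TV u" if u: "u \<in> BV" for u
        using est[OF u] Sobolev_BV[OF u f] True by simp
      then show ?thesis using f0 by (intro exI[of _ "{f0}"] exI[of _ 1]) auto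
    next
      case False
      define \<theta> where "\<theta> = Lp_norm q f"
      have \<theta>: "\<theta> > 0" using False by (simp add: \<theta>_def Lp_norm_def)
      define g where "g x = 1 / \<theta> * f x" for x
      have g: "g \<in> Lp q" unfolding g_def by (rule Lp_cmult[OF f])
      have "Lp_norm q g = 1"
      proof -
        have "(LINT x|lebesgue. \<bar>g x\<bar> powr q) = (1 / \<theta>) powr q * (LINT x|lebesgue. \<bar>f x\<bar> powr q)"
          using \<theta> by (simp add: g_def abs_mult powr_mult del: times_divide_eq_left)
        then have "Lp_norm q g = (1 / \<theta>) * \<theta>"
          using \<theta> pq by (simp add: Lp_norm_def powr_mult powr_powr \<theta>_def del: times_divide_eq_left)
        then show ?thesis using \<theta> by simp
      qed
      moreover have "\<bar>F u\<bar> \<le> \<theta> * Max ((\<lambda>f. \<bar>LINT x|lebesgue. u x * f x\<bar>) ` {g}) + e * TV u" if u: "u \<in> BV" for u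
      proof -
        have "(LINT x|lebesgue. u x * f x) = (LINT x|lebesgue. \<theta> * (u x * g x))"
          using \<theta> by (simp add: g_def)
        then have "\<bar>LINT x|lebesgue. u x * f x\<bar> = \<theta> * \<bar>LINT x|lebesgue. u x * g x\<bar>"
          using \<theta> by (simp add: abs_mult)
        then show ?thesis using est[OF u] by simp
      qed
      ultimately show ?thesis using g \<theta> by (intro exI[of _ "{g}"] exI[of _ \<theta>]) auto
    qed
  qed
  then show "F \<in> SCH0W" using lin by (simp add: SCH0W_def q_def)
qed

text \<open>The seminorm estimate is applied on the common kernel of the pairings with
  \<open>E\<close>, where the maximum is 0. The resulting coefficients assemble the approximating
  function as a linear combination of the members of \<open>E\<close>.\<close>

lemma SCH0W_subset: "(SCH0W :: ((real ^ 'n \<Rightarrow> real) \<Rightarrow> real) set) \<subseteq> SCH0"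
proof
  fix F :: "(real ^ 'n \<Rightarrow> real) \<Rightarrow> real" assume F: "F \<in> SCH0W"
  then have lin: "BV_linear_form F" by (simp add: SCH0W_def)
  have est: "\<exists>E \<theta>. finite E \<and> E \<noteq> {} \<and> E \<subseteq> {f \<in> Lp q. Lp_norm q f = 1} \<and> \<theta> > 0 \<and>
      (\<forall>u\<in>BV. \<bar>F u\<bar> \<le> \<theta> * Max ((\<lambda>f. \<bar>LINT x|lebesgue. u x * f x\<bar>) ` E) + e * TV u)" if "e > 0" for e
    using F that by (simp add: SCH0W_def q_def)
  have "F \<in> BV_dual"
  proof -
    \<comment> \<open>Boundedness of \<open>F\<close> uses the estimate with
      \<open>\<epsilon> = 1\<close>: every member of \<open>E\<close> has norm 1, so the maximum is
      at most \<open>TV u\<close> and \<open>\<theta> + 1\<close> is a bound for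
      \<open>F\<close>.\<close>
    obtain E \<theta> where E: "finite E" "E \<noteq> {}" "E \<subseteq> {f \<in> Lp q. Lp_norm q f = 1}" and \<theta>: "\<theta> > 0"
      and bound: "\<And>u. u \<in> BV \<Longrightarrow> \<bar>F u\<bar> \<le> \<theta> * Max ((\<lambda>f. \<bar>LINT x|lebesgue. u x * f x\<bar>) ` E) + 1 * TV u"
      using est[OF zero_less_one] by blast
    have "\<bar>F u\<bar> \<le> (\<theta> + 1) * TV u" if u: "u \<in> BV" for u
    proof -
      have "\<bar>LINT x|lebesgue. u x * f x\<bar> \<le> TV u" if "f \<in> E" for f
        using Sobolev_BV[OF u, of f] E(3) that by auto
      then have "Max ((\<lambda>f. \<bar>LINT x|lebesgue. u x * f x\<bar>) ` E) \<le> TV u" using E by (subst Max_le_iff) auto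
      then have "\<theta> * Max ((\<lambda>f. \<bar>LINT x|lebesgue. u x * f x\<bar>) ` E) \<le> \<theta> * TV u" using \<theta> by (intro mult_left_mono) auto
      then show ?thesis using bound[OF u] by (simp add: distrib_right)
    qed
    then show ?thesis using lin by (auto simp: BV_dual_def)
  qed
  moreover have "\<exists>f\<in>Lp q. BV_dual_norm (\<lambda>u. F u - integral_form f u) < e" if e: "e > 0" for e
  proof -
    \<comment> \<open>Half of \<open>e\<close> is used because the closure asks for a strict
      inequality, while the extension argument yields only a weak one.\<close>
    obtain E \<theta> where E: "finite E" "E \<noteq> {}" "E \<subseteq> {f \<in> Lp q. Lp_norm q f = 1}"
      and bound: "\<And>u. u \<in> BV \<Longrightarrow> \<bar>F u\<bar> \<le> \<theta> * Max ((\<lambda>f. \<bar>LINT x|lebesgue. u x * f x\<bar>) ` E) + e / 2 * TV u"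
      using est[of "e / 2"] e by auto
    have "\<exists>a. \<forall>u\<in>BV. \<bar>F u - (\<Sum>f\<in>E. a f * (LINT x|lebesgue. u x * f x))\<bar> \<le> e / 2 * TV u"
    proof (rule dominated_modulo_forms[OF E(1) BV_add BV_cmult _ _ BV_linear_form_on[OF lin]])
      fix u v :: "real ^ 'n \<Rightarrow> real" and c :: real assume u: "u \<in> BV"
      show "e / 2 * TV (\<lambda>x. c * u x) \<le> \<bar>c\<bar> * (e / 2 * TV u)"
        using mult_left_mono[OF TV_cmult[OF u, of c], of "e / 2"] e by (simp add: algebra_simps)
      show "e / 2 * TV (\<lambda>x. u x + v x) \<le> e / 2 * TV u + e / 2 * TV v" if "v \<in> BV"
        using mult_left_mono[OF TV_add[OF u that], of "e / 2"] e by (simp add: algebra_simps)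
      assume "\<And>f. f \<in> E \<Longrightarrow> (LINT x|lebesgue. u x * f x) = 0"
      then have "(\<lambda>f. \<bar>LINT x|lebesgue. u x * f x\<bar>) ` E = {0}" using E(2) by auto
      then show "\<bar>F u\<bar> \<le> e / 2 * TV u" using bound[OF u] by simp
    next
      fix f assume "f \<in> E"
      then show "linear_form_on BV (\<lambda>u. LINT x|lebesgue. u x * f x)" using E(3) by (intro linear_form_on_integral) auto
    qed
    then obtain a where a: "\<And>u. u \<in> BV \<Longrightarrow> \<bar>F u - (\<Sum>f\<in>E. a f * (LINT x|lebesgue. u x * f x))\<bar> \<le> e / 2 * TV u"
      by blast
    define g where "g x = (\<Sum>f\<in>E. a f * f x)" for x
    have "(\<lambda>x. \<Sum>f\<in>A. a f * f x) \<in> Lp q" if "finite A" "A \<subseteq> Lp q" for A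
      using that
    proof (induction A rule: finite_induct)
      case (insert f A)
      have "(\<lambda>x. a f * f x + (\<Sum>f\<in>A. a f * f x)) \<in> Lp q"
        using insert pq by (intro Lp_add Lp_cmult) auto
      then show ?case using insert.hyps by simp
    qed (simp add: zero_Lp)
    then have g: "g \<in> Lp q" unfolding g_def using E by auto
    \<comment> \<open>Linearity of the pairing in its second argument identifies the combination of
      forms with the single form given by \<open>g\<close>.\<close>
    have "integral_form g u = (\<Sum>f\<in>E. a f * (LINT x|lebesgue. u x * f x))" if u: "u \<in> BV" for u
    proof -
      have "integrable lebesgue (\<lambda>x. a f * (u x * f x))" if "f \<in> E" for f
        using E(3) that by (intro integrable_mult_right integrable_Lp_mult[OF BV_Lp[OF u]]) auto
      then have "(LINT x|lebesgue. (\<Sum>f\<in>E. a f * (u x * f x))) = (\<Sum>f\<in>E. LINT x|lebesgue. a f * (u x * f x))"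
        by (rule Bochner_Integration.integral_sum)
      then show ?thesis using u by (simp add: integral_form_def g_def sum_distrib_left mult.left_commute)
    qed
    then have "BV_dual_norm (\<lambda>u. F u - integral_form g u) \<le> e / 2"
      using a e by (intro BV_dual_norm_leI) auto
    then show ?thesis using g e by (intro bexI[of _ g]) auto
  qed
  ultimately show "F \<in> SCH0" by (simp add: SCH0_def q_def)
qed

end

theorem theorem5p2p5:
  assumes "CARD('n::finite) \<ge> 2"
  shows "(SCH0 :: ((real ^ 'n \<Rightarrow> real) \<Rightarrow> real) set) = SCH0W \<and>
         (\<forall>F \<in> (SCH0 :: ((real ^ 'n \<Rightarrow> real) \<Rightarrow> real) set). BV_dual_norm F = SCH0W_norm F)"
proof -
  interpret bv_space "TYPE('n)" by unfold_locales (rule assms)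
  show ?thesis
    unfolding BV_dual_norm_def SCH0W_norm_def using equalityI[OF SCH0_subset SCH0W_subset] by simp
qed

end
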